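(* Let $\xi$ and $\eta$ be mutually singular ($\mathbb{P}$-a.e.) invariant random measures on $\mathbb{R}$ with finite intensities $\lambda_\xi=\mathbb{E}\,\xi[0,1]$ and $\lambda_\eta=\mathbb{E}\,\eta[0,1]$ satisfying $\lambda_\xi=\lambda_\eta$. For $u\in[0,1]$ let $$\tau^u(s):=\inf\{t> s : u\,\xi\{s\}+\xi(s,t)\le \eta[s,t]\},\quad s\in\mathbb{R},$$ where $\inf\emptyset:=\infty$ and $\xi(s,t)$ is the $\xi$-mass of the open interval $(s,t)$. Then $$K(s,C):=\int_0^1\mathbf{1}\{\tau^u(s)\in C\}\,du,\quad s\in\mathbb{R},\ C\subset\mathbb{R}\text{ Borel},$$ defines a transport kernel balancing $\xi$ and $\eta$.
   Context: $(\Omega,\mathcal{F},\mathbb{P})$ is a $\sigma$-finite measure space with integral operator $\mathbb{E}$, equipped with a measurable flow $(\theta_s)_{s\in\mathbb{R}}$: mappings $\theta_s:\Omega\to\Omega$ such that $(\omega,s)\mapsto\theta_s\omega$ is measurable, $\theta_0$ is the identity and $\theta_s\circ\theta_t=\theta_{s+t}$. The measure $\mathbb{P}$ is stationary ($\mathbb{P}(\theta_sA)=\mathbb{P}(A)$ for all $s\in\mathbb{R}$, $A\in\mathcal{F}$) and ergodic (if $A\in\mathcal{F}$ satisfies $\theta_sA=A$ for all $s$, then $\mathbb{P}(A)=0$ or $\mathbb{P}(A^c)=0$). A random measure $\xi$ on $\mathbb{R}$ is a kernel from $\Omega$ to $\mathbb{R}$ such that, for $\mathbb{P}$-a.e. $\omega$,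 $\xi(\omega,C)<\infty$ for all compact $C\subset\mathbb{R}$. It is invariant if for $\mathbb{P}$-a.e. $\omega$: $\xi(\theta_t\omega,C-t)=\xi(\omega,C)$ for all Borel $C\subset\mathbb{R}$ and $t\in\mathbb{R}$. A transport kernel is a sub-Markovian kernel $K$ from $\Omega\times\mathbb{R}$ to $\mathbb{R}$ (the argument $\omega$ is usually suppressed). It balances $\xi$ and $\eta$ if $K(\omega,s,\mathbb{R})=1$ for almost every $(\omega,s)$ with respect to the measure $\xi(\omega,ds)\,\mathbb{P}(d\omega)$ and, $\mathbb{P}$-a.e., $\int K(s,\cdot)\,\xi(ds)=\eta$.
   Formalization: Added hypothesis: ξ(ℝ) is 0 or ∞ P-a.e. (automatic for finite P; without it the claim fails, e.g. unit masses at −ω and −ω−1 under Lebesgue P). K is shown to be a transport kernel on the full-measure set of ω where ξ and η are locally finite. *)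

theory Defs
  imports "HOL-Probability.Probability"
begin

locale ergodic_flow = sigma_finite_measure M
  for M :: "'a measure" +
  fixes \<theta> :: "real \<Rightarrow> 'a \<Rightarrow> 'a"
  assumes flow_measurable: "(\<lambda>(\<omega>, s). \<theta> s \<omega>) \<in> M \<Otimes>\<^sub>M borel \<rightarrow>\<^sub>M M"
    and flow_zero: "\<And>\<omega>. \<omega> \<in> space M \<Longrightarrow> \<theta> 0 \<omega> = \<omega>"
    and flow_add: "\<And>s t \<omega>. \<omega> \<in> space M \<Longrightarrow> \<theta> s (\<theta> t \<omega>) = \<theta> (s + t) \<omega>"
    and stationary: "\<And>s A. A \<in> sets M \<Longrightarrow> emeasure M (\<theta> s ` A) = emeasure M A"
    and ergodic: "\<And>A. A \<in> sets M \<Longrightarrow> (\<And>s. \<theta> s ` A = A) \<Longrightarrow>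
      emeasure M A = 0 \<or> emeasure M (space M - A) = 0"

definition locally_finite :: "real measure \<Rightarrow> bool" where
  "locally_finite \<mu> \<longleftrightarrow> (\<forall>C. compact C \<longrightarrow> emeasure \<mu> C < \<infinity>)"

definition random_measure :: "'a measure \<Rightarrow> ('a \<Rightarrow> real measure) \<Rightarrow> bool" where
  "random_measure M \<xi> \<longleftrightarrow>
     (\<forall>\<omega>\<in>space M. sets (\<xi> \<omega>) = sets borel) \<and>
     (\<forall>C\<in>sets borel. (\<lambda>\<omega>. emeasure (\<xi> \<omega>) C) \<in> borel_measurable M) \<and>
     (AE \<omega> in M. locally_finite (\<xi> \<omega>))"

definition invariant_random_measure ::
    "'a measure \<Rightarrow> (real \<Rightarrow> 'a \<Rightarrow> 'a) \<Rightarrow> ('a \<Rightarrow> real measure) \<Rightarrow> bool" where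
  "invariant_random_measure M \<theta> \<xi> \<longleftrightarrow> random_measure M \<xi> \<and>
     (AE \<omega> in M. \<forall>C\<in>sets borel. \<forall>t.
        emeasure (\<xi> (\<theta> t \<omega>)) ((\<lambda>x. x - t) ` C) = emeasure (\<xi> \<omega>) C)"

definition intensity :: "'a measure \<Rightarrow> ('a \<Rightarrow> real measure) \<Rightarrow> ennreal" where
  "intensity M \<xi> = (\<integral>\<^sup>+\<omega>. emeasure (\<xi> \<omega>) {0..1} \<partial>M)"

definition mutually_singular :: "real measure \<Rightarrow> real measure \<Rightarrow> bool" where
  "mutually_singular \<mu> \<nu> \<longleftrightarrow>
     (\<exists>A\<in>sets borel. emeasure \<mu> A = 0 \<and> emeasure \<nu> (UNIV - A) = 0)"

text \<open>Random measures are only a.e. locally finite, and off the set of \<open>\<omega>\<close> where this holds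
  \<open>(\<omega>, s) \<mapsto> \<xi> \<omega> {s}\<close> need not be jointly measurable.  A kernel built from random measures is
  therefore regarded as a transport kernel on the subspace of those \<open>\<omega>\<close> for which the random
  measures are locally finite (a subspace whose complement is null).\<close>

definition transport_kernel :: "'a measure \<Rightarrow> ('a \<Rightarrow> real \<Rightarrow> real measure) \<Rightarrow> bool" where
  "transport_kernel M K \<longleftrightarrow>
     (\<lambda>(\<omega>, s). K \<omega> s) \<in> M \<Otimes>\<^sub>M borel \<rightarrow>\<^sub>M subprob_algebra borel"

text \<open>The measure \<open>\<xi>(\<omega>, ds) M(d\<omega>)\<close> on the product space.\<close>

definition campbell_measure :: "'a measure \<Rightarrow> ('a \<Rightarrow> real measure) \<Rightarrow> ('a \<times> real) measure" where
  "campbell_measure M \<xi> = measure_of (space M \<times> UNIV) (sets (M \<Otimes>\<^sub>M borel))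
     (\<lambda>A. \<integral>\<^sup>+\<omega>. emeasure (\<xi> \<omega>) (Pair \<omega> -` A) \<partial>M)"

definition balances ::
    "'a measure \<Rightarrow> ('a \<Rightarrow> real \<Rightarrow> real measure) \<Rightarrow> ('a \<Rightarrow> real measure) \<Rightarrow> ('a \<Rightarrow> real measure) \<Rightarrow> bool" where
  "balances M K \<xi> \<eta> \<longleftrightarrow>
     (AE (\<omega>, s) in campbell_measure M \<xi>. emeasure (K \<omega> s) UNIV = 1) \<and>
     (AE \<omega> in M. \<forall>C\<in>sets borel. (\<integral>\<^sup>+s. emeasure (K \<omega> s) C \<partial>\<xi> \<omega>) = emeasure (\<eta> \<omega>) C)"

text \<open>On an infinite measure space balancing by \<open>K_tau\<close> below needs the additional assumption
  that \<open>\<xi> \<omega> UNIV \<in> {0, \<infinity>}\<close> for a.e. \<open>\<omega>\<close>, which is automatic for an invariant random measure when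
  \<open>M\<close> is finite.  Otherwise take \<open>M = lborel\<close>, \<open>\<theta> s \<omega> = \<omega> + s\<close>, and for \<open>\<xi> \<omega>\<close> and \<open>\<eta> \<omega>\<close> the
  unit point masses at \<open>- \<omega>\<close> and \<open>- \<omega> - 1\<close>: all other assumptions hold with intensities 1, but
  \<open>\<tau>\<^sup>u(- \<omega>) = \<infinity>\<close> for every \<open>u > 0\<close>, so that no mass of \<open>\<xi>\<close> is transported.\<close>

text \<open>The infimum is taken in the extended reals, where \<open>Inf {} = \<infinity>\<close>.\<close>

definition tau :: "real measure \<Rightarrow> real measure \<Rightarrow> real \<Rightarrow> real \<Rightarrow> ereal" where
  "tau \<mu> \<nu> u s = Inf (ereal ` {t. s < t \<and>
     ennreal u * emeasure \<mu> {s} + emeasure \<mu> {s<..<t} \<le> emeasure \<nu> {s..t}})"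

definition K_tau :: "('a \<Rightarrow> real measure) \<Rightarrow> ('a \<Rightarrow> real measure) \<Rightarrow> 'a \<Rightarrow> real \<Rightarrow> real measure" where
  "K_tau \<xi> \<eta> \<omega> s = measure_of UNIV (sets borel)
     (\<lambda>C. \<integral>\<^sup>+u\<in>{0..1}. indicator (ereal ` C) (tau (\<xi> \<omega>) (\<eta> \<omega>) u s) \<partial>lborel)"

text \<open>A set function passed to \<^const>\<open>measure_of\<close> is replaced by zero unless it is
  countably additive.  The lemmas below verify that \<^const>\<open>K_tau\<close> and
  \<^const>\<open>campbell_measure\<close> do have the intended values.\<close>

lemma mono_tau: "mono (\<lambda>u. tau \<mu> \<nu> u s)"
proof (rule monoI)
  fix u v :: real assume "u \<le> v"
  then have *: "ennreal u * a + b \<le> ennreal v * a + b" for a b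
    by (intro add_right_mono mult_right_mono ennreal_leI) auto
  show "tau \<mu> \<nu> u s \<le> tau \<mu> \<nu> v s"
    unfolding tau_def by (intro Inf_superset_mono image_mono) (use * in \<open>blast intro: order_trans\<close>)
qed

lemma measurable_tau [measurable]: "(\<lambda>u. tau \<mu> \<nu> u s) \<in> borel_measurable borel"
proof (rule borel_measurableI_ge)
  fix a
  let ?A = "{u. a \<le> tau \<mu> \<nu> u s}"
  have "mono (indicator ?A :: real \<Rightarrow> real)"
    using monoD[OF mono_tau] by (intro monoI) (auto simp: indicator_def intro: order_trans)
  then have "(indicator ?A :: real \<Rightarrow> real) \<in> borel_measurable borel"
    by (rule borel_measurable_mono)
  then show "{x \<in> space borel. a \<le> tau \<mu> \<nu> x s} \<in> sets borel"
    by (simp add: borel_measurable_indicator_iff)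
qed

lemma emeasure_K_tau:
  assumes "C \<in> sets borel"
  shows "emeasure (K_tau \<xi> \<eta> \<omega> s) C =
    (\<integral>\<^sup>+u\<in>{0..1}. indicator (ereal ` C) (tau (\<xi> \<omega>) (\<eta> \<omega>) u s) \<partial>lborel)"
proof -
  let ?f = "\<lambda>C u. indicator (ereal ` C) (tau (\<xi> \<omega>) (\<eta> \<omega>) u s) * indicator {0..1} u :: ennreal"
  have meas: "?f C \<in> borel_measurable lborel" if "C \<in> sets borel" for C
  proof -
    have [measurable]: "ereal ` C \<in> sets borel"
    proof -
      have "ereal ` C = {x \<in> space borel. \<bar>x\<bar> \<noteq> \<infinity> \<and> real_of_ereal x \<in> C}"
        by (force simp: image_iff ereal_real)
      also have "\<dots> \<in> sets borel" using that by measurable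
      finally show ?thesis .
    qed
    show ?thesis by measurable
  qed
  show ?thesis
    unfolding K_tau_def
  proof (rule emeasure_measure_of_sigma)
    show "sigma_algebra UNIV (sets (borel :: real measure))"
      using sets.sigma_algebra_axioms[of "borel :: real measure"] by simp
    show "positive (sets borel) (\<lambda>C. \<integral>\<^sup>+u\<in>{0..1}. indicator (ereal ` C) (tau (\<xi> \<omega>) (\<eta> \<omega>) u s) \<partial>lborel)"
      by (simp add: positive_def)
    show "countably_additive (sets borel) (\<lambda>C. \<integral>\<^sup>+u\<in>{0..1}. indicator (ereal ` C) (tau (\<xi> \<omega>) (\<eta> \<omega>) u s) \<partial>lborel)"
    proof (rule countably_additiveI)
      fix F :: "nat \<Rightarrow> real set"
      assume F: "range F \<subseteq> sets borel" "disjoint_family F"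
      have disj: "disjoint_family (\<lambda>i. ereal ` F i)"
        using F(2) by (auto simp: disjoint_family_on_def)
      have "(\<Sum>i. integral\<^sup>N lborel (?f (F i))) = (\<integral>\<^sup>+u. (\<Sum>i. ?f (F i) u) \<partial>lborel)"
        using F(1) meas by (intro nn_integral_suminf[symmetric]) auto
      also have "\<dots> = integral\<^sup>N lborel (?f (\<Union>i. F i))"
        by (intro nn_integral_cong)
          (simp add: ennreal_suminf_multc suminf_indicator[OF disj] image_UN)
      finally show "(\<Sum>i. integral\<^sup>N lborel (?f (F i))) = integral\<^sup>N lborel (?f (\<Union>i. F i))" .
    qed
  qed fact
qed

lemma measurable_kernel_section:
  fixes \<xi> :: "'a \<Rightarrow> real measure"
  assumes sets: "\<And>\<omega>. \<omega> \<in> space M \<Longrightarrow> sets (\<xi> \<omega>) = sets borel"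
    and meas: "\<And>C. C \<in> sets borel \<Longrightarrow> (\<lambda>\<omega>. emeasure (\<xi> \<omega>) C) \<in> borel_measurable M"
    and fin: "\<And>\<omega>. \<omega> \<in> space M \<Longrightarrow> emeasure (\<xi> \<omega>) UNIV < \<infinity>"
    and A: "A \<in> sets (M \<Otimes>\<^sub>M borel)"
  shows "(\<lambda>\<omega>. emeasure (\<xi> \<omega>) (Pair \<omega> -` A)) \<in> borel_measurable M"
  using Int_stable_pair_measure_generator pair_measure_closed A
  unfolding sets_pair_measure
proof (induction rule: sigma_sets_induct_disjoint)
  case (basic A)
  then obtain B C where BC: "A = B \<times> C" "B \<in> sets M" "C \<in> sets borel" by auto
  have "emeasure (\<xi> \<omega>) (Pair \<omega> -` A) = emeasure (\<xi> \<omega>) C * indicator B \<omega>" for \<omega>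
    by (auto simp: BC indicator_def)
  then show ?case using BC meas[of C] by simp
next
  case empty then show ?case by simp
next
  case (compl A)
  then have A: "A \<in> sets (M \<Otimes>\<^sub>M borel)" by (simp add: sets_pair_measure)
  have "emeasure (\<xi> \<omega>) (Pair \<omega> -` (space M \<times> space borel - A)) =
      emeasure (\<xi> \<omega>) UNIV - emeasure (\<xi> \<omega>) (Pair \<omega> -` A)" if w: "\<omega> \<in> space M" for \<omega>
  proof -
    have eq: "Pair \<omega> -` (space M \<times> space borel - A) = UNIV - Pair \<omega> -` A"
      using w by auto
    have 1: "Pair \<omega> -` A \<in> sets (\<xi> \<omega>)"
      using sets_Pair1[OF A] sets[OF w] by simp
    have sp: "space (\<xi> \<omega>) = UNIV"
      using sets_eq_imp_space_eq[OF sets[OF w]] by simp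
    have "emeasure (\<xi> \<omega>) (Pair \<omega> -` A) \<le> emeasure (\<xi> \<omega>) UNIV"
      using emeasure_space[of "\<xi> \<omega>"] sp by simp
    then have "emeasure (\<xi> \<omega>) (Pair \<omega> -` A) \<noteq> \<infinity>"
      using fin[OF w] by (auto simp: top_unique less_top)
    then show ?thesis
      unfolding eq using emeasure_compl[OF 1] sp by simp
  qed
  moreover have "(\<lambda>\<omega>. emeasure (\<xi> \<omega>) UNIV - emeasure (\<xi> \<omega>) (Pair \<omega> -` A)) \<in> borel_measurable M"
    using compl.IH meas[of UNIV] by measurable
  ultimately show ?case by (simp cong: measurable_cong)
next
  case (union F)
  then have F: "F i \<in> sets (M \<Otimes>\<^sub>M borel)" for i by (auto simp: sets_pair_measure)
  have "emeasure (\<xi> \<omega>) (Pair \<omega> -` (\<Union>i. F i)) = (\<Sum>i. emeasure (\<xi> \<omega>) (Pair \<omega> -` F i))"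
    if w: "\<omega> \<in> space M" for \<omega>
  proof -
    have disj: "disjoint_family (\<lambda>i. Pair \<omega> -` F i)"
      using union.hyps(1) unfolding disjoint_family_on_def by blast
    show ?thesis
      unfolding vimage_UN
      by (intro suminf_emeasure[symmetric])
        (use sets_Pair1[OF F] sets[OF w] disj in auto)
  qed
  moreover have "(\<lambda>\<omega>. \<Sum>i. emeasure (\<xi> \<omega>) (Pair \<omega> -` F i)) \<in> borel_measurable M"
    using union.IH by measurable
  ultimately show ?case by (simp cong: measurable_cong)
qed

lemma AE_measurable_section:
  assumes \<xi>: "random_measure M \<xi>" and A: "A \<in> sets (M \<Otimes>\<^sub>M borel)"
  shows "\<exists>f\<in>borel_measurable M. AE \<omega> in M. emeasure (\<xi> \<omega>) (Pair \<omega> -` A) = f \<omega>"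
proof -
  have sets: "sets (\<xi> \<omega>) = sets borel" if "\<omega> \<in> space M" for \<omega>
    using \<xi> that by (auto simp: random_measure_def)
  have meas: "(\<lambda>\<omega>. emeasure (\<xi> \<omega>) C) \<in> borel_measurable M" if "C \<in> sets borel" for C
    using \<xi> that by (auto simp: random_measure_def)
  define I where "I n = {- real n .. real n}" for n
  define \<zeta> where "\<zeta> n \<omega> = (if emeasure (\<xi> \<omega>) (I n) < \<infinity>
     then density (\<xi> \<omega>) (indicator (I n)) else null_measure borel)" for n \<omega>
  have I: "I n \<in> sets borel" for n by (simp add: I_def)
  have em: "emeasure (\<zeta> n \<omega>) C = (if emeasure (\<xi> \<omega>) (I n) < \<infinity> then emeasure (\<xi> \<omega>) (I n \<inter> C) else 0)"
    if "\<omega> \<in> space M" "C \<in> sets borel" for n \<omega> C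
    using that I sets[OF that(1)] by (auto simp: \<zeta>_def emeasure_restricted)
  have sec: "(\<lambda>\<omega>. emeasure (\<zeta> n \<omega>) (Pair \<omega> -` A)) \<in> borel_measurable M" for n
  proof (rule measurable_kernel_section[OF _ _ _ A])
    fix \<omega> assume w: "\<omega> \<in> space M"
    then show "sets (\<zeta> n \<omega>) = sets borel" by (simp add: \<zeta>_def sets)
    show "emeasure (\<zeta> n \<omega>) UNIV < \<infinity>" using em[OF w, of UNIV] by simp
  next
    fix C :: "real set" assume C: "C \<in> sets borel"
    have "(\<lambda>\<omega>. if emeasure (\<xi> \<omega>) (I n) < \<infinity> then emeasure (\<xi> \<omega>) (I n \<inter> C) else 0) \<in> borel_measurable M"
      using meas[OF I, of n] meas[OF sets.Int[OF I C], of n] by measurable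
    then show "(\<lambda>\<omega>. emeasure (\<zeta> n \<omega>) C) \<in> borel_measurable M"
      using em[OF _ C] by (simp cong: measurable_cong)
  qed
  show ?thesis
  proof (intro bexI)
    show "(\<lambda>\<omega>. SUP n. emeasure (\<zeta> n \<omega>) (Pair \<omega> -` A)) \<in> borel_measurable M"
      using sec by measurable
    have "AE \<omega> in M. locally_finite (\<xi> \<omega>)"
      using \<xi> by (auto simp: random_measure_def)
    then show "AE \<omega> in M. emeasure (\<xi> \<omega>) (Pair \<omega> -` A) = (SUP n. emeasure (\<zeta> n \<omega>) (Pair \<omega> -` A))"
    proof eventually_elim
      fix \<omega> assume "locally_finite (\<xi> \<omega>)"
      then have fin: "emeasure (\<xi> \<omega>) (I n) < \<infinity>" for n
        by (auto simp: locally_finite_def I_def)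
      show "emeasure (\<xi> \<omega>) (Pair \<omega> -` A) = (SUP n. emeasure (\<zeta> n \<omega>) (Pair \<omega> -` A))"
      proof (cases "\<omega> \<in> space M")
        case w: True
        have P: "Pair \<omega> -` A \<in> sets borel" using sets_Pair1[OF A] .
        have inc: "incseq (\<lambda>n. I n \<inter> Pair \<omega> -` A)"
        proof (rule monoI)
          fix m n :: nat assume "m \<le> n"
          then have "I m \<subseteq> I n" by (simp add: I_def)
          then show "I m \<inter> Pair \<omega> -` A \<subseteq> I n \<inter> Pair \<omega> -` A" by blast
        qed
        have "(SUP n. emeasure (\<xi> \<omega>) (I n \<inter> Pair \<omega> -` A)) = emeasure (\<xi> \<omega>) (\<Union>n. I n \<inter> Pair \<omega> -` A)"
          by (rule SUP_emeasure_incseq)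
            (use inc P I sets[OF w] in auto)
        also have "(\<Union>n. I n \<inter> Pair \<omega> -` A) = Pair \<omega> -` A"
        proof -
          have "\<exists>n. x \<in> I n" for x
          proof -
            obtain n where "\<bar>x\<bar> \<le> real n" using real_arch_simple by blast
            then have "x \<in> I n" unfolding I_def atLeastAtMost_iff by linarith
            then show ?thesis by blast
          qed
          then show ?thesis by auto
        qed
        finally show ?thesis using em[OF w P] fin by simp
      next
        case False
        then have "Pair \<omega> -` A = {}" using sets.sets_into_space[OF A] by (auto simp: space_pair_measure)
        then show ?thesis by simp
      qed
    qed
  qed
qed

lemma emeasure_campbell_measure:
  assumes \<xi>: "random_measure M \<xi>" and A: "A \<in> sets (M \<Otimes>\<^sub>M borel)"
  shows "emeasure (campbell_measure M \<xi>) A = (\<integral>\<^sup>+\<omega>. emeasure (\<xi> \<omega>) (Pair \<omega> -` A) \<partial>M)"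
  unfolding campbell_measure_def
proof (rule emeasure_measure_of_sigma)
  show "sigma_algebra (space M \<times> UNIV) (sets (M \<Otimes>\<^sub>M (borel :: real measure)))"
    using sets.sigma_algebra_axioms[of "M \<Otimes>\<^sub>M (borel :: real measure)"] by (simp add: space_pair_measure)
  show "positive (sets (M \<Otimes>\<^sub>M borel)) (\<lambda>A. \<integral>\<^sup>+\<omega>. emeasure (\<xi> \<omega>) (Pair \<omega> -` A) \<partial>M)"
    by (simp add: positive_def)
  show "countably_additive (sets (M \<Otimes>\<^sub>M borel)) (\<lambda>A. \<integral>\<^sup>+\<omega>. emeasure (\<xi> \<omega>) (Pair \<omega> -` A) \<partial>M)"
  proof (rule countably_additiveI)
    fix F :: "nat \<Rightarrow> ('a \<times> real) set"
    assume F: "range F \<subseteq> sets (M \<Otimes>\<^sub>M borel)" "disjoint_family F"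
    have "\<forall>i. \<exists>f\<in>borel_measurable M. AE \<omega> in M. emeasure (\<xi> \<omega>) (Pair \<omega> -` F i) = f \<omega>"
      using AE_measurable_section[OF \<xi>] F(1) by auto
    then obtain f where f: "\<And>i. f i \<in> borel_measurable M"
      "\<And>i. AE \<omega> in M. emeasure (\<xi> \<omega>) (Pair \<omega> -` F i) = f i \<omega>" by metis
    have "(\<Sum>i. \<integral>\<^sup>+\<omega>. emeasure (\<xi> \<omega>) (Pair \<omega> -` F i) \<partial>M) = (\<Sum>i. \<integral>\<^sup>+\<omega>. f i \<omega> \<partial>M)"
      using f(2) by (intro suminf_cong nn_integral_cong_AE)
    also have "\<dots> = (\<integral>\<^sup>+\<omega>. (\<Sum>i. f i \<omega>) \<partial>M)"
      using f(1) by (intro nn_integral_suminf[symmetric])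
    also have "\<dots> = (\<integral>\<^sup>+\<omega>. emeasure (\<xi> \<omega>) (Pair \<omega> -` (\<Union>i. F i)) \<partial>M)"
    proof (rule nn_integral_cong_AE)
      have "AE \<omega> in M. \<forall>i. emeasure (\<xi> \<omega>) (Pair \<omega> -` F i) = f i \<omega>"
        using f(2) by (simp add: AE_all_countable)
      then show "AE \<omega> in M. (\<Sum>i. f i \<omega>) = emeasure (\<xi> \<omega>) (Pair \<omega> -` (\<Union>i. F i))"
        using AE_space
      proof eventually_elim
        fix \<omega> assume eq: "\<forall>i. emeasure (\<xi> \<omega>) (Pair \<omega> -` F i) = f i \<omega>" and w: "\<omega> \<in> space M"
        have "sets (\<xi> \<omega>) = sets borel" using \<xi> w by (auto simp: random_measure_def)
        moreover have disj: "disjoint_family (\<lambda>i. Pair \<omega> -` F i)"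
          using F(2) unfolding disjoint_family_on_def by blast
        moreover have "Pair \<omega> -` F i \<in> sets borel" for i using F(1) by (intro sets_Pair1) auto
        ultimately have "(\<Sum>i. emeasure (\<xi> \<omega>) (Pair \<omega> -` F i)) = emeasure (\<xi> \<omega>) (\<Union>i. Pair \<omega> -` F i)"
          using disj by (intro suminf_emeasure) auto
        then show "(\<Sum>i. f i \<omega>) = emeasure (\<xi> \<omega>) (Pair \<omega> -` (\<Union>i. F i))"
          using eq by (simp add: vimage_UN)
      qed
    qed
    finally show "(\<Sum>i. \<integral>\<^sup>+\<omega>. emeasure (\<xi> \<omega>) (Pair \<omega> -` F i) \<partial>M) =
      (\<integral>\<^sup>+\<omega>. emeasure (\<xi> \<omega>) (Pair \<omega> -` (\<Union>i. F i)) \<partial>M)" .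
  qed
qed fact

end

theory Submission
  imports Defs
begin

text \<open>Read \<open>\<xi>\<close> as opening and \<open>\<eta>\<close> as closing brackets, spread over the line according to mass.  The
  time \<open>\<tau>\<^sup>u(s)\<close> is the place where the bracket opened at level \<open>u\<close> of the \<open>\<xi>\<close>-mass at \<open>s\<close> gets closed.
  The proof has a pathwise part, about two fixed mutually singular, locally finite measures \<open>\<mu>\<close>
  and \<open>\<nu>\<close>, and a part that uses stationarity and ergodicity.

  Pathwise, look at a queue with arrivals \<open>\<mu>\<close> and services \<open>\<nu>\<close> that starts empty at time \<open>c\<close>.  Its
  content at time \<open>b\<close> is the backlog, the supremum of \<open>\<mu>(t,b] - \<nu>(t,b]\<close> over \<open>c \<le> t \<le> b\<close>.  Lemma
  \<open>unmatched_mass\<close> identifies it with the \<open>\<mu>\<close>-mass of \<open>(c,b]\<close> whose brackets are still open at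
  \<open>b\<close>.  For the proof, the backlog is viewed as a function of \<open>c\<close>: it is the distribution
  function of a measure \<open>\<rho> \<le> \<mu>\<close>, which does not charge the points \<open>s\<close> whose bracket is closed by
  \<open>b\<close> (there the backlog is locally constant) and agrees with \<open>\<mu>\<close> on the other points (between
  two of them \<open>\<mu>\<close> and \<open>\<rho> + \<nu>\<close> have equal mass, and \<open>\<nu>\<close> is singular to \<open>\<mu>\<close>); at atoms, which
  may be matched in part, the masses are computed.  It follows that
  the \<open>\<mu>\<close>-mass moved into an interval never exceeds its \<open>\<nu>\<close>-mass (\<open>received_le\<close>), with equality to
  the right of a bracket that is never closed (\<open>received_Ioc_ge\<close>).

  For the random measures, the mass transport principle says that the expected mass sent out of
  \<open>(0,1]\<close> equals the expected mass received by \<open>(0,1]\<close>.  Suppose that unmatched \<open>\<xi>\<close>-mass exists but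
  none lies far to the left.  Its leftmost location is then a point that moves with the flow, and
  transporting all of \<open>\<xi>\<close> to it shows that \<open>\<lambda>\<^sub>\<xi>\<close> is infinite, because \<open>\<xi>(\<real>) = \<infinity>\<close>.  So, by ergodicity, either
  almost everywhere all of \<open>\<xi>\<close> is matched, or almost everywhere there are open brackets arbitrarily far to
  the left.  In the second case every interval receives all the mass it can take, and
  \<open>\<lambda>\<^sub>\<xi> = \<lambda>\<^sub>\<eta>\<close> leaves no unmatched mass either.  Hence \<open>K(s,\<real>) = 1\<close> for \<open>\<xi>\<close>-almost every \<open>s\<close>.  Now
  the received measure is at most \<open>\<eta>\<close> and has the same finite intensity, so it is \<open>\<eta>\<close>.\<close>

section \<open>Locally finite measures on the line\<close>

locale lf_borel =
  fixes \<mu> :: "real measure"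
  assumes sets_borel_eq [simp, measurable_cong]: "sets \<mu> = sets borel"
    and locally_finite: "locally_finite \<mu>"
begin

lemma space_UNIV [simp]: "space \<mu> = UNIV"
  using sets_eq_imp_space_eq[OF sets_borel_eq] by simp

lemma finite_on_bounded: "bounded A \<Longrightarrow> emeasure \<mu> A < \<infinity>"
proof -
  assume "bounded A"
  then have "compact (closure A)" by simp
  then have "emeasure \<mu> (closure A) < \<infinity>" using locally_finite by (simp add: locally_finite_def)
  moreover have "emeasure \<mu> A \<le> emeasure \<mu> (closure A)"
    by (rule emeasure_mono) (auto simp: closure_subset)
  ultimately show ?thesis by (rule order.strict_trans1[rotated])
qed

lemma finite_intervals [simp]:
  "emeasure \<mu> {a<..b} \<noteq> top" "emeasure \<mu> {a..b} \<noteq> top" "emeasure \<mu> {a<..<b} \<noteq> top"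
  "emeasure \<mu> {a..<b} \<noteq> top" "emeasure \<mu> {a} \<noteq> top"
  using finite_on_bounded[of "{a<..b}"] finite_on_bounded[of "{a..b}"] finite_on_bounded[of "{a<..<b}"]
    finite_on_bounded[of "{a..<b}"] finite_on_bounded[of "{a}"] by auto

lemma emeasure_eq_measure_bounded: "bounded A \<Longrightarrow> emeasure \<mu> A = ennreal (measure \<mu> A)"
  using finite_on_bounded[of A] by (intro emeasure_eq_ennreal_measure) auto

lemma measure_mono_bounded:
  "A \<subseteq> B \<Longrightarrow> B \<in> sets borel \<Longrightarrow> bounded B \<Longrightarrow> measure \<mu> A \<le> measure \<mu> B"
  using finite_on_bounded[of B] emeasure_mono[of A B \<mu>] emeasure_eq_ennreal_measure[of \<mu> B]
  by (metis emeasure_eq_measure_bounded bounded_subset ennreal_le_iff measure_nonneg sets_borel_eq)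

lemma measure_split:
  "A \<in> sets borel \<Longrightarrow> B \<in> sets borel \<Longrightarrow> bounded A \<Longrightarrow> bounded B \<Longrightarrow> A \<inter> B = {} \<Longrightarrow>
    measure \<mu> (A \<union> B) = measure \<mu> A + measure \<mu> B"
  using finite_on_bounded[of A] finite_on_bounded[of B] by (intro measure_Union) auto

lemma measure_Ioc_split:
  assumes "a \<le> b" "b \<le> c" shows "measure \<mu> {a<..c} = measure \<mu> {a<..b} + measure \<mu> {b<..c}"
  using measure_split[of "{a<..b}" "{b<..c}"] assms by (simp add: ivl_disj_un ivl_disj_int)

lemma measure_Ioc_last:
  assumes "a < b" shows "measure \<mu> {a<..b} = measure \<mu> {a<..<b} + measure \<mu> {b}"
  using measure_split[of "{a<..<b}" "{b}"] ivl_disj_un_singleton(4)[OF assms] by simp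

lemma measure_Icc_first:
  assumes "a \<le> b" shows "measure \<mu> {a..b} = measure \<mu> {a} + measure \<mu> {a<..b}"
  using measure_split[of "{a}" "{a<..b}"] ivl_disj_un_singleton(5)[OF assms] by simp

lemma small_right:
  assumes "0 < e"
  obtains z where "x < z" "\<And>y. y \<le> z \<Longrightarrow> measure \<mu> {x<..y} < e"
proof -
  define A where "A n = {x<..x + 1 / real (Suc n)}" for n
  have dec: "decseq A"
    by (rule decseq_SucI) (auto simp: A_def field_simps intro: order_trans)
  have "(\<lambda>n. emeasure \<mu> (A n)) \<longlonglongrightarrow> emeasure \<mu> (\<Inter>n. A n)"
    by (rule Lim_emeasure_decseq[OF _ dec]) (auto simp: A_def)
  also have "(\<Inter>n. A n) = {}"
  proof -
    have "\<exists>n. y \<notin> A n" for y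
    proof (cases "y \<le> x")
      case False
      then obtain n where "1 / real (Suc n) < y - x" using nat_approx_posE[of "y - x"] by auto
      then show ?thesis by (auto simp: A_def intro!: exI[of _ n])
    qed (auto simp: A_def)
    then show ?thesis by auto
  qed
  finally have "(\<lambda>n. emeasure \<mu> (A n)) \<longlonglongrightarrow> 0" by simp
  then have "\<forall>\<^sub>F n in sequentially. emeasure \<mu> (A n) < ennreal e"
    using assms by (intro order_tendstoD) auto
  then obtain n where "emeasure \<mu> (A n) < ennreal e" by (auto simp: eventually_sequentially)
  then have n: "measure \<mu> (A n) < e"
    using emeasure_eq_measure_bounded[of "A n"] assms by (auto simp: A_def ennreal_less_iff)
  show ?thesis
  proof (rule that[of "x + 1 / real (Suc n)"])
    fix y assume "y \<le> x + 1 / real (Suc n)"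
    then have "measure \<mu> {x<..y} \<le> measure \<mu> (A n)"
      by (intro measure_mono_bounded) (auto simp: A_def)
    then show "measure \<mu> {x<..y} < e" using n by simp
  qed simp
qed

lemma small_left:
  assumes "0 < e"
  obtains z where "z < x" "\<And>y. z \<le> y \<Longrightarrow> measure \<mu> {y<..<x} < e"
proof -
  define A where "A n = {x - 1 / real (Suc n)<..<x}" for n
  have dec: "decseq A"
    by (rule decseq_SucI) (auto simp: A_def field_simps intro: order_trans)
  have "(\<lambda>n. emeasure \<mu> (A n)) \<longlonglongrightarrow> emeasure \<mu> (\<Inter>n. A n)"
    by (rule Lim_emeasure_decseq[OF _ dec]) (auto simp: A_def)
  also have "(\<Inter>n. A n) = {}"
  proof -
    have "\<exists>n. y \<notin> A n" for y
    proof (cases "x \<le> y")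
      case False
      then obtain n where "1 / real (Suc n) < x - y" using nat_approx_posE[of "x - y"] by auto
      then have "y \<notin> A n" by (simp add: A_def)
      then show ?thesis ..
    qed (auto simp: A_def)
    then show ?thesis by auto
  qed
  finally have "(\<lambda>n. emeasure \<mu> (A n)) \<longlonglongrightarrow> 0" by simp
  then have "\<forall>\<^sub>F n in sequentially. emeasure \<mu> (A n) < ennreal e"
    using assms by (intro order_tendstoD) auto
  then obtain n where "emeasure \<mu> (A n) < ennreal e" by (auto simp: eventually_sequentially)
  then have n: "measure \<mu> (A n) < e"
    using emeasure_eq_measure_bounded[of "A n"] assms by (auto simp: A_def ennreal_less_iff)
  show ?thesis
  proof (rule that[of "x - 1 / real (Suc n)"])
    fix y assume "x - 1 / real (Suc n) \<le> y"
    then have "measure \<mu> {y<..<x} \<le> measure \<mu> (A n)"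
      by (intro measure_mono_bounded) (auto simp: A_def)
    then show "measure \<mu> {y<..<x} < e" using n by simp
  qed simp
qed

lemma countable_atoms: "countable {x. emeasure \<mu> {x} \<noteq> 0}"
proof -
  let ?r = "\<lambda>n::nat. density \<mu> (indicator {- real n..real n})"
  have r: "emeasure (?r n) A = emeasure \<mu> ({- real n..real n} \<inter> A)" if "A \<in> sets borel" for n A
    using that by (simp add: emeasure_restricted)
  have "countable {x. measure (?r n) {x} \<noteq> 0}" for n
  proof -
    interpret finite_measure "?r n" by (rule finite_measureI) (simp add: r)
    show ?thesis by (rule countable_support)
  qed
  moreover have "{x. emeasure \<mu> {x} \<noteq> 0} \<subseteq> (\<Union>n. {x. measure (?r n) {x} \<noteq> 0})"
  proof
    fix x assume x: "x \<in> {x. emeasure \<mu> {x} \<noteq> 0}"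
    obtain n where "\<bar>x\<bar> \<le> real n" using real_arch_simple by blast
    then have "emeasure (?r n) {x} = emeasure \<mu> {x}" by (subst r) (auto simp: abs_le_iff Int_absorb1)
    then have "measure (?r n) {x} = measure \<mu> {x}" unfolding measure_def by (rule arg_cong)
    moreover have "measure \<mu> {x} \<noteq> 0" using x emeasure_eq_measure_bounded[of "{x}"] by auto
    ultimately have "measure (?r n) {x} \<noteq> 0" by simp
    then show "x \<in> (\<Union>n. {x. measure (?r n) {x} \<noteq> 0})" by blast
  qed
  ultimately show ?thesis by (rule countable_subset[OF _ countable_UN[OF countableI_type], rotated])
qed

end

definition add_measure :: "real measure \<Rightarrow> real measure \<Rightarrow> real measure" where
  "add_measure \<mu> \<nu> = measure_of UNIV (sets borel) (\<lambda>A. emeasure \<mu> A + emeasure \<nu> A)"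

lemma sets_add_measure [simp, measurable_cong]: "sets (add_measure \<mu> \<nu>) = sets borel"
  unfolding add_measure_def using sets.sigma_sets_eq[of "borel :: real measure"] by simp

lemma emeasure_add_measure:
  assumes [simp]: "sets \<mu> = sets borel" "sets \<nu> = sets borel" and A: "A \<in> sets borel"
  shows "emeasure (add_measure \<mu> \<nu>) A = emeasure \<mu> A + emeasure \<nu> A"
  unfolding add_measure_def
proof (rule emeasure_measure_of_sigma)
  show "sigma_algebra UNIV (sets (borel :: real measure))"
    using sets.sigma_algebra_axioms[of "borel :: real measure"] by simp
  show "countably_additive (sets borel) (\<lambda>A. emeasure \<mu> A + emeasure \<nu> A)"
    by (auto simp: countably_additive_def suminf_add[symmetric] suminf_emeasure)
qed (auto simp: positive_def A)

lemma (in lf_borel) lf_borel_add: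
  assumes "lf_borel \<nu>" shows "lf_borel (add_measure \<mu> \<nu>)"
proof
  interpret \<nu>: lf_borel \<nu> by fact
  show "locally_finite (add_measure \<mu> \<nu>)"
    unfolding locally_finite_def
    using finite_on_bounded \<nu>.finite_on_bounded by (auto simp: emeasure_add_measure borel_compact compact_imp_bounded)
qed simp

lemma lf_borelI_Ioc:
  assumes "sets \<mu> = sets borel" "\<And>x y. emeasure \<mu> {x<..y} < \<infinity>"
  shows "lf_borel \<mu>"
proof
  show "locally_finite \<mu>"
    unfolding locally_finite_def
  proof safe
    fix C :: "real set" assume "compact C"
    then obtain a where a: "\<And>x. x \<in> C \<Longrightarrow> \<bar>x\<bar> \<le> a"
      using compact_imp_bounded[of C] by (auto simp: bounded_iff)
    have "C \<subseteq> {-a-1<..a}" using a by fastforce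
    then have "emeasure \<mu> C \<le> emeasure \<mu> {-a-1<..a}" using assms(1) by (intro emeasure_mono) auto
    then show "emeasure \<mu> C < \<infinity>" using assms(2) order.strict_trans1 by blast
  qed
qed fact

lemma lf_borel_eqI:
  assumes "lf_borel \<mu>" "lf_borel \<nu>" and eq: "\<And>x y. x \<le> y \<Longrightarrow> emeasure \<mu> {x<..y} = emeasure \<nu> {x<..y}"
  shows "\<mu> = \<nu>"
proof -
  interpret \<mu>: lf_borel \<mu> by fact
  interpret \<nu>: lf_borel \<nu> by fact
  let ?E = "range (\<lambda>(a, b). {a <.. b::real})"
  have s: "sets (borel :: real measure) = sigma_sets UNIV ?E"
    by (subst borel_sigma_sets_Ioc) simp
  show ?thesis
  proof (rule measure_eqI_generator_eq[where E = ?E and \<Omega> = UNIV and A = "\<lambda>n. {- real n <.. real n}"])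
    show "Int_stable ?E" by (auto simp: Int_stable_def)
    show "sets \<mu> = sigma_sets UNIV ?E" "sets \<nu> = sigma_sets UNIV ?E" using s by auto
    fix X assume "X \<in> ?E"
    then obtain a b where "X = {a<..b}" by auto
    then show "emeasure \<mu> X = emeasure \<nu> X" using eq[of a b] by (cases "a \<le> b") auto
  next
    have "\<exists>n. x \<in> {- real n <.. real n}" for x
    proof -
      obtain n where "\<bar>x\<bar> < real n" using reals_Archimedean2 by blast
      then show ?thesis by (auto intro!: exI[of _ n])
    qed
    then show "(\<Union>n. {- real n <.. real n}) = UNIV" by auto
  qed auto
qed

text \<open>The difference of the two distribution functions is nondecreasing and right continuous, so
  it is the distribution function of a measure \<open>\<delta>\<close>, and \<open>\<nu> = \<mu> + \<delta>\<close> since the two sides agree on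
  half-open intervals.\<close>

lemma emeasure_le_if_Ioc_le:
  assumes "lf_borel \<mu>" "lf_borel \<nu>"
    and le: "\<And>x y. x \<le> y \<Longrightarrow> emeasure \<mu> {x<..y} \<le> emeasure \<nu> {x<..y}"
    and B: "B \<in> sets borel"
  shows "emeasure \<mu> B \<le> emeasure \<nu> B"
proof -
  interpret \<mu>: lf_borel \<mu> by fact
  interpret \<nu>: lf_borel \<nu> by fact
  define d where "d x y = measure \<nu> {x<..y} - measure \<mu> {x<..y}" for x y
  define F where "F x = (if 0 \<le> x then d 0 x else - d x 0)" for x
  have dd: "d x z = d x y + d y z" if "x \<le> y" "y \<le> z" for x y z
    using that by (simp add: d_def \<mu>.measure_Ioc_split[of x y z] \<nu>.measure_Ioc_split[of x y z])
  have F: "F y - F x = d x y" if "x \<le> y" for x y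
    using that dd[of 0 x y] dd[of x 0 y] dd[of x y 0] by (auto simp: F_def)
  have d0: "0 \<le> d x y" if "x \<le> y" for x y
    using le[OF that] by (simp add: d_def \<mu>.emeasure_eq_measure_bounded \<nu>.emeasure_eq_measure_bounded)
  have mono: "F x \<le> F y" if "x \<le> y" for x y using F[OF that] d0[OF that] by simp
  have cont: "continuous (at_right a) F" for a
  proof (rule continuous_at_right_real_increasing[of F a, OF mono, THEN iffD2], simp, intro allI impI)
    fix e :: real assume "0 < e"
    then obtain z where z: "a < z" "measure \<nu> {a<..z} < e" using \<nu>.small_right[of e a] by (metis order_refl)
    have "F z - F a < e"
      using z(2) F[OF less_imp_le[OF z(1)]] measure_nonneg[of \<mu> "{a<..z}"] unfolding d_def by linarith
    then show "\<exists>x>0. F (a + x) - F a < e" using z(1) by (intro exI[of _ "z - a"]) auto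
  qed
  define \<delta> where "\<delta> = interval_measure F"
  have \<delta>: "emeasure \<delta> {x<..y} = ennreal (d x y)" if "x \<le> y" for x y
    using F[OF that] by (simp add: \<delta>_def emeasure_interval_measure_Ioc[OF that mono cont])
  have lf\<delta>: "lf_borel \<delta>"
  proof (rule lf_borelI_Ioc)
    show "emeasure \<delta> {x<..y} < \<infinity>" for x y using \<delta>[of x y] by (cases "x \<le> y") auto
  qed (simp add: \<delta>_def)
  then interpret \<delta>: lf_borel \<delta> .
  have "\<nu> = add_measure \<mu> \<delta>"
  proof (rule lf_borel_eqI[OF assms(2) \<mu>.lf_borel_add[OF lf\<delta>]])
    fix x y :: real assume xy: "x \<le> y"
    have "measure \<nu> {x<..y} = measure \<mu> {x<..y} + d x y" by (simp add: d_def)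
    then show "emeasure \<nu> {x<..y} = emeasure (add_measure \<mu> \<delta>) {x<..y}"
      using d0[OF xy] by (simp add: emeasure_add_measure \<delta>[OF xy] \<mu>.emeasure_eq_measure_bounded
          \<nu>.emeasure_eq_measure_bounded ennreal_plus)
  qed
  then have "emeasure \<nu> B = emeasure \<mu> B + emeasure \<delta> B"
    using emeasure_add_measure[of \<mu> \<delta> B] B by simp
  then show ?thesis by simp
qed

text \<open>The set \<open>C\<close> serves to exhaust \<open>K\<close> by countably many intervals with end points in \<open>K\<close>.  Picking a
  point of \<open>K\<close> on either side of each rational number misses only a minimum and a maximum of \<open>K\<close>.\<close>

lemma countable_order_hull:
  fixes K :: "real set"
  obtains C where "countable C" "C \<subseteq> K" "\<And>k. k \<in> K \<Longrightarrow> \<exists>a\<in>C. \<exists>b\<in>C. a \<le> k \<and> k \<le> b"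
proof -
  define f where "f r = (SOME k. k \<in> K \<and> k < r)" for r
  define g where "g r = (SOME k. k \<in> K \<and> r < k)" for r
  let ?C = "{k\<in>K. (\<forall>x\<in>K. k \<le> x) \<or> (\<forall>x\<in>K. x \<le> k)} \<union> ((f ` \<rat> \<union> g ` \<rat>) \<inter> K)"
  have f: "f r \<in> K \<and> f r < r" if "k \<in> K" "k < r" for k r
    unfolding f_def by (rule someI[of _ k]) (use that in auto)
  have g: "g r \<in> K \<and> r < g r" if "k \<in> K" "r < k" for k r
    unfolding g_def by (rule someI[of _ k]) (use that in auto)
  show ?thesis
  proof (rule that[of ?C])
    have "{k\<in>K. \<forall>x\<in>K. k \<le> x} \<subseteq> {Inf K}" by (auto intro: cInf_eq_minimum[symmetric])
    then have 1: "countable {k\<in>K. \<forall>x\<in>K. k \<le> x}" by (rule countable_subset) simp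
    have "{k\<in>K. \<forall>x\<in>K. x \<le> k} \<subseteq> {Sup K}" by (auto intro: cSup_eq_maximum[symmetric])
    then have 2: "countable {k\<in>K. \<forall>x\<in>K. x \<le> k}" by (rule countable_subset) simp
    have "?C = {k\<in>K. \<forall>x\<in>K. k \<le> x} \<union> {k\<in>K. \<forall>x\<in>K. x \<le> k} \<union> ((f ` \<rat> \<union> g ` \<rat>) \<inter> K)" by auto
    then show "countable ?C" using 1 2 countable_rat by auto
    fix k assume k: "k \<in> K"
    have "\<exists>a\<in>?C. a \<le> k"
    proof (cases "\<forall>x\<in>K. k \<le> x")
      case False
      then obtain x where x: "x \<in> K" "x < k" by auto
      then obtain r where r: "r \<in> \<rat>" "x < r" "r < k" using Rats_dense_in_real by blast
      then show ?thesis using f[OF x(1) r(2)] by (intro bexI[of _ "f r"]) auto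
    qed (use k in auto)
    moreover have "\<exists>b\<in>?C. k \<le> b"
    proof (cases "\<forall>x\<in>K. x \<le> k")
      case False
      then obtain x where x: "x \<in> K" "k < x" by auto
      then obtain r where r: "r \<in> \<rat>" "k < r" "r < x" using Rats_dense_in_real by blast
      then show ?thesis using g[OF x(1) r(3)] by (intro bexI[of _ "g r"]) auto
    qed (use k in auto)
    ultimately show "\<exists>a\<in>?C. \<exists>b\<in>?C. a \<le> k \<and> k \<le> b" by blast
  qed auto
qed

text \<open>Sets such as the record times of a function are not intervals, but mass can be controlled
  between any two of their points.  The set \<open>K\<close> is the increasing union of sets \<open>K \<inter> [a,b]\<close> with
  \<open>a\<close>, \<open>b\<close> in \<open>K\<close>, and the left end point \<open>a\<close> carries no mass.\<close>

lemma (in lf_borel) emeasure_le_if_hull_le: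
  assumes K: "K \<in> sets borel" and diffuse: "\<And>s. s \<in> K \<Longrightarrow> emeasure \<mu> {s} = 0"
    and le: "\<And>s t. s \<in> K \<Longrightarrow> t \<in> K \<Longrightarrow> s \<le> t \<Longrightarrow> emeasure \<mu> {s<..t} \<le> M"
  shows "emeasure \<mu> K \<le> M"
proof (cases "K = {}")
  case False
  obtain C where C: "countable C" "C \<subseteq> K" "\<And>k. k \<in> K \<Longrightarrow> \<exists>a\<in>C. \<exists>b\<in>C. a \<le> k \<and> k \<le> b"
    using countable_order_hull by metis
  have "C \<noteq> {}" using C(3) False by blast
  define c where "c = from_nat_into C"
  have rc: "range c = C" using C(1) \<open>C \<noteq> {}\<close> by (simp add: c_def range_from_nat_into)
  define a where "a n = Min (c ` {..n})" for n
  define b where "b n = Max (c ` {..n})" for n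
  have aK: "a n \<in> K" and bK: "b n \<in> K" and ab: "a n \<le> b n" for n
  proof -
    have "a n \<in> c ` {..n}" "b n \<in> c ` {..n}" unfolding a_def b_def by (intro Min_in Max_in; simp)+
    then show "a n \<in> K" "b n \<in> K" using rc C(2) by auto
    have "a n \<le> c 0" "c 0 \<le> b n" unfolding a_def b_def by auto
    then show "a n \<le> b n" by simp
  qed
  have dec: "a (Suc n) \<le> a n" "b n \<le> b (Suc n)" for n
    unfolding a_def b_def by (intro Min_antimono Max_mono; auto)+
  have "K \<subseteq> (\<Union>n. K \<inter> {a n..b n})"
  proof
    fix k assume "k \<in> K"
    then obtain i j where ij: "c i \<le> k" "k \<le> c j" using C(3) rc by blast
    have "a (max i j) \<le> c i" "c j \<le> b (max i j)" unfolding a_def b_def by auto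
    then have "k \<in> K \<inter> {a (max i j)..b (max i j)}" using ij \<open>k \<in> K\<close> by simp
    then show "k \<in> (\<Union>n. K \<inter> {a n..b n})" by blast
  qed
  then have "K = (\<Union>n. K \<inter> {a n..b n})" by blast
  moreover have "(SUP n. emeasure \<mu> (K \<inter> {a n..b n})) = emeasure \<mu> (\<Union>n. K \<inter> {a n..b n})"
  proof (rule SUP_emeasure_incseq)
    show "incseq (\<lambda>n. K \<inter> {a n..b n})"
      by (rule incseq_SucI) (use order_trans[OF dec(1)] order_trans[OF _ dec(2)] in auto)
  qed (use K in auto)
  moreover have "emeasure \<mu> (K \<inter> {a n..b n}) \<le> M" for n
  proof -
    have "emeasure \<mu> (K \<inter> {a n..b n}) \<le> emeasure \<mu> ({a n} \<union> {a n<..b n})"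
      by (rule emeasure_mono) auto
    also have "\<dots> \<le> emeasure \<mu> {a n} + emeasure \<mu> {a n<..b n}"
      by (rule emeasure_subadditive) auto
    also have "\<dots> \<le> M" using diffuse[OF aK] le[OF aK bK ab] by simp
    finally show ?thesis .
  qed
  ultimately show ?thesis using SUP_least[of UNIV "\<lambda>n. emeasure \<mu> (K \<inter> {a n..b n})" M] by simp
qed simp

section \<open>Joint measurability of the allocation\<close>

context lf_borel begin

lemma measurable_eq [simp]: "measurable \<mu> N = measurable borel N"
  by (rule measurable_cong_sets) simp_all

lemma Ioo_leI:
  assumes "\<And>z. z < t \<Longrightarrow> c + emeasure \<mu> {s<..z} \<le> y"
  shows "c + emeasure \<mu> {s<..<t} \<le> y"
proof -
  have "(SUP n. emeasure \<mu> {s<..t - 1 / real (Suc n)}) = emeasure \<mu> (\<Union>n. {s<..t - 1 / real (Suc n)})"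
  proof (rule SUP_emeasure_incseq)
    have "1 / real (Suc (Suc n)) \<le> 1 / real (Suc n)" for n by (intro frac_le) auto
    then show "incseq (\<lambda>n. {s<..t - 1 / real (Suc n)})"
      by (intro incseq_SucI) (smt (verit) greaterThanAtMost_iff subsetI)
  qed auto
  also have "(\<Union>n. {s<..t - 1 / real (Suc n)}) = {s<..<t}"
  proof safe
    fix x assume x: "x \<in> {s<..<t}"
    then obtain n where "1 / real (Suc n) < t - x" using nat_approx_posE[of "t - x"] by auto
    then have "x \<in> {s<..t - 1 / real (Suc n)}" using x by auto
    then show "x \<in> (\<Union>n. {s<..t - 1 / real (Suc n)})" by blast
  next
    fix x n assume "x \<in> {s<..t - 1 / real (Suc n)}"
    moreover have "0 < 1 / real (Suc n)" by simp
    ultimately show "x \<in> {s<..<t}" unfolding greaterThanAtMost_iff greaterThanLessThan_iff by linarith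
  qed
  finally have "c + emeasure \<mu> {s<..<t} = (SUP n. c + emeasure \<mu> {s<..t - 1 / real (Suc n)})"
    by (metis ennreal_SUP_add_right UNIV_not_empty)
  also have "\<dots> \<le> y" by (rule SUP_least) (rule assms, simp)
  finally show ?thesis .
qed

lemma le_IccI:
  assumes "\<And>z. t < z \<Longrightarrow> y \<le> emeasure \<mu> {s..z}"
  shows "y \<le> emeasure \<mu> {s..t}"
proof -
  have "(INF n. emeasure \<mu> {s..t + 1 / real (Suc n)}) = emeasure \<mu> (\<Inter>n. {s..t + 1 / real (Suc n)})"
  proof (rule INF_emeasure_decseq)
    show "decseq (\<lambda>n. {s..t + 1 / real (Suc n)})"
      by (rule decseq_SucI) (auto simp: field_simps intro: order_trans)
  qed auto
  also have "(\<Inter>n. {s..t + 1 / real (Suc n)}) = {s..t}"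
  proof safe
    fix x assume x: "x \<in> (\<Inter>n. {s..t + 1 / real (Suc n)})"
    have "x \<le> t"
    proof (rule ccontr)
      assume "\<not> x \<le> t"
      then obtain n where "1 / real (Suc n) < x - t" using nat_approx_posE[of "x - t"] by auto
      moreover have "x \<in> {s..t + 1 / real (Suc n)}" using x by blast
      ultimately show False by auto
    qed
    then show "x \<in> {s..t}" using x by auto
  next
    fix x n assume "x \<in> {s..t}"
    moreover have "0 \<le> 1 / real (Suc n)" by simp
    ultimately show "x \<in> {s..t + 1 / real (Suc n)}" unfolding atLeastAtMost_iff by linarith
  qed
  finally have "emeasure \<mu> {s..t} = (INF n. emeasure \<mu> {s..t + 1 / real (Suc n)})" ..
  also have "y \<le> \<dots>" by (rule INF_greatest) (rule assms, simp)
  finally show ?thesis .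
qed

end

text \<open>Membership of \<open>t\<close> in the set defining \<open>tau\<close> cannot be tested at rational points near \<open>t\<close>: if
  both measures have an atom at \<open>t\<close>, points to the left of \<open>t\<close> miss the atom of \<open>\<nu>\<close> and points
  to the right count the atom of \<open>\<mu>\<close>.
  Here \<open>t\<close> is replaced by a short rational interval \<open>[p,q]\<close>, with \<open>\<mu>\<close> counted only up to \<open>p\<close> and
  \<open>\<nu>\<close> up to \<open>q\<close>.  Conversely, intervals of vanishing length accumulate at some
  \<open>t \<in> [\<alpha>,\<beta>]\<close>, and the inequality survives in the limit since \<open>\<mu>(s,t)\<close> is left continuous
  and \<open>\<nu>[s,t]\<close> right continuous.\<close>

lemma tau_less_iff:
  assumes \<mu>: "lf_borel \<mu>" and \<nu>: "lf_borel \<nu>"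
  shows "tau \<mu> \<nu> u s < ereal a \<longleftrightarrow> (\<exists>\<alpha>\<in>\<rat>. \<exists>\<beta>\<in>\<rat>. s < \<alpha> \<and> \<beta> < a \<and>
    (\<forall>n::nat. \<exists>p\<in>\<rat>. \<exists>q\<in>\<rat>. p < q \<and> q - p \<le> 1 / real (Suc n) \<and> p \<le> \<beta> \<and> \<alpha> \<le> q \<and>
      ennreal u * emeasure \<mu> {s} + emeasure \<mu> {s<..p} \<le> emeasure \<nu> {s..q}))"
    (is "?L \<longleftrightarrow> ?R")
proof
  interpret \<mu>: lf_borel \<mu> by fact
  interpret \<nu>: lf_borel \<nu> by fact
  assume ?L
  then obtain t where t: "s < t" "t < a"
    and le: "ennreal u * emeasure \<mu> {s} + emeasure \<mu> {s<..<t} \<le> emeasure \<nu> {s..t}"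
    unfolding tau_def Inf_less_iff by auto
  obtain \<alpha> \<beta> where \<alpha>: "\<alpha> \<in> \<rat>" "s < \<alpha>" "\<alpha> < t" and \<beta>: "\<beta> \<in> \<rat>" "t < \<beta>" "\<beta> < a"
    using Rats_dense_in_real[OF t(1)] Rats_dense_in_real[OF t(2)] by blast
  have "\<exists>p\<in>\<rat>. \<exists>q\<in>\<rat>. p < q \<and> q - p \<le> 1 / real (Suc n) \<and> p \<le> \<beta> \<and> \<alpha> \<le> q \<and>
      ennreal u * emeasure \<mu> {s} + emeasure \<mu> {s<..p} \<le> emeasure \<nu> {s..q}" for n
  proof -
    define e where "e = 1 / real (Suc n) / 2"
    have e: "0 < e" "e + e = 1 / real (Suc n)" by (simp add: e_def, simp only: e_def field_sum_of_halves)
    obtain p q where p: "p \<in> \<rat>" "t - e < p" "p < t" and q: "q \<in> \<rat>" "t < q" "q < t + e"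
      using Rats_dense_in_real[of "t - e" t] Rats_dense_in_real[of t "t + e"] e(1) by auto
    have "ennreal u * emeasure \<mu> {s} + emeasure \<mu> {s<..p} \<le> ennreal u * emeasure \<mu> {s} + emeasure \<mu> {s<..<t}"
      using p by (intro add_left_mono emeasure_mono) auto
    also have "\<dots> \<le> emeasure \<nu> {s..q}" using q by (intro order_trans[OF le] emeasure_mono) auto
    finally have "ennreal u * emeasure \<mu> {s} + emeasure \<mu> {s<..p} \<le> emeasure \<nu> {s..q}" .
    moreover have "q - p \<le> 1 / real (Suc n)" using p(2) q(3) unfolding e(2)[symmetric] by linarith
    ultimately show ?thesis using p(1,3) q(1,2) \<alpha> \<beta> by (intro bexI[of _ p] bexI[of _ q]) auto
  qed
  then show ?R using \<alpha> \<beta> by blast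
next
  interpret \<mu>: lf_borel \<mu> by fact
  interpret \<nu>: lf_borel \<nu> by fact
  assume ?R
  then obtain \<alpha> \<beta> where ab: "s < \<alpha>" "\<beta> < a"
    and "\<forall>n::nat. \<exists>p q. p < q \<and> q - p \<le> 1 / real (Suc n) \<and> p \<le> \<beta> \<and> \<alpha> \<le> q \<and>
      ennreal u * emeasure \<mu> {s} + emeasure \<mu> {s<..p} \<le> emeasure \<nu> {s..q}"
    by blast
  then obtain p q where pq: "\<And>n. p n < q n" "\<And>n. q n - p n \<le> 1 / real (Suc n)" "\<And>n. p n \<le> \<beta>" "\<And>n. \<alpha> \<le> q n"
    and le: "\<And>n. ennreal u * emeasure \<mu> {s} + emeasure \<mu> {s<..p n} \<le> emeasure \<nu> {s..q n}"
    by metis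
  have "p n \<in> {\<alpha> - 1..\<beta>}" for n
  proof -
    have "1 / real (Suc n) \<le> 1" by simp
    then show ?thesis using pq[of n] unfolding atLeastAtMost_iff by linarith
  qed
  then obtain t r where t: "t \<in> {\<alpha> - 1..\<beta>}" and r: "strict_mono r" "(p \<circ> r) \<longlonglongrightarrow> t"
    using compact_imp_seq_compact[OF compact_Icc, of "\<alpha> - 1" \<beta>] unfolding seq_compact_def by metis
  have "(\<lambda>n. 1 / real (Suc (r n))) \<longlonglongrightarrow> 0"
    using LIMSEQ_subseq_LIMSEQ[OF LIMSEQ_inverse_real_of_nat r(1)] by (simp add: o_def inverse_eq_divide)
  then have "(\<lambda>n. q (r n) - p (r n)) \<longlonglongrightarrow> 0"
    by (rule tendsto_sandwich[OF _ _ tendsto_const, rotated 2]) (use pq in \<open>auto intro!: always_eventually less_imp_le\<close>)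
  from tendsto_add[OF this r(2)] have qr: "(\<lambda>n. q (r n)) \<longlonglongrightarrow> t" by simp
  then have \<alpha>t: "\<alpha> \<le> t" by (rule LIMSEQ_le_const) (use pq in auto)
  have "ennreal u * emeasure \<mu> {s} + emeasure \<mu> {s<..<t} \<le> emeasure \<nu> {s..t}"
  proof (rule \<mu>.Ioo_leI, rule \<nu>.le_IccI)
    fix z z' assume z: "z < t" "t < z'"
    have "\<forall>\<^sub>F n in sequentially. z < p (r n)" "\<forall>\<^sub>F n in sequentially. q (r n) < z'"
      using order_tendstoD(1)[OF r(2) z(1)] order_tendstoD(2)[OF qr z(2)] by (simp_all add: o_def)
    then have "\<forall>\<^sub>F n in sequentially. z < p (r n) \<and> q (r n) < z'" by eventually_elim simp
    then obtain n where n: "z < p (r n)" "q (r n) < z'" by (auto simp: eventually_sequentially)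
    have "ennreal u * emeasure \<mu> {s} + emeasure \<mu> {s<..z} \<le> ennreal u * emeasure \<mu> {s} + emeasure \<mu> {s<..p (r n)}"
      using n by (intro add_left_mono emeasure_mono) auto
    also have "\<dots> \<le> emeasure \<nu> {s..q (r n)}" by (rule le)
    also have "\<dots> \<le> emeasure \<nu> {s..z'}" using n by (intro emeasure_mono) auto
    finally show "ennreal u * emeasure \<mu> {s} + emeasure \<mu> {s<..z} \<le> emeasure \<nu> {s..z'}" .
  qed
  then have "tau \<mu> \<nu> u s \<le> ereal t" unfolding tau_def using ab \<alpha>t by (intro Inf_lower) auto
  also have "ereal t < ereal a" using t ab by simp
  finally show ?L .
qed

text \<open>Local finiteness is required for every \<open>\<omega>\<close>, so that integrals of jointly measurable functions
  are measurable in \<open>\<omega>\<close> without exceptional null sets.\<close>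

definition lf_kernel :: "'a measure \<Rightarrow> ('a \<Rightarrow> real measure) \<Rightarrow> bool" where
  "lf_kernel M \<xi> \<longleftrightarrow> (\<forall>\<omega>\<in>space M. lf_borel (\<xi> \<omega>)) \<and>
     (\<forall>C\<in>sets borel. (\<lambda>\<omega>. emeasure (\<xi> \<omega>) C) \<in> borel_measurable M)"

lemma lf_kernelD:
  assumes "lf_kernel M \<xi>"
  shows "\<omega> \<in> space M \<Longrightarrow> lf_borel (\<xi> \<omega>)" "C \<in> sets borel \<Longrightarrow> (\<lambda>\<omega>. emeasure (\<xi> \<omega>) C) \<in> borel_measurable M"
  using assms by (auto simp: lf_kernel_def)

lemma lf_kernel_comp: "lf_kernel M \<xi> \<Longrightarrow> f \<in> N \<rightarrow>\<^sub>M M \<Longrightarrow> lf_kernel N (\<lambda>x. \<xi> (f x))"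
  by (auto simp: lf_kernel_def dest: measurable_space intro: measurable_compose)

lemma UN_Icc_nat: "(\<Union>n. {- real n..real n}) = UNIV"
proof -
  have "\<exists>n. x \<in> {- real n..real n}" for x
  proof -
    obtain n where "\<bar>x\<bar> < real n" using reals_Archimedean2 by blast
    then show ?thesis by (auto intro!: exI[of _ n])
  qed
  then show ?thesis by auto
qed

text \<open>The case of finite measures, applied to the restrictions to \<open>[-n,n]\<close>.\<close>

lemma measurable_section_lf:
  assumes \<xi>: "lf_kernel M \<xi>" and A: "A \<in> sets (M \<Otimes>\<^sub>M borel)"
  shows "(\<lambda>\<omega>. emeasure (\<xi> \<omega>) (Pair \<omega> -` A)) \<in> borel_measurable M"
proof -
  define I where "I n = {- real n .. real n}" for n
  have I: "I n \<in> sets borel" for n by (simp add: I_def)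
  define \<zeta> where "\<zeta> n \<omega> = density (\<xi> \<omega>) (indicator (I n))" for n \<omega>
  have em: "emeasure (\<zeta> n \<omega>) C = emeasure (\<xi> \<omega>) (I n \<inter> C)" if "\<omega> \<in> space M" "C \<in> sets borel" for n \<omega> C
    using that I lf_borel.sets_borel_eq[OF lf_kernelD(1)[OF \<xi> that(1)]] by (auto simp: \<zeta>_def emeasure_restricted)
  have sec: "(\<lambda>\<omega>. emeasure (\<zeta> n \<omega>) (Pair \<omega> -` A)) \<in> borel_measurable M" for n
  proof (rule measurable_kernel_section[OF _ _ _ A])
    fix \<omega> assume w: "\<omega> \<in> space M"
    interpret lf_borel "\<xi> \<omega>" using lf_kernelD(1)[OF \<xi> w] .
    show "sets (\<zeta> n \<omega>) = sets borel" by (simp add: \<zeta>_def)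
    show "emeasure (\<zeta> n \<omega>) UNIV < \<infinity>" using em[OF w, of UNIV] finite_on_bounded[of "I n"] by (simp add: I_def)
  next
    fix C :: "real set" assume C: "C \<in> sets borel"
    have "(\<lambda>\<omega>. emeasure (\<xi> \<omega>) (I n \<inter> C)) \<in> borel_measurable M"
      using lf_kernelD(2)[OF \<xi>, of "I n \<inter> C"] I C by simp
    then show "(\<lambda>\<omega>. emeasure (\<zeta> n \<omega>) C) \<in> borel_measurable M"
      using em[OF _ C] by (simp cong: measurable_cong)
  qed
  have "emeasure (\<xi> \<omega>) (Pair \<omega> -` A) = (SUP n. emeasure (\<zeta> n \<omega>) (Pair \<omega> -` A))" if w: "\<omega> \<in> space M" for \<omega>
  proof -
    interpret lf_borel "\<xi> \<omega>" using lf_kernelD(1)[OF \<xi> w] .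
    have P: "Pair \<omega> -` A \<in> sets borel" using sets_Pair1[OF A] .
    have "(SUP n. emeasure (\<xi> \<omega>) (I n \<inter> Pair \<omega> -` A)) = emeasure (\<xi> \<omega>) (\<Union>n. I n \<inter> Pair \<omega> -` A)"
    proof (rule SUP_emeasure_incseq)
      show "incseq (\<lambda>n. I n \<inter> Pair \<omega> -` A)" by (rule incseq_SucI) (auto simp: I_def)
    qed (use P I in auto)
    also have "(\<Union>n. I n \<inter> Pair \<omega> -` A) = Pair \<omega> -` A" using UN_Icc_nat by (simp add: I_def Int_UN_distrib2[symmetric])
    finally show ?thesis using em[OF w P] by simp
  qed
  moreover have "(\<lambda>\<omega>. SUP n. emeasure (\<zeta> n \<omega>) (Pair \<omega> -` A)) \<in> borel_measurable M"
    using sec by measurable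
  ultimately show ?thesis by (simp cong: measurable_cong)
qed

lemma measurable_section_lf_compose:
  assumes "lf_kernel M \<xi>" "f \<in> N \<rightarrow>\<^sub>M M" "{x\<in>space (N \<Otimes>\<^sub>M borel). P (fst x) (snd x)} \<in> sets (N \<Otimes>\<^sub>M borel)"
  shows "(\<lambda>x. emeasure (\<xi> (f x)) {y. P x y}) \<in> borel_measurable N"
proof -
  let ?A = "{x\<in>space (N \<Otimes>\<^sub>M (borel :: real measure)). P (fst x) (snd x)}"
  have "(\<lambda>x. emeasure (\<xi> (f x)) (Pair x -` ?A)) \<in> borel_measurable N"
    by (rule measurable_section_lf[OF lf_kernel_comp[OF assms(1,2)] assms(3)])
  moreover have "Pair x -` ?A = {y. P x y}" if "x \<in> space N" for x
    using that by (auto simp: space_pair_measure)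
  ultimately show ?thesis by (simp cong: measurable_cong)
qed

lemma measurable_kernel_integral:
  assumes \<xi>: "lf_kernel M \<xi>" and f: "f \<in> borel_measurable (M \<Otimes>\<^sub>M borel)"
  shows "(\<lambda>\<omega>. \<integral>\<^sup>+s. f (\<omega>, s) \<partial>\<xi> \<omega>) \<in> borel_measurable M"
  using f
proof (induction rule: borel_measurable_induct)
  case (cong f g)
  have "(\<integral>\<^sup>+s. f (\<omega>, s) \<partial>\<xi> \<omega>) = (\<integral>\<^sup>+s. g (\<omega>, s) \<partial>\<xi> \<omega>)" if "\<omega> \<in> space M" for \<omega>
    using cong.hyps(3) that by (intro nn_integral_cong) (auto simp: space_pair_measure)
  then show ?case using cong.IH by (simp cong: measurable_cong)
next
  case (set A)
  have "(\<integral>\<^sup>+s. indicator A (\<omega>, s) \<partial>\<xi> \<omega>) = emeasure (\<xi> \<omega>) (Pair \<omega> -` A)" if "\<omega> \<in> space M" for \<omega>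
  proof -
    interpret lf_borel "\<xi> \<omega>" using lf_kernelD(1)[OF \<xi> that] .
    have "(\<integral>\<^sup>+s. indicator A (\<omega>, s) \<partial>\<xi> \<omega>) = (\<integral>\<^sup>+s. indicator (Pair \<omega> -` A) s \<partial>\<xi> \<omega>)"
      by (intro nn_integral_cong) (auto simp: indicator_def)
    then show ?thesis using sets_Pair1[OF set] by simp
  qed
  then show ?case using measurable_section_lf[OF \<xi> set] by (simp cong: measurable_cong)
next
  case (mult u c)
  have "(\<integral>\<^sup>+s. c * u (\<omega>, s) \<partial>\<xi> \<omega>) = c * (\<integral>\<^sup>+s. u (\<omega>, s) \<partial>\<xi> \<omega>)" if "\<omega> \<in> space M" for \<omega>
  proof -
    interpret lf_borel "\<xi> \<omega>" using lf_kernelD(1)[OF \<xi> that] .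
    show ?thesis using measurable_Pair2[OF mult.hyps(2) that] by (intro nn_integral_cmult) simp_all
  qed
  then show ?case using mult.IH by (simp cong: measurable_cong)
next
  case (add u v)
  have "(\<integral>\<^sup>+s. v (\<omega>, s) + u (\<omega>, s) \<partial>\<xi> \<omega>) = (\<integral>\<^sup>+s. v (\<omega>, s) \<partial>\<xi> \<omega>) + (\<integral>\<^sup>+s. u (\<omega>, s) \<partial>\<xi> \<omega>)"
    if "\<omega> \<in> space M" for \<omega>
  proof -
    interpret lf_borel "\<xi> \<omega>" using lf_kernelD(1)[OF \<xi> that] .
    show ?thesis using measurable_Pair2[OF add.hyps(1) that] measurable_Pair2[OF add.hyps(3) that]
      by (intro nn_integral_add) simp_all
  qed
  then show ?case using add.IH by (simp cong: measurable_cong)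
next
  case (seq U)
  have "(\<integral>\<^sup>+s. (SUP i. U i) (\<omega>, s) \<partial>\<xi> \<omega>) = (SUP i. \<integral>\<^sup>+s. U i (\<omega>, s) \<partial>\<xi> \<omega>)" if "\<omega> \<in> space M" for \<omega>
  proof -
    interpret lf_borel "\<xi> \<omega>" using lf_kernelD(1)[OF \<xi> that] .
    have "(\<integral>\<^sup>+s. (SUP i. U i) (\<omega>, s) \<partial>\<xi> \<omega>) = (\<integral>\<^sup>+s. (SUP i. U i (\<omega>, s)) \<partial>\<xi> \<omega>)"
      by (simp add: SUP_apply image_image)
    also have "\<dots> = (SUP i. \<integral>\<^sup>+s. U i (\<omega>, s) \<partial>\<xi> \<omega>)"
    proof (rule nn_integral_monotone_convergence_SUP)
      show "incseq (\<lambda>i s. U i (\<omega>, s))" using seq.hyps(3) by (auto simp: incseq_def le_fun_def)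
      show "(\<lambda>s. U i (\<omega>, s)) \<in> borel_measurable (\<xi> \<omega>)" for i using measurable_Pair2[OF seq.hyps(1) that] by simp
    qed
    finally show ?thesis .
  qed
  then show ?case using seq.IH by (simp cong: measurable_cong)
qed

lemma measurable_tau_kernel:
  assumes \<xi>: "lf_kernel M \<xi>" and \<eta>: "lf_kernel M \<eta>"
  shows "(\<lambda>((\<omega>, s), u). tau (\<xi> \<omega>) (\<eta> \<omega>) u s) \<in> borel_measurable ((M \<Otimes>\<^sub>M borel) \<Otimes>\<^sub>M borel)"
proof -
  let ?N = "M \<Otimes>\<^sub>M (borel :: real measure)"
  have [measurable]: "(\<lambda>x. emeasure (\<xi> (fst x)) {y. y = snd x}) \<in> borel_measurable ?N"
    by (rule measurable_section_lf_compose[OF \<xi>]) measurable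
  have [measurable]: "(\<lambda>x. emeasure (\<xi> (fst x)) {y. snd x < y \<and> y \<le> p}) \<in> borel_measurable ?N" for p
    by (rule measurable_section_lf_compose[OF \<xi>]) measurable
  have [measurable]: "(\<lambda>x. emeasure (\<eta> (fst x)) {y. snd x \<le> y \<and> y \<le> q}) \<in> borel_measurable ?N" for q
    by (rule measurable_section_lf_compose[OF \<eta>]) measurable
  have eq: "{y. y = s} = {s}" "{y. s < y \<and> y \<le> p} = {s<..p}" "{y. s \<le> y \<and> y \<le> q} = {s..q}" for s p q :: real
    by auto
  have 1: "{z\<in>space (?N \<Otimes>\<^sub>M borel). tau (\<xi> (fst (fst z))) (\<eta> (fst (fst z))) (snd z) (snd (fst z)) < ereal a} \<in> sets (?N \<Otimes>\<^sub>M borel)" for a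
  proof -
    have "{z\<in>space (?N \<Otimes>\<^sub>M borel). tau (\<xi> (fst (fst z))) (\<eta> (fst (fst z))) (snd z) (snd (fst z)) < ereal a} =
     {z\<in>space (?N \<Otimes>\<^sub>M borel). \<exists>\<alpha>\<in>\<rat>. \<exists>\<beta>\<in>\<rat>. snd (fst z) < \<alpha> \<and> \<beta> < a \<and>
      (\<forall>n::nat. \<exists>p\<in>\<rat>. \<exists>q\<in>\<rat>. p < q \<and> q - p \<le> 1 / real (Suc n) \<and> p \<le> \<beta> \<and> \<alpha> \<le> q \<and>
      ennreal (snd z) * emeasure (\<xi> (fst (fst z))) {y. y = snd (fst z)} + emeasure (\<xi> (fst (fst z))) {y. snd (fst z) < y \<and> y \<le> p}
        \<le> emeasure (\<eta> (fst (fst z))) {y. snd (fst z) \<le> y \<and> y \<le> q})}"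
      unfolding eq
      by (intro Collect_cong conj_cong refl tau_less_iff lf_kernelD(1)[OF \<xi>] lf_kernelD(1)[OF \<eta>])
        (auto simp: space_pair_measure)
    also have "\<dots> \<in> sets (?N \<Otimes>\<^sub>M borel)"
      using countable_rat by measurable
    finally show ?thesis .
  qed
  let ?t = "\<lambda>z. tau (\<xi> (fst (fst z))) (\<eta> (fst (fst z))) (snd z) (snd (fst z))"
  have "?t \<in> borel_measurable (?N \<Otimes>\<^sub>M borel)"
  proof (rule borel_measurableI_less)
    fix c :: ereal
    have "{z\<in>space (?N \<Otimes>\<^sub>M borel). ?t z < c} = (\<Union>r\<in>\<rat>. if ereal r \<le> c then {z\<in>space (?N \<Otimes>\<^sub>M borel). ?t z < ereal r} else {})"
    proof safe
      fix a s u assume a: "((a, s), u) \<in> space (?N \<Otimes>\<^sub>M (borel :: real measure))" "?t ((a, s), u) < c"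
      then obtain r' where r': "?t ((a, s), u) < ereal r'" "ereal r' < c" using ereal_dense2 by blast
      obtain r'' where r'': "ereal r' < ereal r''" "ereal r'' < c" using r'(2) ereal_dense2 by blast
      obtain r where r: "r \<in> \<rat>" "r' < r" "r < r''" using r''(1) Rats_dense_in_real by auto
      have "?t ((a, s), u) < ereal r" using r'(1) r(2) by (auto intro: less_trans)
      moreover have "ereal r \<le> c" using less_trans[of "ereal r" "ereal r''" c] r(3) r''(2) by auto
      ultimately show "((a, s), u) \<in> (\<Union>r\<in>\<rat>. if ereal r \<le> c then {z\<in>space (?N \<Otimes>\<^sub>M borel). ?t z < ereal r} else {})"
        using r(1) a(1) by auto
    qed (auto split: if_splits)
    also have "\<dots> \<in> sets (?N \<Otimes>\<^sub>M borel)"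
      using 1 countable_rat by (intro sets.countable_UN') auto
    finally show "{z\<in>space (?N \<Otimes>\<^sub>M borel). ?t z < c} \<in> sets (?N \<Otimes>\<^sub>M borel)" .
  qed
  then show ?thesis by (simp add: case_prod_beta')
qed

lemma sets_ereal_image: "C \<in> sets borel \<Longrightarrow> ereal ` C \<in> sets borel"
proof -
  assume C: "C \<in> sets borel"
  have "ereal ` C = {x \<in> space borel. \<bar>x\<bar> \<noteq> \<infinity> \<and> real_of_ereal x \<in> C}"
    by (force simp: image_iff ereal_real)
  also have "\<dots> \<in> sets borel" using C by measurable
  finally show ?thesis .
qed

lemma sets_K_tau [simp, measurable_cong]: "sets (K_tau \<xi> \<eta> \<omega> s) = sets borel"
  unfolding K_tau_def using sets.sigma_sets_eq[of "borel :: real measure"] by simp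

lemma space_K_tau [simp]: "space (K_tau \<xi> \<eta> \<omega> s) = UNIV"
  using sets_eq_imp_space_eq[OF sets_K_tau, of \<xi> \<eta> \<omega> s] by simp

lemma emeasure_K_tau_le_1: "emeasure (K_tau \<xi> \<eta> \<omega> s) C \<le> 1"
proof -
  have borel_UNIV: "(UNIV :: real set) \<in> sets borel" by simp
  have "emeasure (K_tau \<xi> \<eta> \<omega> s) C \<le> emeasure (K_tau \<xi> \<eta> \<omega> s) (space (K_tau \<xi> \<eta> \<omega> s))"
    by (rule emeasure_space)
  also have "\<dots> = emeasure (K_tau \<xi> \<eta> \<omega> s) UNIV"
    by simp
  also have "\<dots> \<le> (\<integral>\<^sup>+u. indicator {0..1::real} u \<partial>lborel)"
    unfolding emeasure_K_tau[OF borel_UNIV]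
    by (intro nn_integral_mono) (auto simp: indicator_def)
  also have "\<dots> = 1" by simp
  finally show ?thesis .
qed

lemma measurable_K_tau:
  assumes \<xi>: "lf_kernel M \<xi>" and \<eta>: "lf_kernel M \<eta>" and C: "C \<in> sets borel"
  shows "(\<lambda>(\<omega>, s). emeasure (K_tau \<xi> \<eta> \<omega> s) C) \<in> borel_measurable (M \<Otimes>\<^sub>M borel)"
proof -
  note [measurable] = measurable_tau_kernel[OF \<xi> \<eta>] sets_ereal_image[OF C]
  have "(\<lambda>x. \<integral>\<^sup>+u. indicator (ereal ` C) ((\<lambda>((\<omega>, s), u). tau (\<xi> \<omega>) (\<eta> \<omega>) u s) (x, u)) * indicator {0..1} u \<partial>lborel)
    \<in> borel_measurable (M \<Otimes>\<^sub>M borel)"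
    by measurable
  then show ?thesis unfolding emeasure_K_tau[OF C] by (simp add: case_prod_beta')
qed

lemma transport_kernel_K_tau:
  assumes "lf_kernel M \<xi>" "lf_kernel M \<eta>"
  shows "transport_kernel M (K_tau \<xi> \<eta>)"
  unfolding transport_kernel_def
proof (rule measurable_subprob_algebra)
  fix A :: "real set" assume "A \<in> sets borel"
  then show "(\<lambda>a. emeasure (case a of (\<omega>, s) \<Rightarrow> K_tau \<xi> \<eta> \<omega> s) A) \<in> borel_measurable (M \<Otimes>\<^sub>M borel)"
    using measurable_K_tau[OF assms] by (simp add: case_prod_beta')
qed (auto intro!: subprob_spaceI emeasure_K_tau_le_1)

section \<open>The unmatched mass is the backlog\<close>

text \<open>Singularity enters twice: through the absence of common atoms, and to discard \<open>\<nu>\<close> in the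
  comparison of \<open>\<mu>\<close> with \<open>\<rho> + \<nu>\<close> below.\<close>

locale singular_pair = \<mu>: lf_borel \<mu> + \<nu>: lf_borel \<nu> for \<mu> \<nu> +
  assumes singular: "mutually_singular \<mu> \<nu>"
begin

abbreviation "m \<equiv> measure \<mu>"
abbreviation "n \<equiv> measure \<nu>"

lemma no_common_atoms: "m {s} = 0 \<or> n {s} = 0"
proof -
  obtain A where A: "A \<in> sets borel" "emeasure \<mu> A = 0" "emeasure \<nu> (UNIV - A) = 0"
    using singular unfolding mutually_singular_def by blast
  show ?thesis
  proof (cases "s \<in> A")
    case True
    then have "emeasure \<mu> {s} \<le> emeasure \<mu> A" using A by (intro emeasure_mono) auto
    then show ?thesis using A by (simp add: measure_def)
  next
    case False
    then have "emeasure \<nu> {s} \<le> emeasure \<nu> (UNIV - A)" using A by (intro emeasure_mono) auto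
    then show ?thesis using A by (simp add: measure_def)
  qed
qed

lemma covered_iff:
  assumes "0 \<le> u"
  shows "ennreal u * emeasure \<mu> {s} + emeasure \<mu> {s<..<t} \<le> emeasure \<nu> {s..t} \<longleftrightarrow>
    u * m {s} + m {s<..<t} \<le> n {s..t}"
  using assms by (simp add: \<mu>.emeasure_eq_measure_bounded \<nu>.emeasure_eq_measure_bounded
      flip: ennreal_mult ennreal_plus)

lemma tau_ge: "ereal s \<le> tau \<mu> \<nu> u s"
  unfolding tau_def by (rule Inf_greatest) auto

lemma tau_leI:
  assumes "0 \<le> u" "s < t" "u * m {s} + m {s<..<t} \<le> n {s..t}"
  shows "tau \<mu> \<nu> u s \<le> ereal t"
  unfolding tau_def using assms covered_iff[of u s t] by (intro Inf_lower) auto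

text \<open>If the infimum is \<open>b\<close> without being attained, it is approached from the right, and by right
  continuity the defining inequality holds in the limit with \<open>(s,b]\<close> in place of \<open>(s,b)\<close>.  This is
  the second case; it includes \<open>b = s\<close>.\<close>

lemma tau_leE:
  assumes "tau \<mu> \<nu> u s \<le> ereal b" "0 \<le> u" "s \<le> b"
  obtains t where "s < t" "t \<le> b" "u * m {s} + m {s<..<t} \<le> n {s..t}"
    | "u * m {s} + m {s<..b} \<le> n {s..b}"
proof (cases "\<exists>t. s < t \<and> t \<le> b \<and> u * m {s} + m {s<..<t} \<le> n {s..t}")
  case True then show ?thesis using that by blast
next
  case False
  have "ennreal u * emeasure \<mu> {s} + emeasure \<mu> {s<..b} \<le> emeasure \<nu> {s..b}"
  proof (rule \<nu>.le_IccI)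
    fix z assume "b < z"
    then have "tau \<mu> \<nu> u s < ereal z" using assms(1) by (auto intro: le_less_trans)
    then obtain t where t: "s < t" "t < z"
      and le: "ennreal u * emeasure \<mu> {s} + emeasure \<mu> {s<..<t} \<le> emeasure \<nu> {s..t}"
      unfolding tau_def Inf_less_iff by auto
    have "u * m {s} + m {s<..<t} \<le> n {s..t}" using le covered_iff[OF assms(2)] by simp
    then have "b < t" using False t(1) not_le by blast
    have "ennreal u * emeasure \<mu> {s} + emeasure \<mu> {s<..b} \<le> ennreal u * emeasure \<mu> {s} + emeasure \<mu> {s<..<t}"
      using \<open>b < t\<close> by (intro add_left_mono emeasure_mono) auto
    also have "\<dots> \<le> emeasure \<nu> {s..z}" using t by (intro order_trans[OF le] emeasure_mono) auto
    finally show "ennreal u * emeasure \<mu> {s} + emeasure \<mu> {s<..b} \<le> emeasure \<nu> {s..z}" .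
  qed
  then have "u * m {s} + m {s<..b} \<le> n {s..b}"
    using assms(2) by (simp add: \<mu>.emeasure_eq_measure_bounded \<nu>.emeasure_eq_measure_bounded
      flip: ennreal_mult ennreal_plus)
  then show ?thesis by (rule that(2))
qed

lemma measurable_tau_pair [measurable]: "(\<lambda>(s, u). tau \<mu> \<nu> u s) \<in> borel_measurable (borel \<Otimes>\<^sub>M borel)"
proof -
  have "(\<lambda>((w, s), u). tau \<mu> \<nu> u s) \<in> borel_measurable ((count_space (UNIV :: unit set) \<Otimes>\<^sub>M borel) \<Otimes>\<^sub>M borel)"
    by (rule measurable_tau_kernel[of "count_space UNIV" "\<lambda>_. \<mu>" "\<lambda>_. \<nu>"])
      (auto simp: lf_kernel_def \<mu>.lf_borel_axioms \<nu>.lf_borel_axioms)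
  from measurable_compose[OF _ this, of "\<lambda>(s, u). (((), s), u)"]
  show ?thesis by (simp add: case_prod_beta')
qed

text \<open>Reading \<open>\<mu>\<close> as arrivals and \<open>\<nu>\<close> as services of a queue, \<open>backlog b c\<close> is the content at time \<open>b\<close>
  of the queue that is empty at time \<open>c\<close>.\<close>

definition excess :: "real \<Rightarrow> real \<Rightarrow> real" where
  "excess b t = m {t<..b} - n {t<..b}"

definition backlog :: "real \<Rightarrow> real \<Rightarrow> real" where
  "backlog b c = (SUP t\<in>{c..b}. excess b t)"

lemma excess_self [simp]: "excess b b = 0" by (simp add: excess_def)

lemma excess_split: "t \<le> t' \<Longrightarrow> t' \<le> b \<Longrightarrow> excess b t = m {t<..t'} - n {t<..t'} + excess b t'"
  by (simp add: excess_def \<mu>.measure_Ioc_split[of t t' b] \<nu>.measure_Ioc_split[of t t' b])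

lemma excess_end_split: "t \<le> a \<Longrightarrow> a \<le> b \<Longrightarrow> excess b t = excess a t + excess b a"
  by (simp add: excess_def \<mu>.measure_Ioc_split[of t a b] \<nu>.measure_Ioc_split[of t a b])

lemma excess_le_backlog:
  assumes "c \<le> t" "t \<le> b" shows "excess b t \<le> backlog b c"
  unfolding backlog_def
proof (rule cSUP_upper)
  show "bdd_above (excess b ` {c..b})"
  proof (rule bdd_aboveI2)
    fix t assume "t \<in> {c..b}"
    then have "m {t<..b} \<le> m {c<..b}" by (intro \<mu>.measure_mono_bounded) auto
    then show "excess b t \<le> m {c<..b}" using measure_nonneg[of \<nu> "{t<..b}"] unfolding excess_def by linarith
  qed
qed (use assms in auto)

lemma backlog_least: "c \<le> b \<Longrightarrow> (\<And>t. c \<le> t \<Longrightarrow> t \<le> b \<Longrightarrow> excess b t \<le> x) \<Longrightarrow> backlog b c \<le> x"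
  unfolding backlog_def by (rule cSUP_least) auto

lemma backlog_self [simp]: "backlog b b = 0" by (simp add: backlog_def)

lemma backlog_nonneg: "c \<le> b \<Longrightarrow> 0 \<le> backlog b c"
  using excess_le_backlog[of c b b] by simp

lemma backlog_antimono: "c \<le> c' \<Longrightarrow> c' \<le> b \<Longrightarrow> backlog b c' \<le> backlog b c"
  by (rule backlog_least) (auto intro: excess_le_backlog)

text \<open>Moving the start from \<open>c'\<close> back to \<open>c\<close> adds at most the arrivals of \<open>(c,c']\<close>.  This is what
  makes the backlog right continuous in \<open>c\<close>, and its increments a measure dominated by \<open>\<mu>\<close>.\<close>

lemma backlog_step:
  assumes "c \<le> c'" "c' \<le> b" shows "backlog b c \<le> backlog b c' + m {c<..c'}"
proof (rule backlog_least)
  fix t assume t: "c \<le> t" "t \<le> b"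
  show "excess b t \<le> backlog b c' + m {c<..c'}"
  proof (cases "t \<le> c'")
    case True
    have "m {t<..c'} \<le> m {c<..c'}" using t by (intro \<mu>.measure_mono_bounded) auto
    then show ?thesis
      using excess_split[of t c' b] excess_le_backlog[of c' c' b] True assms measure_nonneg[of \<nu> "{t<..c'}"] by linarith
  next
    case False
    then show ?thesis using excess_le_backlog[of c' t b] t measure_nonneg[of \<mu> "{c<..c'}"] by linarith
  qed
qed (use assms in auto)

text \<open>For fixed \<open>b\<close>, the increments of \<open>c \<mapsto> - backlog b c\<close> on \<open>(-\<infinity>,b]\<close> form the measure \<open>\<rho> b\<close>; it has
  no mass to the right of \<open>b\<close>.\<close>

definition backlog_cdf :: "real \<Rightarrow> real \<Rightarrow> real" where "backlog_cdf b x = - backlog b (min x b)"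

definition \<rho> :: "real \<Rightarrow> real measure" where "\<rho> b = interval_measure (backlog_cdf b)"

lemma backlog_cdf_mono: "x \<le> y \<Longrightarrow> backlog_cdf b x \<le> backlog_cdf b y"
  by (auto simp: backlog_cdf_def intro: backlog_antimono)

lemma backlog_cdf_step: "x \<le> y \<Longrightarrow> backlog_cdf b y - backlog_cdf b x \<le> m {x<..y}"
proof -
  assume xy: "x \<le> y"
  have "backlog b (min x b) \<le> backlog b (min y b) + m {min x b<..min y b}"
    using xy by (intro backlog_step) auto
  moreover have "m {min x b<..min y b} \<le> m {x<..y}"
    by (rule \<mu>.measure_mono_bounded) (auto simp: min_def)
  ultimately show ?thesis by (simp add: backlog_cdf_def)
qed

lemma backlog_cdf_right_cont: "continuous (at_right a) (backlog_cdf b)"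
proof (rule continuous_at_right_real_increasing[of "backlog_cdf b" a, OF backlog_cdf_mono, THEN iffD2], simp, intro allI impI)
  fix e :: real assume "0 < e"
  then obtain z where z: "a < z" "m {a<..z} < e" using \<mu>.small_right[of e a] by (metis order_refl)
  then have "backlog_cdf b z - backlog_cdf b a < e" using backlog_cdf_step[of a z b] by simp
  then show "\<exists>x>0. backlog_cdf b (a + x) - backlog_cdf b a < e" using z(1) by (intro exI[of _ "z - a"]) auto
qed

lemma \<rho>_Ioc_cdf: "x \<le> y \<Longrightarrow> emeasure (\<rho> b) {x<..y} = ennreal (backlog_cdf b y - backlog_cdf b x)"
  unfolding \<rho>_def by (rule emeasure_interval_measure_Ioc[OF _ backlog_cdf_mono backlog_cdf_right_cont])

lemma \<rho>_Ioc: "x \<le> y \<Longrightarrow> y \<le> b \<Longrightarrow> emeasure (\<rho> b) {x<..y} = ennreal (backlog b x - backlog b y)"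
  by (simp add: \<rho>_Ioc_cdf backlog_cdf_def min_def)

lemma lf_borel_\<rho>: "lf_borel (\<rho> b)"
proof (rule lf_borelI_Ioc)
  show "emeasure (\<rho> b) {x<..y} < \<infinity>" for x y using \<rho>_Ioc_cdf[of x y b] by (cases "x \<le> y") auto
qed (simp add: \<rho>_def)

sublocale \<rho>: lf_borel "\<rho> b" for b by (rule lf_borel_\<rho>)

lemma \<rho>_le_\<mu>: "B \<in> sets borel \<Longrightarrow> emeasure (\<rho> b) B \<le> emeasure \<mu> B"
  by (rule emeasure_le_if_Ioc_le[OF lf_borel_\<rho> \<mu>.lf_borel_axioms])
    (simp_all add: \<rho>_Ioc_cdf backlog_cdf_step \<mu>.emeasure_eq_measure_bounded ennreal_leI)

definition atoms :: "real set" where "atoms = {s. emeasure \<mu> {s} \<noteq> 0}"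

lemma countable_atoms_\<mu>: "countable atoms" unfolding atoms_def by (rule \<mu>.countable_atoms)

lemma sets_atoms [measurable]: "atoms \<in> sets borel"
  by (rule sets.countable[OF _ countable_atoms_\<mu>]) auto

lemma measurable_backlog_cdf [measurable]: "backlog_cdf b \<in> borel_measurable borel"
  by (rule borel_measurable_mono) (simp add: mono_def backlog_cdf_mono)

lemma measurable_excess [measurable]: "excess b \<in> borel_measurable borel"
proof -
  have "mono (\<lambda>t. - m {t<..b})" "mono (\<lambda>t. - n {t<..b})"
    by (auto intro!: monoI \<mu>.measure_mono_bounded \<nu>.measure_mono_bounded)
  then have "(\<lambda>t. - n {t<..b} - - m {t<..b}) \<in> borel_measurable borel"
    by (intro borel_measurable_diff borel_measurable_mono)
  then show ?thesis by (simp add: excess_def[abs_def])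
qed

text \<open>The points to the left of a rational number \<open>r\<close> with the same backlog as \<open>r\<close> form an interval, on
  which \<open>\<rho>\<close> has no mass apart from a possible jump at its left end.  Such a jump sits at an atom of \<open>\<mu>\<close>.\<close>

lemma \<rho>_flat_null: "{s. s < b \<and> (\<exists>z. s < z \<and> z \<le> b \<and> backlog b s = backlog b z)} - atoms \<in> null_sets (\<rho> b)"
proof -
  define N where "N r = {s. s < r \<and> backlog_cdf b s = backlog_cdf b r} - atoms" for r
  have N_sets: "N r \<in> sets borel" for r unfolding N_def by measurable
  have "N r \<in> null_sets (\<rho> b)" for r
  proof -
    have "emeasure (\<rho> b) (N r) \<le> 0"
    proof (rule \<rho>.emeasure_le_if_hull_le[OF N_sets])
      fix s assume "s \<in> N r"
      then have "emeasure \<mu> {s} = 0" by (simp add: N_def atoms_def)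
      then show "emeasure (\<rho> b) {s} = 0" using \<rho>_le_\<mu>[of "{s}" b] by simp
    next
      fix s t assume "s \<in> N r" "t \<in> N r" "s \<le> t"
      then show "emeasure (\<rho> b) {s<..t} \<le> 0" by (simp add: \<rho>_Ioc_cdf N_def)
    qed
    then show ?thesis using N_sets by (simp add: null_sets_def)
  qed
  then have "(\<Union>r\<in>\<rat> \<inter> {..b}. N r) \<in> null_sets (\<rho> b)"
    using countable_rat by (intro null_sets_UN') auto
  moreover have "{s. s < b \<and> (\<exists>z. s < z \<and> z \<le> b \<and> backlog b s = backlog b z)} - atoms = (\<Union>r\<in>\<rat> \<inter> {..b}. N r)"
  proof (intro equalityI subsetI)
    fix s assume s: "s \<in> {s. s < b \<and> (\<exists>z. s < z \<and> z \<le> b \<and> backlog b s = backlog b z)} - atoms"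
    then obtain z where z: "s < z" "z \<le> b" "backlog b s = backlog b z" by blast
    obtain r where r: "r \<in> \<rat>" "s < r" "r < z" using Rats_dense_in_real[OF z(1)] by blast
    have "backlog b s = backlog b r" using backlog_antimono[of s r b] backlog_antimono[of r z b] r z by simp
    then have "s \<in> N r" using s r z by (simp add: N_def backlog_cdf_def min_def)
    then show "s \<in> (\<Union>r\<in>\<rat> \<inter> {..b}. N r)" using r z by auto
  qed (auto simp: N_def backlog_cdf_def min_def split: if_splits)
  ultimately show ?thesis by simp
qed

text \<open>At a record, where excess and backlog agree, nothing to the right ever exceeds the excess.
  Hence between two records \<open>s < t\<close> the mass \<open>\<mu>(s,t]\<close> is exactly \<open>\<rho>(s,t] + \<nu>(s,t]\<close>, which gives
  \<open>\<mu> \<le> \<rho> + \<nu>\<close> on the set of records.  Intersecting with a set that carries \<open>\<mu>\<close> and is null for \<open>\<nu>\<close>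
  removes the last term.\<close>

lemma \<mu>_records_le_\<rho>:
  assumes B: "B \<in> sets borel"
  shows "emeasure \<mu> (({s. s \<le> b \<and> backlog b s = excess b s} - atoms) \<inter> B) \<le> emeasure (\<rho> b) B"
proof -
  define E where "E = {s. s \<le> b \<and> backlog b s = excess b s} - atoms"
  have "E = {s. s \<le> b \<and> - backlog_cdf b s = excess b s} - atoms" by (auto simp: E_def backlog_cdf_def min_def)
  also have "\<dots> \<in> sets borel" by measurable
  finally have E [measurable]: "E \<in> sets borel" .
  let ?\<mu> = "density \<mu> (indicator E)"
  have em: "emeasure ?\<mu> C = emeasure \<mu> (E \<inter> C)" if "C \<in> sets borel" for C
    using that E by (simp add: emeasure_restricted)
  have add: "emeasure (add_measure (\<rho> b) \<nu>) C = emeasure (\<rho> b) C + emeasure \<nu> C"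
    if "C \<in> sets borel" for C using that by (intro emeasure_add_measure) simp_all
  have Ioc_borel: "{x<..y::real} \<in> sets borel" for x y by simp
  have le: "emeasure \<mu> (E \<inter> C) \<le> emeasure (\<rho> b) C + emeasure \<nu> C" if C: "C \<in> sets borel" for C
  proof -
    have "emeasure ?\<mu> C \<le> emeasure (add_measure (\<rho> b) \<nu>) C"
    proof (rule emeasure_le_if_Ioc_le[OF _ \<rho>.lf_borel_add[OF \<nu>.lf_borel_axioms] _ C])
      show "lf_borel ?\<mu>"
      proof (rule lf_borelI_Ioc)
        fix x y :: real
        have "emeasure \<mu> (E \<inter> {x<..y}) \<le> emeasure \<mu> {x<..y}" by (rule emeasure_mono) auto
        also have "\<dots> < \<infinity>" by (rule \<mu>.finite_on_bounded) simp
        finally show "emeasure ?\<mu> {x<..y} < \<infinity>" by (simp add: em)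
      qed simp
      fix x y :: real assume xy: "x \<le> y"
      have "emeasure \<mu> (E \<inter> {x<..y}) \<le> emeasure (\<rho> b) {x<..y} + emeasure \<nu> {x<..y}"
      proof (rule \<mu>.emeasure_le_if_hull_le)
        show "E \<inter> {x<..y} \<in> sets borel" using E by simp
        fix s t assume st: "s \<in> E \<inter> {x<..y}" "t \<in> E \<inter> {x<..y}" "s \<le> t"
        have "m {s<..t} = (backlog b s - backlog b t) + n {s<..t}" using excess_split[of s t b] st by (auto simp: E_def)
        moreover have "0 \<le> backlog b s - backlog b t" using backlog_antimono[of s t b] st by (auto simp: E_def)
        ultimately have "emeasure \<mu> {s<..t} = emeasure (\<rho> b) {s<..t} + emeasure \<nu> {s<..t}"
          using st by (simp add: E_def \<mu>.emeasure_eq_measure_bounded \<nu>.emeasure_eq_measure_bounded \<rho>_Ioc)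
        also have "\<dots> \<le> emeasure (\<rho> b) {x<..y} + emeasure \<nu> {x<..y}"
          using st by (intro add_mono emeasure_mono) auto
        finally show "emeasure \<mu> {s<..t} \<le> emeasure (\<rho> b) {x<..y} + emeasure \<nu> {x<..y}" .
      qed (auto simp: E_def atoms_def)
      then show "emeasure ?\<mu> {x<..y} \<le> emeasure (add_measure (\<rho> b) \<nu>) {x<..y}"
        unfolding em[OF Ioc_borel] add[OF Ioc_borel] .
    qed
    then show ?thesis unfolding em[OF C] add[OF C] .
  qed
  obtain A where A: "A \<in> sets borel" "emeasure \<mu> A = 0" "emeasure \<nu> (UNIV - A) = 0"
    using singular unfolding mutually_singular_def by blast
  \<comment> \<open>here \<open>\<mu>\<close> lives off \<open>A\<close> and \<open>\<nu>\<close> on \<open>A\<close>\<close>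
  have "emeasure \<mu> (E \<inter> B) \<le> emeasure \<mu> (E \<inter> (B - A) \<union> A)"
    using A B E by (intro emeasure_mono) auto
  also have "\<dots> \<le> emeasure \<mu> (E \<inter> (B - A)) + emeasure \<mu> A"
    using A B E by (intro emeasure_subadditive) auto
  also have "\<dots> \<le> emeasure (\<rho> b) (B - A) + emeasure \<nu> (B - A)" using le[of "B - A"] A B by simp
  also have "\<dots> \<le> emeasure (\<rho> b) B + emeasure \<nu> (UNIV - A)"
    using A B by (intro add_mono emeasure_mono) auto
  finally show ?thesis using A by (simp add: E_def)
qed

text \<open>At an atom \<open>t\<close> of \<open>\<mu>\<close> the left limit of the excess is \<open>m {t} + excess b t\<close>, since \<open>t\<close> is no atom
  of \<open>\<nu>\<close>.\<close>

lemma atom_excess_le_backlog: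
  assumes "s < t" "t \<le> b" shows "m {t} + excess b t \<le> backlog b s"
proof (cases "m {t} = 0")
  case True then show ?thesis using excess_le_backlog[of s t b] assms by simp
next
  case False
  then have nt: "n {t} = 0" using no_common_atoms by blast
  show ?thesis
  proof (rule field_le_epsilon)
    fix e :: real assume "0 < e"
    then obtain z where z: "z < t" "\<And>y. z \<le> y \<Longrightarrow> n {y<..<t} < e" using \<nu>.small_left by metis
    define y where "y = max z s"
    have y: "s \<le> y" "y < t" "n {y<..<t} < e" using z assms by (auto simp: y_def)
    have "n {y<..t} < e" using \<nu>.measure_Ioc_last[OF y(2)] y(3) nt by simp
    moreover have "m {t} \<le> m {y<..t}" using y by (intro \<mu>.measure_mono_bounded) auto
    ultimately show "m {t} + excess b t \<le> backlog b s + e"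
      using excess_split[of y t b] excess_le_backlog[of s y b] y assms by linarith
  qed
qed

text \<open>If \<open>excess b s\<close> is strictly below the backlog, it stays so for a while by right continuity.
  If it equals the backlog and the bracket opened at \<open>s\<close> is closed at \<open>t\<close>, then the excess is as
  large at \<open>t\<close>, or just before \<open>t\<close>, so that \<open>s\<close> does not contribute to the supremum.\<close>

lemma tau_le_imp_flat:
  assumes s: "s < b" "m {s} = 0" "n {s} = 0" and le: "tau \<mu> \<nu> 0 s \<le> ereal b"
  shows "\<exists>z. s < z \<and> z \<le> b \<and> backlog b s = backlog b z"
proof (cases "excess b s < backlog b s")
  case True
  then obtain z where z: "s < z" "\<And>y. y \<le> z \<Longrightarrow> n {s<..y} < backlog b s - excess b s"
    using \<nu>.small_right[of "backlog b s - excess b s" s] by (metis diff_gt_0_iff_gt)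
  \<comment> \<open>the backlog is flat on \<open>[s,z']\<close>: on this interval the excess stays below \<open>backlog b s\<close>\<close>
  define z' where "z' = min z b"
  have z': "s < z'" "z' \<le> b" "n {s<..z'} < backlog b s - excess b s" using z(1) z(2)[of z'] s by (auto simp: z'_def)
  have "backlog b s \<le> max (backlog b z') (excess b s + n {s<..z'})"
  proof (rule backlog_least)
    fix t assume t: "s \<le> t" "t \<le> b"
    show "excess b t \<le> max (backlog b z') (excess b s + n {s<..z'})"
    proof (cases "t \<le> z'")
      case True
      have "n {s<..t} \<le> n {s<..z'}" using True by (intro \<nu>.measure_mono_bounded) auto
      then have "excess b t \<le> excess b s + n {s<..z'}"
        using excess_split[of s t b] t measure_nonneg[of \<mu> "{s<..t}"] by linarith
      then show ?thesis by simp
    next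
      case False
      then show ?thesis using excess_le_backlog[of z' t b] t by simp
    qed
  qed (use s in simp)
  then have "backlog b s \<le> backlog b z'" using z'(3) by linarith
  then show ?thesis using backlog_antimono[of s z' b] z' by (intro exI[of _ z']) auto
next
  case False
  then have eq: "backlog b s = excess b s" using excess_le_backlog[of s s b] s by simp
  from le s show ?thesis
  proof (rule_tac tau_leE[OF le])
    fix t assume t: "s < t" "t \<le> b" "0 * m {s} + m {s<..<t} \<le> n {s..t}"
    have "excess b s \<le> m {t} + excess b t"
      using excess_split[of s t b] \<mu>.measure_Ioc_last[of s t] \<nu>.measure_Icc_first[of s t] t s by simp
    moreover have "m {t} + excess b t \<le> backlog b ((s + t) / 2)" using t by (intro atom_excess_le_backlog) auto
    ultimately show ?thesis
      using eq backlog_antimono[of s "(s + t) / 2" b] t by (intro exI[of _ "(s + t) / 2"]) auto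
  next
    assume "0 * m {s} + m {s<..b} \<le> n {s..b}"
    then have "excess b s \<le> 0" using \<nu>.measure_Icc_first[of s b] s by (simp add: excess_def)
    then show ?thesis using eq backlog_nonneg[of s b] s by (intro exI[of _ b]) auto
  qed auto
qed

lemma tau_gt_imp_record:
  assumes s: "s \<le> b" "m {s} = 0" and gt: "ereal b < tau \<mu> \<nu> 0 s"
  shows "backlog b s = excess b s"
proof (rule antisym)
  show "backlog b s \<le> excess b s"
  proof (rule backlog_least[OF s(1)])
    fix t assume t: "s \<le> t" "t \<le> b"
    show "excess b t \<le> excess b s"
    proof (cases "s < t")
      case True
      have "\<not> m {s<..<t} \<le> n {s..t}"
        using tau_leI[of 0 s t] True gt t by (auto dest: less_le_trans)
      moreover have "n {s<..t} \<le> n {s..t}" by (rule \<nu>.measure_mono_bounded) auto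
      ultimately show ?thesis
        using excess_split[of s t b] t \<mu>.measure_Ioc_last[OF True] measure_nonneg[of \<mu> "{t}"] by linarith
    qed (use t in simp)
  qed
qed (use excess_le_backlog[of s s b] s in simp)

text \<open>The levels \<open>u\<close> label the pieces of an atom at \<open>s\<close>; if \<open>s\<close> carries no atom, all levels behave alike
  and the fraction is \<open>0\<close> or \<open>1\<close>.\<close>

definition open_fraction :: "real \<Rightarrow> real \<Rightarrow> ennreal" where
  "open_fraction b s = emeasure lborel {u \<in> {0..1}. ereal b < tau \<mu> \<nu> u s}"

lemma measurable_open_fraction [measurable]: "open_fraction b \<in> borel_measurable borel"
proof -
  have "open_fraction b = (\<lambda>s. emeasure lborel (Pair s -` {p \<in> space (borel \<Otimes>\<^sub>M lborel). 0 \<le> snd p \<and> snd p \<le> 1 \<and> ereal b < (\<lambda>(s, u). tau \<mu> \<nu> u s) p}))"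
    by (intro ext arg_cong[where f = "emeasure lborel"]) (auto simp: open_fraction_def space_pair_measure)
  also have "\<dots> \<in> borel_measurable borel"
    by (rule lborel.measurable_emeasure_Pair) measurable
  finally show ?thesis .
qed

lemma open_fraction_diffuse:
  assumes "m {s} = 0" shows "open_fraction b s = indicator {s. ereal b < tau \<mu> \<nu> 0 s} s"
proof -
  have "emeasure \<mu> {s} = 0" using assms by (simp add: \<mu>.emeasure_eq_measure_bounded)
  then have "tau \<mu> \<nu> u s = tau \<mu> \<nu> 0 s" for u by (simp add: tau_def)
  then obtain c where c: "tau \<mu> \<nu> u s = c" for u by blast
  then have "{u \<in> {0..1}. ereal b < tau \<mu> \<nu> u s} = (if ereal b < c then {0..1} else {})" by auto
  then show ?thesis by (simp add: open_fraction_def indicator_def c)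
qed

text \<open>By time \<open>b\<close> the services have used up \<open>backlog b s - excess b s\<close> of the atom: the levels
  \<open>u\<close> with \<open>u * m {s}\<close> above this amount are still open, those below it are closed.\<close>

lemma open_fraction_atom:
  assumes s: "s \<le> b" "m {s} \<noteq> 0"
  shows "open_fraction b s * emeasure \<mu> {s} = ennreal (m {s} - (backlog b s - excess b s))"
proof -
  have m0: "0 < m {s}" using s(2) by (simp add: zero_less_measure_iff)
  have n0: "n {s} = 0" using no_common_atoms s(2) by blast
  define g where "g = backlog b s - excess b s"
  have g0: "0 \<le> g" using excess_le_backlog[of s s b] s by (simp add: g_def)
  have 1: "ereal b < tau \<mu> \<nu> u s" if u: "0 \<le> u" "g < u * m {s}" for u
  proof (rule ccontr)
    assume "\<not> ereal b < tau \<mu> \<nu> u s"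
    then have "tau \<mu> \<nu> u s \<le> ereal b" by simp
    then show False using u(1) s(1)
    proof (rule tau_leE)
      fix t assume t: "s < t" "t \<le> b" "u * m {s} + m {s<..<t} \<le> n {s..t}"
      show False
        using excess_split[of s t b] \<mu>.measure_Ioc_last[of s t] \<nu>.measure_Icc_first[of s t] t s n0
          atom_excess_le_backlog[of s t b] u(2) by (simp add: g_def)
    next
      assume "u * m {s} + m {s<..b} \<le> n {s..b}"
      then show False using \<nu>.measure_Icc_first[of s b] n0 u backlog_nonneg[of s b] s by (simp add: g_def excess_def)
    qed
  qed
  have 2: "tau \<mu> \<nu> u s \<le> ereal b" if u: "0 \<le> u" "u * m {s} < g" for u
  proof -
    have "\<exists>t. s \<le> t \<and> t \<le> b \<and> excess b s + u * m {s} < excess b t"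
    proof (rule ccontr)
      assume "\<not> ?thesis"
      then have "backlog b s \<le> excess b s + u * m {s}" using s by (intro backlog_least) (auto simp: not_less)
      then show False using u by (simp add: g_def)
    qed
    then obtain t where t: "s \<le> t" "t \<le> b" "excess b s + u * m {s} < excess b t" by blast
    have "0 \<le> u * m {s}" using u by simp
    then have st: "s < t" using t by (cases "s = t") auto
    have "m {s<..<t} \<le> m {s<..t}" "n {s<..t} \<le> n {s..t}"
      by (auto intro!: \<mu>.measure_mono_bounded \<nu>.measure_mono_bounded)
    then have "u * m {s} + m {s<..<t} \<le> n {s..t}" using excess_split[of s t b] t by linarith
    from tau_leI[OF u(1) st this] show ?thesis using t(2) by (auto intro: order_trans)
  qed
  have "open_fraction b s = ennreal (1 - g / m {s})"
  proof (rule antisym)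
    have "open_fraction b s \<le> emeasure lborel {g / m {s}..1}"
      unfolding open_fraction_def
    proof (rule emeasure_mono)
      show "{u \<in> {0..1}. ereal b < tau \<mu> \<nu> u s} \<subseteq> {g / m {s}..1}"
      proof
        fix u assume u: "u \<in> {u \<in> {0..1}. ereal b < tau \<mu> \<nu> u s}"
        then have "g \<le> u * m {s}" using 2[of u] not_le by (metis (mono_tags) atLeastAtMost_iff mem_Collect_eq)
        then show "u \<in> {g / m {s}..1}" using u unfolding atLeastAtMost_iff pos_divide_le_eq[OF m0] by simp
      qed
    qed simp
    also have "\<dots> = ennreal (1 - g / m {s})"
      by (cases "g / m {s} \<le> 1") (auto simp: ennreal_neg)
    finally show "open_fraction b s \<le> ennreal (1 - g / m {s})" .
    have "ennreal (1 - g / m {s}) = emeasure lborel {g / m {s}<..1}"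
      by (cases "g / m {s} \<le> 1") (auto simp: ennreal_neg)
    also have "\<dots> \<le> open_fraction b s"
      unfolding open_fraction_def
    proof (rule emeasure_mono)
      have "0 \<le> g / m {s}" using g0 by simp
      show "{g / m {s}<..1} \<subseteq> {u \<in> {0..1}. ereal b < tau \<mu> \<nu> u s}"
      proof
        fix u assume "u \<in> {g / m {s}<..1}"
        then have u: "g / m {s} < u" "u \<le> 1" by auto
        then have "g < u * m {s}" unfolding pos_divide_less_eq[OF m0] by simp
        moreover have "0 \<le> u" using \<open>0 \<le> g / m {s}\<close> u(1) by linarith
        ultimately show "u \<in> {u \<in> {0..1}. ereal b < tau \<mu> \<nu> u s}" using 1[of u] u(2) by simp
      qed
      have "{u \<in> space borel. u \<in> {0..1} \<and> ereal b < tau \<mu> \<nu> u s} \<in> sets borel" by measurable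
      then show "{u \<in> {0..1}. ereal b < tau \<mu> \<nu> u s} \<in> sets lborel" by simp
    qed
    finally show "ennreal (1 - g / m {s}) \<le> open_fraction b s" .
  qed
  then have "open_fraction b s * emeasure \<mu> {s} = ennreal (1 - g / m {s}) * ennreal (m {s})"
    by (simp add: \<mu>.emeasure_eq_measure_bounded)
  also have "\<dots> = ennreal ((1 - g / m {s}) * m {s})" using m0 by (simp add: ennreal_mult'')
  also have "(1 - g / m {s}) * m {s} = m {s} - g" using m0 by (simp add: field_simps)
  finally show ?thesis by (simp add: g_def)
qed

text \<open>Just before \<open>s\<close> the backlog is the larger of \<open>backlog b s\<close> and the left limit
  \<open>excess b s + m {s}\<close> of the excess.\<close>

lemma \<rho>_atom:
  assumes s: "s \<le> b" "m {s} \<noteq> 0"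
  shows "emeasure (\<rho> b) {s} = ennreal (m {s} - (backlog b s - excess b s))"
proof -
  have n0: "n {s} = 0" using no_common_atoms s(2) by blast
  define g where "g = backlog b s - excess b s"
  let ?r = "measure (\<rho> b) {s}"
  have \<rho>r: "measure (\<rho> b) {y<..s} = backlog b y - backlog b s" if "y < s" for y
    using \<rho>_Ioc[of y s b] backlog_antimono[of y s b] that s by (simp add: measure_def)
  have "?r \<le> max 0 (m {s} - g)"
  proof (rule field_le_epsilon)
    fix e :: real assume e: "0 < e"
    then obtain y where y: "y < s" "\<And>t. y \<le> t \<Longrightarrow> m {t<..<s} < e" using \<mu>.small_left by metis
    have "backlog b y \<le> max (backlog b s) (excess b s + m {s} + e)"
    proof (rule backlog_least)
      fix t assume t: "y \<le> t" "t \<le> b"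
      show "excess b t \<le> max (backlog b s) (excess b s + m {s} + e)"
      proof (cases "t < s")
        case True
        then show ?thesis using excess_split[of t s b] \<mu>.measure_Ioc_last[of t s] y(2)[OF t(1)] s t
          measure_nonneg[of \<nu> "{t<..s}"] by linarith
      next
        case False
        then show ?thesis using excess_le_backlog[of s t b] t by simp
      qed
    qed (use y s in simp)
    moreover have "?r \<le> measure (\<rho> b) {y<..s}" using y by (intro \<rho>.measure_mono_bounded) auto
    ultimately show "?r \<le> max 0 (m {s} - g) + e" using \<rho>r[OF y(1)] e by (auto simp: g_def)
  qed
  moreover have "max 0 (m {s} - g) \<le> ?r"
  proof (rule field_le_epsilon)
    fix e :: real assume e: "0 < e"
    then have "0 < e / 2" by simp
    then obtain y y' where y: "y < s" "\<And>t. y \<le> t \<Longrightarrow> n {t<..<s} < e / 2"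
      and y': "y' < s" "\<And>t. y' \<le> t \<Longrightarrow> measure (\<rho> b) {t<..<s} < e / 2"
      using \<nu>.small_left \<rho>.small_left by metis
    define z where "z = max y y'"
    have z: "z < s" "n {z<..<s} < e / 2" "measure (\<rho> b) {z<..<s} < e / 2"
      using y y' by (auto simp: z_def)
    have "m {s} \<le> m {z<..s}" using z by (intro \<mu>.measure_mono_bounded) auto
    then have "m {s} - e / 2 + excess b s \<le> backlog b z"
      using excess_le_backlog[of z z b] excess_split[of z s b] \<nu>.measure_Ioc_last[OF z(1)] z n0 s by linarith
    moreover have "backlog b z - backlog b s \<le> e / 2 + ?r"
      using \<rho>r[OF z(1)] \<rho>.measure_Ioc_last[OF z(1), of b] z by linarith
    ultimately show "max 0 (m {s} - g) \<le> ?r + e" using e by (auto simp: g_def)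
  qed
  ultimately have "?r = max 0 (m {s} - g)" by simp
  then show ?thesis by (simp add: \<rho>.emeasure_eq_measure_bounded g_def ennreal_max_0 max.commute)
qed

text \<open>Both sides are the mass of \<open>(c,b]\<close>, under \<open>\<mu>\<close> with density \<open>open_fraction b\<close> on the left and
  under \<open>\<rho> b\<close> on the right.  On the countable set \<open>Q\<close>, which contains all atoms, these measures are
  compared point by point.  Elsewhere the density is an indicator: its set consists of records,
  and off this set the backlog is flat.\<close>

lemma unmatched_mass:
  assumes cb: "c \<le> b"
  shows "(\<integral>\<^sup>+s. open_fraction b s * indicator {c<..b} s \<partial>\<mu>) = ennreal (backlog b c)"
proof -
  let ?w = "density \<mu> (open_fraction b)"
  let ?J = "{c<..b}"
  \<comment> \<open>the point \<open>b\<close> belongs to \<open>Q\<close> because flatness is claimed only for points to the left of \<open>b\<close>\<close>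
  define Q where "Q = atoms \<union> {s. emeasure \<nu> {s} \<noteq> 0} \<union> {b}"
  define G where "G = {s. ereal b < tau \<mu> \<nu> 0 s}"
  have cQ: "countable Q" using countable_atoms_\<mu> \<nu>.countable_atoms by (simp add: Q_def)
  have [measurable]: "Q \<in> sets borel" by (rule sets.countable[OF _ cQ]) auto
  have [measurable]: "G \<in> sets borel" unfolding G_def by measurable
  have w: "emeasure ?w B = (\<integral>\<^sup>+s. open_fraction b s * indicator B s \<partial>\<mu>)" if "B \<in> sets borel" for B
    using that by (intro emeasure_density) auto
  have singletons: "emeasure ?w {s} = emeasure (\<rho> b) {s}" if "s \<le> b" for s
  proof (cases "m {s} = 0")
    case True
    then have 0: "emeasure \<mu> {s} = 0" by (simp add: \<mu>.emeasure_eq_measure_bounded)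
    then have "emeasure (\<rho> b) {s} = 0" using \<rho>_le_\<mu>[of "{s}" b] by simp
    moreover have "emeasure ?w {s} = 0" using 0 by (simp add: w nn_integral_indicator_singleton)
    ultimately show ?thesis by simp
  next
    case False
    then show ?thesis using open_fraction_atom[OF that False] \<rho>_atom[OF that False] by (simp add: w nn_integral_indicator_singleton)
  qed
  have "emeasure ?w (?J \<inter> Q) = (\<integral>\<^sup>+x. emeasure ?w {x} \<partial>count_space (?J \<inter> Q))"
    using cQ by (intro emeasure_countable_singleton) (auto intro: countable_Int2)
  also have "\<dots> = (\<integral>\<^sup>+x. emeasure (\<rho> b) {x} \<partial>count_space (?J \<inter> Q))"
    by (intro nn_integral_cong singletons) auto
  also have "\<dots> = emeasure (\<rho> b) (?J \<inter> Q)"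
    using cQ by (intro emeasure_countable_singleton[symmetric]) (auto intro: countable_Int2)
  finally have on_Q: "emeasure ?w (?J \<inter> Q) = emeasure (\<rho> b) (?J \<inter> Q)" .
  have Q0: "m {s} = 0" "n {s} = 0" "s \<noteq> b" "s \<notin> atoms" if "s \<notin> Q" for s
    using that by (auto simp: Q_def atoms_def measure_def)
  have "emeasure ?w (?J - Q) = (\<integral>\<^sup>+s. indicator ((?J - Q) \<inter> G) s \<partial>\<mu>)"
  proof -
    have "open_fraction b s * indicator (?J - Q) s = (indicator ((?J - Q) \<inter> G) s :: ennreal)" for s
      using open_fraction_diffuse[of s b] Q0(1)[of s] by (cases "s \<in> ?J - Q") (auto simp: G_def indicator_def)
    then show ?thesis by (simp add: w)
  qed
  also have "\<dots> = emeasure \<mu> ((?J - Q) \<inter> G)" by (intro nn_integral_indicator) simp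
  finally have wG: "emeasure ?w (?J - Q) = emeasure \<mu> ((?J - Q) \<inter> G)" .
  have "emeasure \<mu> ((?J - Q) \<inter> G) \<le> emeasure \<mu> (({s. s \<le> b \<and> backlog b s = excess b s} - atoms) \<inter> ((?J - Q) \<inter> G))"
    using tau_gt_imp_record Q0 by (intro eq_refl arg_cong[where f = "emeasure \<mu>"]) (auto simp: G_def)
  also have "\<dots> \<le> emeasure (\<rho> b) ((?J - Q) \<inter> G)" by (rule \<mu>_records_le_\<rho>) simp
  also have "\<dots> \<le> emeasure (\<rho> b) (?J - Q)" by (rule emeasure_mono) auto
  finally have U: "emeasure ?w (?J - Q) \<le> emeasure (\<rho> b) (?J - Q)" using wG by simp
  let ?N = "{s. s < b \<and> (\<exists>z. s < z \<and> z \<le> b \<and> backlog b s = backlog b z)} - atoms"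
  have "emeasure (\<rho> b) (?J - Q) \<le> emeasure (\<rho> b) ((?J - Q) \<inter> G \<union> ?N)"
  proof (rule emeasure_mono)
    show "?J - Q \<subseteq> (?J - Q) \<inter> G \<union> ?N"
    proof
      fix x assume x: "x \<in> ?J - Q"
      then have "x \<notin> Q" "x < b" using Q0(3)[of x] by auto
      then show "x \<in> (?J - Q) \<inter> G \<union> ?N"
        using x tau_le_imp_flat[of x b] Q0[of x] by (cases "x \<in> G") (auto simp: G_def not_less)
    qed
  qed (use \<rho>_flat_null[of b] in auto)
  also have "\<dots> = emeasure (\<rho> b) ((?J - Q) \<inter> G)"
    by (rule emeasure_Un_null_set[OF _ \<rho>_flat_null]) simp
  also have "\<dots> \<le> emeasure \<mu> ((?J - Q) \<inter> G)" by (rule \<rho>_le_\<mu>) simp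
  finally have L: "emeasure (\<rho> b) (?J - Q) \<le> emeasure ?w (?J - Q)" using wG by simp
  have split: "emeasure M ?J = emeasure M (?J \<inter> Q) + emeasure M (?J - Q)" if [simp]: "sets M = sets borel" for M
  proof -
    have "emeasure M (?J \<inter> Q) + emeasure M (?J - Q) = emeasure M ((?J \<inter> Q) \<union> (?J - Q))"
      by (rule plus_emeasure) auto
    then show ?thesis by (simp add: Int_Diff_Un)
  qed
  have "(\<integral>\<^sup>+s. open_fraction b s * indicator ?J s \<partial>\<mu>) = emeasure ?w ?J" by (simp add: w)
  also have "\<dots> = emeasure (\<rho> b) ?J" using split[of ?w] split[of "\<rho> b"] on_Q U L by simp
  also have "\<dots> = ennreal (backlog b c)" using \<rho>_Ioc[of c b b] cb by simp
  finally show ?thesis .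
qed

end

section \<open>The mass received by an interval\<close>

text \<open>The kernel \<open>K_tau\<close> depends on \<open>\<omega>\<close> only through the two measures; here they are fixed and the
  parameter is a dummy.\<close>

definition kern :: "real measure \<Rightarrow> real measure \<Rightarrow> real \<Rightarrow> real measure" where
  "kern \<mu> \<nu> s = K_tau (\<lambda>_. \<mu>) (\<lambda>_. \<nu>) () s"

lemma kern_eq_K_tau: "kern (\<xi> \<omega>) (\<eta> \<omega>) s = K_tau \<xi> \<eta> \<omega> s"
  by (simp add: kern_def K_tau_def)

definition received :: "real measure \<Rightarrow> real measure \<Rightarrow> real set \<Rightarrow> ennreal" where
  "received \<mu> \<nu> C = (\<integral>\<^sup>+s. emeasure (kern \<mu> \<nu> s) C \<partial>\<mu>)"

lemma sets_kern [simp, measurable_cong]: "sets (kern \<mu> \<nu> s) = sets borel"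
  by (simp add: kern_def)

lemma (in lf_borel) measurable_kern:
  assumes "lf_borel \<nu>" "C \<in> sets borel"
  shows "(\<lambda>s. emeasure (kern \<mu> \<nu> s) C) \<in> borel_measurable borel"
proof -
  have "(\<lambda>(w, s). emeasure (K_tau (\<lambda>_. \<mu>) (\<lambda>_. \<nu>) w s) C) \<in> borel_measurable (count_space (UNIV :: unit set) \<Otimes>\<^sub>M borel)"
    by (rule measurable_K_tau) (use assms in \<open>auto simp: lf_kernel_def lf_borel_axioms\<close>)
  from measurable_compose[OF _ this, of "\<lambda>s. ((), s)"]
  show ?thesis by (simp add: kern_def)
qed

context singular_pair begin

lemma kern_measurable: "C \<in> sets borel \<Longrightarrow> (\<lambda>s. emeasure (kern \<mu> \<nu> s) C) \<in> borel_measurable borel"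
  by (rule \<mu>.measurable_kern[OF \<nu>.lf_borel_axioms])

lemma open_fraction_nn_integral: "open_fraction b s = (\<integral>\<^sup>+u. indicator {x. ereal b < x} (tau \<mu> \<nu> u s) * indicator {0..1} u \<partial>lborel)"
proof -
  have "open_fraction b s = (\<integral>\<^sup>+u. indicator {u \<in> {0..1}. ereal b < tau \<mu> \<nu> u s} u \<partial>lborel)"
  proof -
    have "{u \<in> space borel. u \<in> {0..1} \<and> ereal b < tau \<mu> \<nu> u s} \<in> sets borel" by measurable
    then show ?thesis unfolding open_fraction_def by (intro nn_integral_indicator[symmetric]) simp
  qed
  also have "\<dots> = (\<integral>\<^sup>+u. indicator {x. ereal b < x} (tau \<mu> \<nu> u s) * indicator {0..1} u \<partial>lborel)"
    by (intro nn_integral_cong) (auto simp: indicator_def)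
  finally show ?thesis .
qed

text \<open>What is open at \<open>a\<close> is either matched in \<open>(a,b]\<close> or still open at \<open>b\<close>.\<close>

lemma kern_Ioc:
  assumes "a \<le> b" shows "emeasure (kern \<mu> \<nu> s) {a<..b} + open_fraction b s = open_fraction a s"
proof -
  have [measurable]: "ereal ` {a<..b} \<in> sets borel" "{x. ereal b < x} \<in> sets borel"
    using sets_ereal_image[of "{a<..b}"] by (auto simp: greaterThan_def[symmetric])
  have "emeasure (kern \<mu> \<nu> s) {a<..b} + open_fraction b s =
    (\<integral>\<^sup>+u. indicator (ereal ` {a<..b}) (tau \<mu> \<nu> u s) * indicator {0..1} u +
      indicator {x. ereal b < x} (tau \<mu> \<nu> u s) * indicator {0..1} u \<partial>lborel)"
    by (simp add: kern_def emeasure_K_tau open_fraction_nn_integral nn_integral_add)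
  also have "\<dots> = open_fraction a s"
    unfolding open_fraction_nn_integral
  proof (intro nn_integral_cong)
    fix u
    have *: "(indicator (ereal ` {a<..b}) x + indicator {x. ereal b < x} x :: ennreal) = indicator {x. ereal a < x} x" for x
      using assms by (cases x) (auto simp: indicator_def)
    show "indicator (ereal ` {a<..b}) (tau \<mu> \<nu> u s) * indicator {0..1} u +
      indicator {x. ereal b < x} (tau \<mu> \<nu> u s) * indicator {0..1} u =
      (indicator {x. ereal a < x} (tau \<mu> \<nu> u s) * indicator {0..1} u :: ennreal)"
      by (simp only: distrib_right[symmetric] *)
  qed
  finally show ?thesis .
qed

lemma open_fraction_eq_1: "a < s \<Longrightarrow> open_fraction a s = 1"
proof -
  assume "a < s"
  then have "ereal a < tau \<mu> \<nu> u s" for u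
    using less_le_trans[of "ereal a" "ereal s", OF _ tau_ge] by simp
  then have "{u \<in> {0..1}. ereal a < tau \<mu> \<nu> u s} = {0..1}" by auto
  then show ?thesis by (simp add: open_fraction_def)
qed

text \<open>Conservation of mass in the queue that starts empty at \<open>c\<close>: what is waiting at \<open>a\<close> or arrives in
  \<open>(a,b]\<close> is either served in \<open>(a,b]\<close> or waiting at \<open>b\<close>.\<close>

lemma received_truncated:
  assumes cab: "c \<le> a" "a \<le> b"
  shows "(\<integral>\<^sup>+s. emeasure (kern \<mu> \<nu> s) {a<..b} * indicator {c<..} s \<partial>\<mu>) + ennreal (backlog b c)
    = ennreal (backlog a c) + emeasure \<mu> {a<..b}"
proof -
  have [measurable]: "(\<lambda>s. emeasure (kern \<mu> \<nu> s) {a<..b}) \<in> borel_measurable borel"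
    by (rule kern_measurable) simp
  have "(\<integral>\<^sup>+s. emeasure (kern \<mu> \<nu> s) {a<..b} * indicator {c<..} s \<partial>\<mu>) + ennreal (backlog b c) =
    (\<integral>\<^sup>+s. emeasure (kern \<mu> \<nu> s) {a<..b} * indicator {c<..} s + open_fraction b s * indicator {c<..b} s \<partial>\<mu>)"
    using unmatched_mass[of c b] cab by (subst nn_integral_add) auto
  also have "\<dots> = (\<integral>\<^sup>+s. open_fraction a s * indicator {c<..a} s + indicator {a<..b} s \<partial>\<mu>)"
  proof (rule nn_integral_cong)
    fix s
    have far: "emeasure (kern \<mu> \<nu> s) {a<..b} = 0" if "b < s"
      using kern_Ioc[OF cab(2), of s] that cab by (simp add: open_fraction_eq_1)
    show "emeasure (kern \<mu> \<nu> s) {a<..b} * indicator {c<..} s + open_fraction b s * indicator {c<..b} s =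
      open_fraction a s * indicator {c<..a} s + indicator {a<..b} s"
      using kern_Ioc[OF cab(2), of s] far cab open_fraction_eq_1[of a s]
      by (cases "s \<le> c"; cases "s \<le> a"; cases "s \<le> b") (auto simp: indicator_def)
  qed
  also have "\<dots> = ennreal (backlog a c) + emeasure \<mu> {a<..b}"
    using unmatched_mass[of c a] cab by (subst nn_integral_add) auto
  finally show ?thesis .
qed

lemma received_truncated_le:
  assumes cab: "c \<le> a" "a \<le> b"
  shows "(\<integral>\<^sup>+s. emeasure (kern \<mu> \<nu> s) {a<..b} * indicator {c<..} s \<partial>\<mu>) \<le> emeasure \<nu> {a<..b}"
    (is "?k \<le> _")
proof -
  have "backlog a c \<le> backlog b c - excess b a"
  proof (rule backlog_least)
    fix t assume "c \<le> t" "t \<le> a"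
    then show "excess a t \<le> backlog b c - excess b a" using excess_end_split[of t a b] excess_le_backlog[of c t b] cab by simp
  qed (use cab in simp)
  moreover have "excess b a = m {a<..b} - n {a<..b}" by (simp add: excess_def)
  ultimately have "backlog a c + m {a<..b} \<le> n {a<..b} + backlog b c" by simp
  then have "ennreal (backlog a c) + ennreal (m {a<..b}) \<le> ennreal (n {a<..b}) + ennreal (backlog b c)"
    using backlog_nonneg[of c a] backlog_nonneg[of c b] cab by (simp flip: ennreal_plus)
  then have "?k + ennreal (backlog b c) \<le> emeasure \<nu> {a<..b} + ennreal (backlog b c)"
    using received_truncated[OF cab] by (simp add: \<mu>.emeasure_eq_measure_bounded \<nu>.emeasure_eq_measure_bounded)
  then show ?thesis by (simp add: add.commute[of _ "ennreal (backlog b c)"] ennreal_add_left_cancel_le)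
qed

lemma received_Ioc_le:
  assumes ab: "a \<le> b"
  shows "received \<mu> \<nu> {a<..b} \<le> emeasure \<nu> {a<..b}"
proof -
  let ?f = "\<lambda>s. emeasure (kern \<mu> \<nu> s) {a<..b}"
  have [measurable]: "?f \<in> borel_measurable borel" by (rule kern_measurable) simp
  \<comment> \<open>let the time \<open>c = a - i\<close> at which the queue starts empty tend to \<open>-\<infinity>\<close>\<close>
  define A where "A i = {a - real i<..}" for i
  have em: "emeasure (density \<mu> ?f) B = (\<integral>\<^sup>+s. ?f s * indicator B s \<partial>\<mu>)" if "B \<in> sets borel" for B
    using that by (intro emeasure_density) auto
  have "(\<Union>i. A i) = UNIV"
  proof -
    have "\<exists>i. x \<in> A i" for x using reals_Archimedean2[of "a - x"] by (auto simp: A_def algebra_simps)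
    then show ?thesis by auto
  qed
  then have "received \<mu> \<nu> {a<..b} = emeasure (density \<mu> ?f) (\<Union>i. A i)" by (simp add: em received_def)
  also have "\<dots> = (SUP i. emeasure (density \<mu> ?f) (A i))"
  proof (rule SUP_emeasure_incseq[symmetric])
    show "incseq A" by (rule incseq_SucI) (auto simp: A_def)
  qed (auto simp: A_def)
  also have "\<dots> \<le> emeasure \<nu> {a<..b}"
  proof (rule SUP_least)
    fix i
    have "A i \<in> sets borel" by (simp add: A_def)
    then show "emeasure (density \<mu> ?f) (A i) \<le> emeasure \<nu> {a<..b}"
      using received_truncated_le[of "a - real i" a b] ab by (simp add: em A_def)
  qed
  finally show ?thesis .
qed

text \<open>Start the queue at \<open>c < s\<close>.  As the bracket at \<open>s\<close> is never closed, the queue does not become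
  empty after \<open>s\<close>: in the supremum defining the backlog at \<open>b\<close> the times up to \<open>a\<close> suffice, so no service in
  \<open>(a,b]\<close> is wasted.\<close>

lemma received_Ioc_ge:
  assumes ab: "s \<le> a" "a \<le> b" and u: "0 \<le> u" "u \<le> 1" and inf: "tau \<mu> \<nu> u s = \<infinity>"
  shows "emeasure \<nu> {a<..b} \<le> received \<mu> \<nu> {a<..b}"
proof -
  define c where "c = s - 1"
  have c: "c \<le> a" "c < s" using ab by (auto simp: c_def)
  have unc: "n {s..t} < u * m {s} + m {s<..<t}" if "s < t" for t
    using tau_leI[OF u(1) that] inf by (auto simp: not_le[symmetric])
  have "backlog b c \<le> backlog a c + excess b a"
  proof (rule backlog_least)
    fix t assume t: "c \<le> t" "t \<le> b"
    have "\<exists>z. c \<le> z \<and> z \<le> a \<and> excess b t \<le> excess b z"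
    proof (cases "t \<le> a")
      case False
      then have st: "s < t" using ab by simp
      then have "0 < u * m {s} + m {s<..<t} - n {s..t}" using unc by simp
      then obtain z where z: "z < s" "\<And>y. z \<le> y \<Longrightarrow> n {y<..<s} < u * m {s} + m {s<..<t} - n {s..t}"
        using \<nu>.small_left by metis
      \<comment> \<open>just before \<open>s\<close> the excess exceeds that at \<open>t\<close>: the strict inequality at \<open>s\<close> leaves room for the \<open>\<nu>\<close>-mass of \<open>(y,s)\<close>\<close>
      define y where "y = max z c"
      have y: "y < s" "c \<le> y" "n {y<..<s} < u * m {s} + m {s<..<t} - n {s..t}"
        using z c by (auto simp: y_def)
      have "u * m {s} \<le> m {s}" using u mult_right_mono[of u 1 "m {s}"] by simp
      moreover have "m {s} + m {s<..t} \<le> m {y<..t}"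
        using \<mu>.measure_Icc_first[of s t] st y by (simp flip: \<mu>.measure_Icc_first) (auto intro!: \<mu>.measure_mono_bounded)
      moreover have "m {s<..<t} \<le> m {s<..t}" by (rule \<mu>.measure_mono_bounded) auto
      moreover have "n {y<..t} = n {y<..<s} + n {s..t}"
      proof -
        have "{y<..t} = {y<..<s} \<union> {s..t}" using y st by auto
        moreover have "{y<..<s} \<inter> {s..t} = {}" by auto
        ultimately show ?thesis using \<nu>.measure_split[of "{y<..<s}" "{s..t}"] by simp
      qed
      ultimately have "excess b t \<le> excess b y" using excess_split[of y t b] y st t by linarith
      then show ?thesis using y ab by (intro exI[of _ y]) auto
    qed (use t in auto)
    then obtain z where "c \<le> z" "z \<le> a" "excess b t \<le> excess b z" by blast
    then show "excess b t \<le> backlog a c + excess b a" using excess_end_split[of z a b] excess_le_backlog[of c z a] ab by simp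
  qed (use ab c in simp)
  then have "n {a<..b} + backlog b c \<le> backlog a c + m {a<..b}" by (simp add: excess_def)
  then have "ennreal (n {a<..b}) + ennreal (backlog b c) \<le> ennreal (backlog a c) + ennreal (m {a<..b})"
    using backlog_nonneg[of c a] backlog_nonneg[of c b] ab c by (simp flip: ennreal_plus)
  also have "\<dots> = (\<integral>\<^sup>+s. emeasure (kern \<mu> \<nu> s) {a<..b} * indicator {c<..} s \<partial>\<mu>) + ennreal (backlog b c)"
    using received_truncated[OF c(1) ab(2)] by (simp add: \<mu>.emeasure_eq_measure_bounded)
  also have "\<dots> \<le> received \<mu> \<nu> {a<..b} + ennreal (backlog b c)"
    unfolding received_def by (intro add_right_mono nn_integral_mono) (auto simp: indicator_def)
  finally have "emeasure \<nu> {a<..b} + ennreal (backlog b c) \<le> received \<mu> \<nu> {a<..b} + ennreal (backlog b c)"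
    by (simp add: \<nu>.emeasure_eq_measure_bounded)
  then show ?thesis by (simp add: add.commute[of _ "ennreal (backlog b c)"] ennreal_add_left_cancel_le)
qed

definition received_measure :: "real measure" where
  "received_measure = measure_of UNIV (sets borel) (received \<mu> \<nu>)"

lemma sets_received_measure [simp]: "sets received_measure = sets borel"
  unfolding received_measure_def using sets.sigma_sets_eq[of "borel :: real measure"] by simp

lemma emeasure_received_measure:
  assumes "C \<in> sets borel" shows "emeasure received_measure C = received \<mu> \<nu> C"
  unfolding received_measure_def
proof (rule emeasure_measure_of_sigma)
  show "sigma_algebra UNIV (sets (borel :: real measure))"
    using sets.sigma_algebra_axioms[of "borel :: real measure"] by simp
  show "countably_additive (sets borel) (received \<mu> \<nu>)"
  proof (rule countably_additiveI)
    fix A :: "nat \<Rightarrow> real set" assume A: "range A \<subseteq> sets borel" "disjoint_family A"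
    have "(\<Sum>i. received \<mu> \<nu> (A i)) = (\<integral>\<^sup>+s. (\<Sum>i. emeasure (kern \<mu> \<nu> s) (A i)) \<partial>\<mu>)"
      unfolding received_def using A by (intro nn_integral_suminf[symmetric]) (auto intro: kern_measurable)
    also have "\<dots> = received \<mu> \<nu> (\<Union>i. A i)"
      unfolding received_def using A by (intro nn_integral_cong suminf_emeasure) auto
    finally show "(\<Sum>i. received \<mu> \<nu> (A i)) = received \<mu> \<nu> (\<Union>i. A i)" .
  qed
qed (auto simp: positive_def received_def assms)

text \<open>The comparison on half-open intervals extends to Borel sets once \<open>received \<mu> \<nu>\<close> is known to be a measure.\<close>

lemma received_le:
  assumes "C \<in> sets borel" shows "received \<mu> \<nu> C \<le> emeasure \<nu> C"
proof -
  have "lf_borel received_measure"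
  proof (rule lf_borelI_Ioc)
    fix x y :: real
    have "emeasure received_measure {x<..y} \<le> emeasure \<nu> {x<..y}"
      using received_Ioc_le[of x y] by (cases "x \<le> y") (auto simp: emeasure_received_measure received_def)
    then show "emeasure received_measure {x<..y} < \<infinity>" using \<nu>.finite_on_bounded[of "{x<..y}"] by (auto intro: le_less_trans)
  qed simp
  then have "emeasure received_measure C \<le> emeasure \<nu> C"
    by (rule emeasure_le_if_Ioc_le[OF _ \<nu>.lf_borel_axioms _ assms]) (simp add: emeasure_received_measure received_Ioc_le)
  then show ?thesis using assms by (simp add: emeasure_received_measure)
qed

text \<open>Two measures of which one dominates the other agree inside every set of finite mass on which
  their totals agree.\<close>

lemma received_eq_if_Ioc_eq:
  assumes C: "C \<in> sets borel" and eq: "\<And>j::int. received \<mu> \<nu> {real_of_int j<..real_of_int j + 1} = emeasure \<nu> {real_of_int j<..real_of_int j + 1}"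
  shows "received \<mu> \<nu> C = emeasure \<nu> C"
proof -
  define J where "J j = {real_of_int j<..real_of_int j + 1}" for j :: int
  have J[simp]: "J j \<in> sets borel" for j by (simp add: J_def)
  have CJ [simp]: "C \<inter> J j \<in> sets borel" "J j - C \<in> sets borel" for j using C by auto
  have part: "emeasure received_measure (C \<inter> J j) = emeasure \<nu> (C \<inter> J j)" for j
  proof (rule antisym)
    show "emeasure received_measure (C \<inter> J j) \<le> emeasure \<nu> (C \<inter> J j)" using received_le[of "C \<inter> J j"] C by (simp add: emeasure_received_measure)
    have split: "emeasure N (J j) = emeasure N (C \<inter> J j) + emeasure N (J j - C)" if [simp]: "sets N = sets borel" for N
    proof -
      have "emeasure N (C \<inter> J j) + emeasure N (J j - C) = emeasure N ((C \<inter> J j) \<union> (J j - C))"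
        using C by (intro plus_emeasure) auto
      moreover have "(C \<inter> J j) \<union> (J j - C) = J j" by blast
      ultimately show ?thesis by simp
    qed
    have fin: "emeasure \<nu> (J j - C) < \<infinity>" by (rule \<nu>.finite_on_bounded) (auto simp: J_def intro: bounded_subset[of "{real_of_int j<..real_of_int j + 1}"])
    have "emeasure \<nu> (J j - C) + emeasure \<nu> (C \<inter> J j) = emeasure \<nu> (J j)" by (simp add: split add.commute)
    also have "\<dots> = emeasure received_measure (J j)" using eq[of j] by (simp add: emeasure_received_measure J_def)
    also have "\<dots> = emeasure received_measure (J j - C) + emeasure received_measure (C \<inter> J j)" by (simp add: split add.commute)
    also have "\<dots> \<le> emeasure \<nu> (J j - C) + emeasure received_measure (C \<inter> J j)"
      using received_le[of "J j - C"] C by (intro add_right_mono) (simp add: emeasure_received_measure)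
    finally show "emeasure \<nu> (C \<inter> J j) \<le> emeasure received_measure (C \<inter> J j)"
      using fin by (auto simp: ennreal_add_left_cancel_le)
  qed
  have cover: "(\<Union>j. J j) = UNIV"
  proof -
    have "x \<in> J (\<lceil>x\<rceil> - 1)" for x by (simp add: J_def) linarith
    then show ?thesis by blast
  qed
  have disj: "disjoint_family J"
    by (auto simp: disjoint_family_on_def J_def)
  have sum: "emeasure N C = (\<integral>\<^sup>+j. emeasure N (C \<inter> J j) \<partial>count_space UNIV)" if [simp]: "sets N = sets borel" for N
  proof -
    have "emeasure N (\<Union>j\<in>UNIV. C \<inter> J j) = (\<integral>\<^sup>+j. emeasure N (C \<inter> J j) \<partial>count_space UNIV)"
      using C disj by (intro emeasure_UN_countable) (auto simp: disjoint_family_on_def)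
    moreover have "(\<Union>j\<in>UNIV. C \<inter> J j) = C" using cover by auto
    ultimately show ?thesis by simp
  qed
  have "emeasure received_measure C = emeasure \<nu> C" by (simp add: sum part)
  then show ?thesis using C by (simp add: emeasure_received_measure)
qed

end

section \<open>Translations, stationarity and mass transport\<close>

text \<open>The flow moves an invariant random measure by this translation.\<close>

definition translate :: "real \<Rightarrow> real measure \<Rightarrow> real measure" where
  "translate t \<mu> = distr \<mu> borel (\<lambda>x. x - t)"

lemma sets_translate [simp, measurable_cong]: "sets (translate t \<mu>) = sets borel"
  by (simp add: translate_def)

lemma (in lf_borel) emeasure_translate: "A \<in> sets borel \<Longrightarrow> emeasure (translate t \<mu>) A = emeasure \<mu> {x. x - t \<in> A}"
  unfolding translate_def by (subst emeasure_distr) (auto simp: vimage_def)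

lemma (in lf_borel) lf_borel_translate: "lf_borel (translate t \<mu>)"
proof (rule lf_borelI_Ioc)
  fix x y :: real
  have "{z. z - t \<in> {x<..y}} = {x + t<..y + t}" by auto
  then show "emeasure (translate t \<mu>) {x<..y} < \<infinity>"
    using finite_on_bounded[of "{x + t<..y + t}"] by (simp add: emeasure_translate)
qed simp

lemma tau_translate:
  assumes "lf_borel \<mu>" "lf_borel \<nu>"
  shows "tau (translate t \<mu>) (translate t \<nu>) u (s - t) = tau \<mu> \<nu> u s - ereal t"
proof -
  interpret \<mu>: lf_borel \<mu> by fact
  interpret \<nu>: lf_borel \<nu> by fact
  have eq: "{x. x - t \<in> {s - t}} = {s}" "{x. x - t \<in> {s - t<..<r - t}} = {s<..<r}"
    "{x. x - t \<in> {s - t..r - t}} = {s..r}" for r by auto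
  have cov: "ennreal u * emeasure (translate t \<mu>) {s - t} + emeasure (translate t \<mu>) {s - t<..<r - t} \<le> emeasure (translate t \<nu>) {s - t..r - t}
    \<longleftrightarrow> ennreal u * emeasure \<mu> {s} + emeasure \<mu> {s<..<r} \<le> emeasure \<nu> {s..r}" for r
    using \<mu>.emeasure_translate[of "{s - t}" t] \<mu>.emeasure_translate[of "{s - t<..<r - t}" t]
      \<nu>.emeasure_translate[of "{s - t..r - t}" t]
    unfolding eq by simp
  show ?thesis
  proof (rule antisym)
    have "tau (translate t \<mu>) (translate t \<nu>) u (s - t) + ereal t \<le> tau \<mu> \<nu> u s"
      unfolding tau_def[of \<mu>]
    proof (rule Inf_greatest)
      fix x assume "x \<in> ereal ` {r. s < r \<and> ennreal u * emeasure \<mu> {s} + emeasure \<mu> {s<..<r} \<le> emeasure \<nu> {s..r}}"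
      then obtain r where r: "x = ereal r" "s < r" "ennreal u * emeasure \<mu> {s} + emeasure \<mu> {s<..<r} \<le> emeasure \<nu> {s..r}"
        by auto
      then have "tau (translate t \<mu>) (translate t \<nu>) u (s - t) \<le> ereal (r - t)"
        unfolding tau_def using cov[of r] by (intro Inf_lower imageI) simp
      then show "tau (translate t \<mu>) (translate t \<nu>) u (s - t) + ereal t \<le> x"
        using r(1) by (cases "tau (translate t \<mu>) (translate t \<nu>) u (s - t)") auto
    qed
    then show "tau (translate t \<mu>) (translate t \<nu>) u (s - t) \<le> tau \<mu> \<nu> u s - ereal t"
      by (cases "tau (translate t \<mu>) (translate t \<nu>) u (s - t)"; cases "tau \<mu> \<nu> u s") auto
    show "tau \<mu> \<nu> u s - ereal t \<le> tau (translate t \<mu>) (translate t \<nu>) u (s - t)"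
      unfolding tau_def[of "translate t \<mu>"]
    proof (rule Inf_greatest)
      fix x assume "x \<in> ereal ` {r. s - t < r \<and> ennreal u * emeasure (translate t \<mu>) {s - t} + emeasure (translate t \<mu>) {s - t<..<r} \<le> emeasure (translate t \<nu>) {s - t..r}}"
      then obtain r where r: "x = ereal r" "s - t < r" "ennreal u * emeasure (translate t \<mu>) {s - t} + emeasure (translate t \<mu>) {s - t<..<r} \<le> emeasure (translate t \<nu>) {s - t..r}"
        by auto
      then have "tau \<mu> \<nu> u s \<le> ereal (r + t)"
        unfolding tau_def using cov[of "r + t"] by (intro Inf_lower imageI) auto
      then show "tau \<mu> \<nu> u s - ereal t \<le> x"
        using r(1) by (cases "tau \<mu> \<nu> u s") auto
    qed
  qed
qed

lemma emeasure_kern_translate: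
  assumes "lf_borel \<mu>" "lf_borel \<nu>" and C: "C \<in> sets borel"
  shows "emeasure (kern (translate t \<mu>) (translate t \<nu>) (s - t)) C = emeasure (kern \<mu> \<nu> s) {x. x - t \<in> C}"
proof -
  have "{x \<in> space borel. x - t \<in> C} \<in> sets borel" using C by measurable
  then have C': "{x. x - t \<in> C} \<in> sets borel" by simp
  have "x - ereal t \<in> ereal ` C \<longleftrightarrow> x \<in> ereal ` {x. x - t \<in> C}" for x
    by (cases x) auto
  then have "(indicator (ereal ` C) (x - ereal t) :: ennreal) = indicator (ereal ` {x. x - t \<in> C}) x" for x
    by (simp add: indicator_def)
  then show ?thesis
    by (simp add: kern_def emeasure_K_tau[OF C] emeasure_K_tau[OF C'] tau_translate[OF assms(1,2)])
qed

definition moved :: "real measure \<Rightarrow> real measure \<Rightarrow> real set \<Rightarrow> real set \<Rightarrow> ennreal" where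
  "moved \<mu> \<nu> B C = (\<integral>\<^sup>+s. emeasure (kern \<mu> \<nu> s) C * indicator B s \<partial>\<mu>)"

definition unmoved :: "real measure \<Rightarrow> real measure \<Rightarrow> real set \<Rightarrow> ennreal" where
  "unmoved \<mu> \<nu> B = (\<integral>\<^sup>+s. (1 - emeasure (kern \<mu> \<nu> s) UNIV) * indicator B s \<partial>\<mu>)"

lemma moved_UNIV: "moved \<mu> \<nu> UNIV C = received \<mu> \<nu> C"
  by (simp add: moved_def received_def)

lemma sets_translate_vimage: "C \<in> sets borel \<Longrightarrow> {x::real. x - t \<in> C} \<in> sets borel"
proof -
  assume "C \<in> sets borel"
  then have "{x \<in> space borel. x - t \<in> C} \<in> sets borel" by measurable
  then show ?thesis by simp
qed

lemma moved_translate: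
  assumes "lf_borel \<mu>" "lf_borel \<nu>" and B: "B \<in> sets borel" and C: "C \<in> sets borel"
  shows "moved (translate t \<mu>) (translate t \<nu>) B C = moved \<mu> \<nu> {x. x - t \<in> B} {x. x - t \<in> C}"
proof -
  interpret \<mu>: lf_borel \<mu> by fact
  interpret \<nu>: lf_borel \<nu> by fact
  have [measurable]: "(\<lambda>s. emeasure (kern (translate t \<mu>) (translate t \<nu>) s) C) \<in> borel_measurable borel"
    by (rule lf_borel.measurable_kern[OF \<mu>.lf_borel_translate \<nu>.lf_borel_translate C])
  show ?thesis
    unfolding moved_def using B
    by (subst (1) translate_def, subst nn_integral_distr)
      (auto simp: emeasure_kern_translate[OF assms(1,2) C] indicator_def)
qed

lemma unmoved_translate:
  assumes "lf_borel \<mu>" "lf_borel \<nu>" and B: "B \<in> sets borel"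
  shows "unmoved (translate t \<mu>) (translate t \<nu>) B = unmoved \<mu> \<nu> {x. x - t \<in> B}"
proof -
  interpret \<mu>: lf_borel \<mu> by fact
  interpret \<nu>: lf_borel \<nu> by fact
  have UNIV: "(UNIV :: real set) \<in> sets borel" by simp
  have [measurable]: "(\<lambda>s. emeasure (kern (translate t \<mu>) (translate t \<nu>) s) UNIV) \<in> borel_measurable borel"
    by (rule lf_borel.measurable_kern[OF \<mu>.lf_borel_translate \<nu>.lf_borel_translate UNIV])
  show ?thesis
    unfolding unmoved_def using B
    by (subst (1) translate_def, subst nn_integral_distr)
      (auto simp: emeasure_kern_translate[OF assms(1,2) UNIV] indicator_def)
qed

lemma kern_le_1: "emeasure (kern \<mu> \<nu> s) C \<le> 1"
  unfolding kern_def by (rule emeasure_K_tau_le_1)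

context lf_borel begin

lemma unmoved_measurable [measurable]:
  "lf_borel \<nu> \<Longrightarrow> (\<lambda>s. 1 - emeasure (kern \<mu> \<nu> s) UNIV) \<in> borel_measurable borel"
  using measurable_kern[of \<nu> UNIV] by simp

lemma unmoved_mono: "B \<subseteq> B' \<Longrightarrow> unmoved \<mu> \<nu> B \<le> unmoved \<mu> \<nu> B'"
  unfolding unmoved_def by (intro nn_integral_mono) (auto simp: indicator_def)

lemma unmoved_eq_0_iff:
  assumes "lf_borel \<nu>" "B \<in> sets borel"
  shows "unmoved \<mu> \<nu> B = 0 \<longleftrightarrow> (AE s in \<mu>. s \<in> B \<longrightarrow> emeasure (kern \<mu> \<nu> s) UNIV = 1)"
proof -
  have *: "(1 - emeasure (kern \<mu> \<nu> s) UNIV) * indicator B s = 0 \<longleftrightarrow> (s \<in> B \<longrightarrow> emeasure (kern \<mu> \<nu> s) UNIV = 1)" for s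
    using kern_le_1[of \<mu> \<nu> s UNIV] by (auto simp: indicator_def diff_eq_0_iff_ennreal)
  show ?thesis
    unfolding unmoved_def *[symmetric] using assms by (intro nn_integral_0_iff_AE) simp
qed

lemma unmoved_plus_moved:
  assumes "lf_borel \<nu>" "B \<in> sets borel"
  shows "unmoved \<mu> \<nu> B + moved \<mu> \<nu> B UNIV = emeasure \<mu> B"
proof -
  have [measurable]: "(\<lambda>s. emeasure (kern \<mu> \<nu> s) UNIV) \<in> borel_measurable borel"
    by (rule measurable_kern[OF assms(1)]) simp
  have "unmoved \<mu> \<nu> B + moved \<mu> \<nu> B UNIV = (\<integral>\<^sup>+s. (1 - emeasure (kern \<mu> \<nu> s) UNIV) * indicator B s
      + emeasure (kern \<mu> \<nu> s) UNIV * indicator B s \<partial>\<mu>)"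
    unfolding unmoved_def moved_def using assms by (intro nn_integral_add[symmetric]) auto
  also have "\<dots> = (\<integral>\<^sup>+s. indicator B s \<partial>\<mu>)"
    using kern_le_1[of \<mu> \<nu> _ UNIV] by (intro nn_integral_cong) (auto simp: indicator_def diff_add_cancel_ennreal)
  finally show ?thesis using assms by simp
qed

end

abbreviation unit_Ioc :: "int \<Rightarrow> real set" where
  "unit_Ioc j \<equiv> {real_of_int j<..real_of_int j + 1}"

lemma unit_Ioc_cover: "(\<Union>j. unit_Ioc j) = UNIV"
proof -
  have "x \<in> unit_Ioc (\<lceil>x\<rceil> - 1)" for x by simp linarith
  then show ?thesis by blast
qed

lemma unit_Ioc_disjoint: "disjoint_family unit_Ioc"
  by (auto simp: disjoint_family_on_def)

lemma sum_indicator_unit_Ioc: "(\<integral>\<^sup>+j. indicator (unit_Ioc j) x \<partial>count_space UNIV) = 1"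
proof -
  define k where "k = \<lceil>x\<rceil> - 1"
  have k: "x \<in> unit_Ioc k" by (simp add: k_def) linarith
  have "indicator (unit_Ioc j) x = (indicator {k} j :: ennreal)" for j
    using k disjoint_family_onD[OF unit_Ioc_disjoint, of j k] by (cases "j = k") auto
  then show ?thesis by simp
qed

context lf_borel begin

lemma sum_moved_source:
  assumes "lf_borel \<nu>" "C \<in> sets borel"
  shows "(\<integral>\<^sup>+i. moved \<mu> \<nu> (unit_Ioc i) C \<partial>count_space UNIV) = received \<mu> \<nu> C"
proof -
  have [measurable]: "(\<lambda>s. emeasure (kern \<mu> \<nu> s) C) \<in> borel_measurable borel"
    by (rule measurable_kern[OF assms])
  have "(\<integral>\<^sup>+i. moved \<mu> \<nu> (unit_Ioc i) C \<partial>count_space UNIV) =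
    (\<integral>\<^sup>+s. \<integral>\<^sup>+i. emeasure (kern \<mu> \<nu> s) C * indicator (unit_Ioc i) s \<partial>count_space UNIV \<partial>\<mu>)"
    unfolding moved_def by (rule nn_integral_count_space_nn_integral[symmetric]) auto
  also have "\<dots> = received \<mu> \<nu> C"
    by (simp add: received_def nn_integral_cmult sum_indicator_unit_Ioc)
  finally show ?thesis .
qed

lemma sum_moved_target:
  assumes "lf_borel \<nu>" "B \<in> sets borel"
  shows "(\<integral>\<^sup>+j. moved \<mu> \<nu> B (unit_Ioc j) \<partial>count_space UNIV) = moved \<mu> \<nu> B UNIV"
proof -
  have [measurable]: "(\<lambda>s. emeasure (kern \<mu> \<nu> s) (unit_Ioc j)) \<in> borel_measurable borel" for j
    by (rule measurable_kern[OF assms(1)]) simp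
  have "(\<integral>\<^sup>+j. moved \<mu> \<nu> B (unit_Ioc j) \<partial>count_space UNIV) =
    (\<integral>\<^sup>+s. \<integral>\<^sup>+j. emeasure (kern \<mu> \<nu> s) (unit_Ioc j) * indicator B s \<partial>count_space UNIV \<partial>\<mu>)"
    unfolding moved_def using assms by (intro nn_integral_count_space_nn_integral[symmetric]) auto
  also have "\<dots> = moved \<mu> \<nu> B UNIV"
    unfolding moved_def
  proof (rule nn_integral_cong)
    fix s
    have "emeasure (kern \<mu> \<nu> s) (\<Union>j\<in>UNIV. unit_Ioc j) = (\<integral>\<^sup>+j. emeasure (kern \<mu> \<nu> s) (unit_Ioc j) \<partial>count_space UNIV)"
      using unit_Ioc_disjoint by (intro emeasure_UN_countable) auto
    then show "(\<integral>\<^sup>+j. emeasure (kern \<mu> \<nu> s) (unit_Ioc j) * indicator B s \<partial>count_space UNIV) =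
      emeasure (kern \<mu> \<nu> s) UNIV * indicator B s"
      by (simp add: nn_integral_multc unit_Ioc_cover)
  qed
  finally show ?thesis .
qed

end

context ergodic_flow begin

lemma flow_in_space: "\<omega> \<in> space M \<Longrightarrow> \<theta> s \<omega> \<in> space M"
  using measurable_space[OF flow_measurable, of "(\<omega>, s)"] by (simp add: space_pair_measure)

lemma measurable_flow [measurable]: "\<theta> s \<in> M \<rightarrow>\<^sub>M M"
  using measurable_compose[OF _ flow_measurable, of "\<lambda>\<omega>. (\<omega>, s)" M] by simp

lemma flow_neg: "\<omega> \<in> space M \<Longrightarrow> \<theta> (- s) (\<theta> s \<omega>) = \<omega>" "\<omega> \<in> space M \<Longrightarrow> \<theta> s (\<theta> (- s) \<omega>) = \<omega>"
  using flow_add[of \<omega> "- s" s] flow_add[of \<omega> s "- s"] flow_zero by auto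

lemma distr_flow: "distr M M (\<theta> s) = M"
proof (rule measure_eqI)
  fix A assume "A \<in> sets (distr M M (\<theta> s))"
  then have A: "A \<in> sets M" by simp
  have "\<theta> s -` A \<inter> space M = \<theta> (- s) ` A"
  proof (intro equalityI subsetI)
    fix \<omega> assume "\<omega> \<in> \<theta> s -` A \<inter> space M"
    then show "\<omega> \<in> \<theta> (- s) ` A" using flow_neg(1)[of \<omega> s] by force
  next
    fix \<omega>' assume "\<omega>' \<in> \<theta> (- s) ` A"
    then obtain \<omega> where w: "\<omega> \<in> A" "\<omega>' = \<theta> (- s) \<omega>" by blast
    then have "\<omega> \<in> space M" using sets.sets_into_space[OF A] by blast
    then show "\<omega>' \<in> \<theta> s -` A \<inter> space M" using flow_neg(2)[of \<omega> s] w flow_in_space by auto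
  qed
  then show "emeasure (distr M M (\<theta> s)) A = emeasure M A"
    using A by (simp add: emeasure_distr stationary)
qed simp

lemma nn_integral_flow: "f \<in> borel_measurable M \<Longrightarrow> (\<integral>\<^sup>+\<omega>. f (\<theta> s \<omega>) \<partial>M) = (\<integral>\<^sup>+\<omega>. f \<omega> \<partial>M)"
  using nn_integral_distr[of "\<theta> s" M M f] by (simp add: distr_flow)

lemma AE_flow: "AE \<omega> in M. P \<omega> \<Longrightarrow> AE \<omega> in M. P (\<theta> s \<omega>)"
  using AE_distrD[OF measurable_flow, of P s] unfolding distr_flow .

text \<open>Ergodicity concerns sets that are invariant for every \<open>\<omega>\<close>.  The set of all \<open>\<omega>\<close> whose orbit
  spends Lebesgue-almost all its time in \<open>B\<close> has this property, because Lebesgue measure is invariant under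
  translations, and it coincides with \<open>B\<close> almost everywhere.\<close>

lemma ergodic_AE:
  assumes B: "B \<in> sets M" and inv: "AE \<omega> in M. \<forall>t. \<theta> t \<omega> \<in> B \<longleftrightarrow> \<omega> \<in> B"
  shows "(AE \<omega> in M. \<omega> \<in> B) \<or> (AE \<omega> in M. \<omega> \<notin> B)"
proof -
  define X where "X \<omega> = {t. \<theta> t \<omega> \<notin> B}" for \<omega>
  define A where "A = {\<omega> \<in> space M. emeasure lborel (X \<omega>) = 0}"
  have [measurable]: "(\<lambda>p. \<theta> (snd p) (fst p)) \<in> M \<Otimes>\<^sub>M lborel \<rightarrow>\<^sub>M M"
    using flow_measurable by (simp add: case_prod_beta')
  let ?P = "{p \<in> space (M \<Otimes>\<^sub>M lborel). \<theta> (snd p) (fst p) \<notin> B}"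
  have P: "?P \<in> sets (M \<Otimes>\<^sub>M lborel)" using B by measurable
  have XP: "X \<omega> = Pair \<omega> -` ?P" if "\<omega> \<in> space M" for \<omega>
    using that by (auto simp: X_def space_pair_measure)
  have X: "X \<omega> \<in> sets borel" if "\<omega> \<in> space M" for \<omega>
    using sets_Pair1[OF P, of \<omega>] XP[OF that] by simp
  have "(\<lambda>\<omega>. emeasure lborel (Pair \<omega> -` ?P)) \<in> borel_measurable M"
    by (rule lborel.measurable_emeasure_Pair[OF P])
  then have "{\<omega> \<in> space M. emeasure lborel (Pair \<omega> -` ?P) = 0} \<in> sets M" by measurable
  also have "{\<omega> \<in> space M. emeasure lborel (Pair \<omega> -` ?P) = 0} = A"
    unfolding A_def using XP by auto
  finally have A: "A \<in> sets M" .
  have shift_A: "\<theta> s \<omega> \<in> A" if w: "\<omega> \<in> A" for s \<omega>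
  proof -
    have ws: "\<omega> \<in> space M" using w by (simp add: A_def)
    have "X (\<theta> s \<omega>) = (+) s -` X \<omega>" using flow_add[OF ws] by (auto simp: X_def add.commute)
    then have "emeasure lborel (X (\<theta> s \<omega>)) = emeasure (distr lborel borel ((+) s)) (X \<omega>)"
      using X[OF ws] by (simp add: emeasure_distr)
    also have "\<dots> = emeasure lborel (X \<omega>)" by (simp add: lborel_distr_plus)
    finally show ?thesis using w flow_in_space by (simp add: A_def)
  qed
  have "\<theta> s ` A = A" for s
  proof safe
    fix \<omega> assume w: "\<omega> \<in> A"
    then show "\<omega> \<in> \<theta> s ` A" using shift_A[OF w, of "- s"] flow_neg(2)[of \<omega> s] by (force simp: A_def)
  qed (rule shift_A)
  then have "emeasure M A = 0 \<or> emeasure M (space M - A) = 0" by (rule ergodic[OF A])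
  then have "(AE \<omega> in M. \<omega> \<notin> A) \<or> (AE \<omega> in M. \<omega> \<in> A)"
    using A AE_iff_measurable[of A M "\<lambda>\<omega>. \<omega> \<notin> A"] AE_iff_measurable[of "space M - A" M "\<lambda>\<omega>. \<omega> \<in> A"]
      sets.sets_into_space[OF A] by auto
  moreover have "AE \<omega> in M. \<omega> \<in> A \<longleftrightarrow> \<omega> \<in> B"
    using inv AE_space
  proof eventually_elim
    case (elim \<omega>)
    then show ?case by (cases "\<omega> \<in> B") (auto simp: A_def X_def)
  qed
  ultimately show ?thesis
  proof (elim disjE)
    assume "AE \<omega> in M. \<omega> \<notin> A" "AE \<omega> in M. \<omega> \<in> A \<longleftrightarrow> \<omega> \<in> B"
    then have "AE \<omega> in M. \<omega> \<notin> B" by eventually_elim simp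
    then show ?thesis ..
  next
    assume "AE \<omega> in M. \<omega> \<in> A" "AE \<omega> in M. \<omega> \<in> A \<longleftrightarrow> \<omega> \<in> B"
    then have "AE \<omega> in M. \<omega> \<in> B" by eventually_elim simp
    then show ?thesis ..
  qed
qed

text \<open>By stationarity the expected mass sent from \<open>0\<close> to \<open>j\<close> is that sent from \<open>-j\<close> to \<open>0\<close>; sum over \<open>j\<close>.\<close>

lemma mass_transport:
  fixes Q :: "'a \<Rightarrow> int \<Rightarrow> int \<Rightarrow> ennreal"
  assumes Q: "\<And>i j. (\<lambda>\<omega>. Q \<omega> i j) \<in> borel_measurable M"
    and inv: "AE \<omega> in M. \<forall>t i j. Q (\<theta> (real_of_int t) \<omega>) (i - t) (j - t) = Q \<omega> i j"
  shows "(\<integral>\<^sup>+\<omega>. \<integral>\<^sup>+j. Q \<omega> 0 j \<partial>count_space UNIV \<partial>M) = (\<integral>\<^sup>+\<omega>. \<integral>\<^sup>+i. Q \<omega> i 0 \<partial>count_space UNIV \<partial>M)"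
proof -
  have "(\<integral>\<^sup>+\<omega>. Q \<omega> 0 j \<partial>M) = (\<integral>\<^sup>+\<omega>. Q \<omega> (- j) 0 \<partial>M)" for j
  proof -
    have "(\<integral>\<^sup>+\<omega>. Q \<omega> 0 j \<partial>M) = (\<integral>\<^sup>+\<omega>. Q (\<theta> (real_of_int j) \<omega>) (- j) 0 \<partial>M)"
    proof (rule nn_integral_cong_AE)
      show "AE \<omega> in M. Q \<omega> 0 j = Q (\<theta> (real_of_int j) \<omega>) (- j) 0"
        using inv
      proof eventually_elim
        case (elim \<omega>)
        from elim[rule_format, of j 0 j] show ?case by simp
      qed
    qed
    also have "\<dots> = (\<integral>\<^sup>+\<omega>. Q \<omega> (- j) 0 \<partial>M)" by (rule nn_integral_flow[OF Q])
    finally show ?thesis .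
  qed
  then have "(\<integral>\<^sup>+j. \<integral>\<^sup>+\<omega>. Q \<omega> 0 j \<partial>M \<partial>count_space UNIV) = (\<integral>\<^sup>+j. (\<integral>\<^sup>+\<omega>. Q \<omega> (- j) 0 \<partial>M) \<partial>count_space UNIV)"
    by simp
  also have "\<dots> = (\<integral>\<^sup>+i. \<integral>\<^sup>+\<omega>. Q \<omega> i 0 \<partial>M \<partial>count_space UNIV)"
    by (rule nn_integral_bij_count_space) (rule bij_uminus)
  finally show ?thesis using Q by (simp add: nn_integral_count_space_nn_integral)
qed

end

section \<open>Balancing for invariant random measures\<close>

lemma AE_eq_if_nn_integral_eq:
  assumes [measurable]: "f \<in> borel_measurable M" "g \<in> borel_measurable M"
    and le: "AE x in M. f x \<le> g x" and eq: "(\<integral>\<^sup>+x. f x \<partial>M) = (\<integral>\<^sup>+x. g x \<partial>M)"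
    and fin: "(\<integral>\<^sup>+x. g x \<partial>M) < \<infinity>"
  shows "AE x in M. f x = (g x :: ennreal)"
proof -
  have "(\<integral>\<^sup>+x. g x - f x \<partial>M) = (\<integral>\<^sup>+x. g x \<partial>M) - (\<integral>\<^sup>+x. f x \<partial>M)"
    using fin eq by (intro nn_integral_diff le) auto
  then have "(\<integral>\<^sup>+x. g x - f x \<partial>M) = 0" using eq fin by simp
  then have "AE x in M. g x - f x = 0" by (subst (asm) nn_integral_0_iff_AE) auto
  moreover have "AE x in M. g x \<noteq> \<infinity>" using fin by (intro nn_integral_noteq_infinite) auto
  ultimately show ?thesis using le
    by eventually_elim (auto simp: diff_eq_0_iff_ennreal intro: antisym)
qed

lemma unit_Ioc_translate: "{x. x - real_of_int t \<in> unit_Ioc (j - t)} = unit_Ioc j"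
  by auto

text \<open>If all brackets up to \<open>a\<close> were closed, the kernel would have total mass \<open>1\<close> there.\<close>

lemma (in lf_borel) exists_unmatched:
  assumes \<nu>: "lf_borel \<nu>" and pos: "0 < unmoved \<mu> \<nu> {..a}" and sing: "mutually_singular \<mu> \<nu>"
  shows "\<exists>s\<le>a. \<exists>u\<in>{0..1}. tau \<mu> \<nu> u s = \<infinity>"
proof (rule ccontr)
  assume neg: "\<not> ?thesis"
  interpret singular_pair \<mu> \<nu>
    using lf_borel_axioms \<nu> sing by (simp add: singular_pair_def singular_pair_axioms_def)
  have "emeasure (kern \<mu> \<nu> s) UNIV = 1" if "s \<le> a" for s
  proof -
    have "tau \<mu> \<nu> u s \<in> range ereal" if "u \<in> {0..1}" for u
      using neg \<open>s \<le> a\<close> that tau_ge[of s u] by (cases "tau \<mu> \<nu> u s") auto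
    then have "(indicator (range ereal) (tau \<mu> \<nu> u s) * indicator {0..1} u :: ennreal) = indicator {0..1} u" for u
      by (cases "u \<in> {0..1}") auto
    then show ?thesis by (simp add: kern_def emeasure_K_tau)
  qed
  then have "unmoved \<mu> \<nu> {..a} = (\<integral>\<^sup>+s. 0 \<partial>\<mu>)"
    unfolding unmoved_def by (intro nn_integral_cong) (auto simp: indicator_def)
  then show False using pos by simp
qed

lemma (in lf_borel) unmoved_eq_0I:
  assumes \<nu>: "lf_borel \<nu>" and bdd: "\<And>n::int. unmoved \<mu> \<nu> {..real_of_int n} = 0"
  shows "AE s in \<mu>. emeasure (kern \<mu> \<nu> s) UNIV = 1"
proof -
  have "AE s in \<mu>. \<forall>n::int. s \<le> real_of_int n \<longrightarrow> emeasure (kern \<mu> \<nu> s) UNIV = 1"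
  proof (rule AE_all_countable[THEN iffD2], rule allI)
    fix n :: int
    show "AE s in \<mu>. s \<le> real_of_int n \<longrightarrow> emeasure (kern \<mu> \<nu> s) UNIV = 1"
      using bdd[of n] unmoved_eq_0_iff[OF \<nu>, of "{..real_of_int n}"] by simp
  qed
  then show ?thesis
  proof eventually_elim
    case (elim s)
    then show ?case using le_of_int_ceiling[of s] by blast
  qed
qed

text \<open>The hypotheses of the theorem after a modification on a null set that makes the measures locally finite for
  every \<open>\<omega>\<close>, with the intensities taken over half-open intervals.\<close>

locale invariant_pair = ergodic_flow M \<theta> for M :: "'a measure" and \<theta> +
  fixes \<xi> \<eta> :: "'a \<Rightarrow> real measure"
  assumes lf_\<xi>: "lf_kernel M \<xi>" and lf_\<eta>: "lf_kernel M \<eta>"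
    and inv_\<xi>: "AE \<omega> in M. \<forall>t. \<xi> (\<theta> t \<omega>) = translate t (\<xi> \<omega>)"
    and inv_\<eta>: "AE \<omega> in M. \<forall>t. \<eta> (\<theta> t \<omega>) = translate t (\<eta> \<omega>)"
    and sing: "AE \<omega> in M. mutually_singular (\<xi> \<omega>) (\<eta> \<omega>)"
    and intensity_finite: "(\<integral>\<^sup>+\<omega>. emeasure (\<xi> \<omega>) {0<..1} \<partial>M) < \<infinity>"
    and intensity_eq: "(\<integral>\<^sup>+\<omega>. emeasure (\<xi> \<omega>) {0<..1} \<partial>M) = (\<integral>\<^sup>+\<omega>. emeasure (\<eta> \<omega>) {0<..1} \<partial>M)"
    and dichotomy: "AE \<omega> in M. emeasure (\<xi> \<omega>) UNIV = 0 \<or> emeasure (\<xi> \<omega>) UNIV = \<infinity>"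
begin

abbreviation "U \<omega> \<equiv> unmoved (\<xi> \<omega>) (\<eta> \<omega>)"
abbreviation "T \<omega> \<equiv> moved (\<xi> \<omega>) (\<eta> \<omega>)"
abbreviation "G \<omega> \<equiv> received (\<xi> \<omega>) (\<eta> \<omega>)"

lemma lf: "\<omega> \<in> space M \<Longrightarrow> lf_borel (\<xi> \<omega>)" "\<omega> \<in> space M \<Longrightarrow> lf_borel (\<eta> \<omega>)"
  using lf_\<xi> lf_\<eta> by (auto simp: lf_kernel_def)

lemma AE_pair: "AE \<omega> in M. singular_pair (\<xi> \<omega>) (\<eta> \<omega>)"
  using sing AE_space
  by eventually_elim (simp add: singular_pair_def singular_pair_axioms_def lf)

lemma AE_translate: "AE \<omega> in M. \<omega> \<in> space M \<and> (\<forall>t. \<xi> (\<theta> t \<omega>) = translate t (\<xi> \<omega>) \<and> \<eta> (\<theta> t \<omega>) = translate t (\<eta> \<omega>))"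
  using inv_\<xi> inv_\<eta> AE_space by eventually_elim simp

lemma measurable_kern_\<omega>:
  assumes "C \<in> sets borel"
  shows "(\<lambda>p. emeasure (kern (\<xi> (fst p)) (\<eta> (fst p)) (snd p)) C) \<in> borel_measurable (M \<Otimes>\<^sub>M borel)"
  using measurable_K_tau[OF lf_\<xi> lf_\<eta> assms] by (simp add: kern_eq_K_tau case_prod_beta')

lemma U_measurable [measurable]: "B \<in> sets borel \<Longrightarrow> (\<lambda>\<omega>. U \<omega> B) \<in> borel_measurable M"
proof -
  assume B [measurable]: "B \<in> sets borel"
  have [measurable]: "(\<lambda>p. emeasure (kern (\<xi> (fst p)) (\<eta> (fst p)) (snd p)) UNIV) \<in> borel_measurable (M \<Otimes>\<^sub>M borel)"
    by (rule measurable_kern_\<omega>) simp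
  have "(\<lambda>p. (1 - emeasure (kern (\<xi> (fst p)) (\<eta> (fst p)) (snd p)) UNIV) * indicator B (snd p)) \<in> borel_measurable (M \<Otimes>\<^sub>M borel)"
    by measurable
  from measurable_kernel_integral[OF lf_\<xi> this] show ?thesis by (simp add: unmoved_def)
qed

lemma T_measurable [measurable]: "B \<in> sets borel \<Longrightarrow> C \<in> sets borel \<Longrightarrow> (\<lambda>\<omega>. T \<omega> B C) \<in> borel_measurable M"
proof -
  assume B [measurable]: "B \<in> sets borel" and C: "C \<in> sets borel"
  note [measurable] = measurable_kern_\<omega>[OF C]
  have "(\<lambda>p. emeasure (kern (\<xi> (fst p)) (\<eta> (fst p)) (snd p)) C * indicator B (snd p)) \<in> borel_measurable (M \<Otimes>\<^sub>M borel)"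
    by measurable
  from measurable_kernel_integral[OF lf_\<xi> this] show ?thesis by (simp add: moved_def)
qed

lemma G_measurable [measurable]: "C \<in> sets borel \<Longrightarrow> (\<lambda>\<omega>. G \<omega> C) \<in> borel_measurable M"
  using T_measurable[of UNIV C] by (simp add: moved_UNIV)

lemma \<xi>_measurable [measurable]: "C \<in> sets borel \<Longrightarrow> (\<lambda>\<omega>. emeasure (\<xi> \<omega>) C) \<in> borel_measurable M"
  and \<eta>_measurable [measurable]: "C \<in> sets borel \<Longrightarrow> (\<lambda>\<omega>. emeasure (\<eta> \<omega>) C) \<in> borel_measurable M"
  using lf_\<xi> lf_\<eta> by (auto simp: lf_kernel_def)

text \<open>Mass transport, applied to the mass moved from \<open>(i,i+1]\<close> to \<open>(j,j+1]\<close>.\<close>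

lemma intensity_T: "(\<integral>\<^sup>+\<omega>. T \<omega> {0<..1} UNIV \<partial>M) = (\<integral>\<^sup>+\<omega>. G \<omega> {0<..1} \<partial>M)"
proof -
  have "(\<integral>\<^sup>+\<omega>. \<integral>\<^sup>+j. T \<omega> (unit_Ioc 0) (unit_Ioc j) \<partial>count_space UNIV \<partial>M) =
    (\<integral>\<^sup>+\<omega>. \<integral>\<^sup>+i. T \<omega> (unit_Ioc i) (unit_Ioc 0) \<partial>count_space UNIV \<partial>M)"
  proof (rule mass_transport)
    show "AE \<omega> in M. \<forall>t i j. T (\<theta> (real_of_int t) \<omega>) (unit_Ioc (i - t)) (unit_Ioc (j - t)) = T \<omega> (unit_Ioc i) (unit_Ioc j)"
      using AE_translate
    proof (eventually_elim, intro allI)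
      fix \<omega> t i j
      assume w: "\<omega> \<in> space M \<and> (\<forall>t. \<xi> (\<theta> t \<omega>) = translate t (\<xi> \<omega>) \<and> \<eta> (\<theta> t \<omega>) = translate t (\<eta> \<omega>))"
      then show "T (\<theta> (real_of_int t) \<omega>) (unit_Ioc (i - t)) (unit_Ioc (j - t)) = T \<omega> (unit_Ioc i) (unit_Ioc j)"
        using moved_translate[OF lf(1) lf(2), of \<omega> \<omega> "unit_Ioc (i - t)" "unit_Ioc (j - t)" "real_of_int t"]
        unfolding unit_Ioc_translate by simp
    qed
  qed simp
  moreover have "(\<integral>\<^sup>+\<omega>. \<integral>\<^sup>+j. T \<omega> (unit_Ioc 0) (unit_Ioc j) \<partial>count_space UNIV \<partial>M) = (\<integral>\<^sup>+\<omega>. T \<omega> {0<..1} UNIV \<partial>M)"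
    by (intro nn_integral_cong) (simp add: lf_borel.sum_moved_target[OF lf(1) lf(2)])
  moreover have "(\<integral>\<^sup>+\<omega>. \<integral>\<^sup>+i. T \<omega> (unit_Ioc i) (unit_Ioc 0) \<partial>count_space UNIV \<partial>M) = (\<integral>\<^sup>+\<omega>. G \<omega> {0<..1} \<partial>M)"
    by (intro nn_integral_cong) (simp add: lf_borel.sum_moved_source[OF lf(1) lf(2)])
  ultimately show ?thesis by simp
qed

definition first_unmoved_in :: "int \<Rightarrow> 'a set" where
  "first_unmoved_in j = {\<omega> \<in> space M. U \<omega> {..real_of_int j} = 0 \<and> 0 < U \<omega> {..real_of_int j + 1}}"

lemma sets_first_unmoved_in [measurable]: "first_unmoved_in j \<in> sets M"
  unfolding first_unmoved_in_def by measurable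

lemma U_translate:
  assumes "\<omega> \<in> space M" "\<xi> (\<theta> t \<omega>) = translate t (\<xi> \<omega>)" "\<eta> (\<theta> t \<omega>) = translate t (\<eta> \<omega>)" "B \<in> sets borel"
  shows "U (\<theta> t \<omega>) B = U \<omega> {x. x - t \<in> B}"
  unfolding assms(2,3) by (rule unmoved_translate[OF lf[OF assms(1)] assms(4)])

lemma U_translate_atMost:
  assumes "\<omega> \<in> space M" "\<xi> (\<theta> t \<omega>) = translate t (\<xi> \<omega>)" "\<eta> (\<theta> t \<omega>) = translate t (\<eta> \<omega>)"
  shows "U (\<theta> t \<omega>) {..a} = U \<omega> {..a + t}"
proof -
  have "{x. x - t \<in> {..a}} = {..a + t}" by auto
  then show ?thesis using U_translate[OF assms, of "{..a}"] by simp
qed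

lemma first_unmoved_in_translate:
  assumes "\<omega> \<in> space M" "\<xi> (\<theta> t \<omega>) = translate t (\<xi> \<omega>)" "\<eta> (\<theta> t \<omega>) = translate t (\<eta> \<omega>)" "t = real_of_int k"
  shows "\<theta> t \<omega> \<in> first_unmoved_in (j - k) \<longleftrightarrow> \<omega> \<in> first_unmoved_in j"
proof -
  have e: "real_of_int (j - k) + t = real_of_int j" "real_of_int (j - k) + 1 + t = real_of_int j + 1"
    using assms(4) by auto
  have "U (\<theta> t \<omega>) {..real_of_int (j - k)} = U \<omega> {..real_of_int j}"
    "U (\<theta> t \<omega>) {..real_of_int (j - k) + 1} = U \<omega> {..real_of_int j + 1}"
    unfolding U_translate_atMost[OF assms(1-3)] e by simp_all
  then show ?thesis
    using assms(1) flow_in_space by (simp add: first_unmoved_in_def del: of_int_diff)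
qed

lemma first_unmoved_in_disjoint: "\<omega> \<in> first_unmoved_in i \<Longrightarrow> \<omega> \<in> first_unmoved_in j \<Longrightarrow> i = j"
proof -
  have "\<not> i < j" if "\<omega> \<in> first_unmoved_in i" "\<omega> \<in> first_unmoved_in j" for i j
  proof
    assume "i < j"
    then have "real_of_int i + 1 \<le> real_of_int j" by linarith
    then have "U \<omega> {..real_of_int i + 1} \<le> U \<omega> {..real_of_int j}"
      using lf that by (intro lf_borel.unmoved_mono) (auto simp: first_unmoved_in_def)
    then show False using that by (simp add: first_unmoved_in_def)
  qed
  then show "\<omega> \<in> first_unmoved_in i \<Longrightarrow> \<omega> \<in> first_unmoved_in j \<Longrightarrow> i = j" by (meson linorder_less_linear)
qed

text \<open>Transport all the mass of \<open>\<xi>\<close> to the first unit interval with unmatched mass.  The expected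
  mass sent out of \<open>(0,1]\<close> is at most the intensity, hence finite, whereas \<open>(0,1]\<close> receives
  \<open>\<xi>(\<real>) = \<infinity>\<close> on the event \<open>first_unmoved_in 0\<close>.  So this event is null.\<close>

lemma AE_not_first_unmoved_in: "AE \<omega> in M. \<forall>j. \<omega> \<notin> first_unmoved_in j"
proof -
  let ?Q = "\<lambda>\<omega> i j. emeasure (\<xi> \<omega>) (unit_Ioc i) * indicator (first_unmoved_in j) \<omega>"
  have transport: "(\<integral>\<^sup>+\<omega>. \<integral>\<^sup>+j. ?Q \<omega> 0 j \<partial>count_space UNIV \<partial>M) = (\<integral>\<^sup>+\<omega>. \<integral>\<^sup>+i. ?Q \<omega> i 0 \<partial>count_space UNIV \<partial>M)"
  proof (rule mass_transport)
    show "AE \<omega> in M. \<forall>t i j. ?Q (\<theta> (real_of_int t) \<omega>) (i - t) (j - t) = ?Q \<omega> i j"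
      using AE_translate
    proof (eventually_elim, intro allI)
      fix \<omega> t i j
      assume w: "\<omega> \<in> space M \<and> (\<forall>t. \<xi> (\<theta> t \<omega>) = translate t (\<xi> \<omega>) \<and> \<eta> (\<theta> t \<omega>) = translate t (\<eta> \<omega>))"
      then interpret lf_borel "\<xi> \<omega>" using lf by blast
      have "emeasure (\<xi> (\<theta> (real_of_int t) \<omega>)) (unit_Ioc (i - t)) = emeasure (\<xi> \<omega>) (unit_Ioc i)"
        using w emeasure_translate[of "unit_Ioc (i - t)" "real_of_int t"] unfolding unit_Ioc_translate by simp
      moreover have "\<theta> (real_of_int t) \<omega> \<in> first_unmoved_in (j - t) \<longleftrightarrow> \<omega> \<in> first_unmoved_in j"
        using w by (intro first_unmoved_in_translate) auto
      ultimately show "?Q (\<theta> (real_of_int t) \<omega>) (i - t) (j - t) = ?Q \<omega> i j" by (simp add: indicator_def)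
    qed
  qed measurable
  have "(\<integral>\<^sup>+\<omega>. \<integral>\<^sup>+j. ?Q \<omega> 0 j \<partial>count_space UNIV \<partial>M) \<le> (\<integral>\<^sup>+\<omega>. emeasure (\<xi> \<omega>) {0<..1} \<partial>M)"
  proof (rule nn_integral_mono)
    fix \<omega>
    have "(\<integral>\<^sup>+j. indicator (first_unmoved_in j) \<omega> \<partial>count_space UNIV) \<le> (1 :: ennreal)"
    proof (cases "\<exists>k. \<omega> \<in> first_unmoved_in k")
      case True
      then obtain k where "\<omega> \<in> first_unmoved_in k" by blast
      then have "indicator (first_unmoved_in j) \<omega> = (indicator {k} j :: ennreal)" for j
        using first_unmoved_in_disjoint by (auto simp: indicator_def)
      then show ?thesis by simp
    qed (simp add: indicator_def)
    then have "emeasure (\<xi> \<omega>) (unit_Ioc 0) * (\<integral>\<^sup>+j. indicator (first_unmoved_in j) \<omega> \<partial>count_space UNIV) \<le> emeasure (\<xi> \<omega>) (unit_Ioc 0) * 1"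
      by (rule mult_left_mono) simp
    then show "(\<integral>\<^sup>+j. ?Q \<omega> 0 j \<partial>count_space UNIV) \<le> emeasure (\<xi> \<omega>) {0<..1}"
      by (simp add: nn_integral_cmult)
  qed
  also have "\<dots> < \<infinity>" by (rule intensity_finite)
  finally have fin: "(\<integral>\<^sup>+\<omega>. \<integral>\<^sup>+i. ?Q \<omega> i 0 \<partial>count_space UNIV \<partial>M) < \<infinity>" unfolding transport .
  have "(\<integral>\<^sup>+\<omega>. \<integral>\<^sup>+i. ?Q \<omega> i 0 \<partial>count_space UNIV \<partial>M) = (\<integral>\<^sup>+\<omega>. emeasure (\<xi> \<omega>) UNIV * indicator (first_unmoved_in 0) \<omega> \<partial>M)"
  proof (rule nn_integral_cong)
    fix \<omega> assume "\<omega> \<in> space M"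
    then interpret lf_borel "\<xi> \<omega>" by (rule lf)
    have "emeasure (\<xi> \<omega>) (\<Union>i\<in>UNIV. unit_Ioc i) = (\<integral>\<^sup>+i. emeasure (\<xi> \<omega>) (unit_Ioc i) \<partial>count_space UNIV)"
      using unit_Ioc_disjoint by (intro emeasure_UN_countable) auto
    then show "(\<integral>\<^sup>+i. ?Q \<omega> i 0 \<partial>count_space UNIV) = emeasure (\<xi> \<omega>) UNIV * indicator (first_unmoved_in 0) \<omega>"
      by (simp add: nn_integral_multc unit_Ioc_cover)
  qed
  with fin have "(\<integral>\<^sup>+\<omega>. emeasure (\<xi> \<omega>) UNIV * indicator (first_unmoved_in 0) \<omega> \<partial>M) \<noteq> \<infinity>" by simp
  then have "AE \<omega> in M. emeasure (\<xi> \<omega>) UNIV * indicator (first_unmoved_in 0) \<omega> \<noteq> \<infinity>"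
    by (intro nn_integral_noteq_infinite) auto
  then have Z0: "AE \<omega> in M. \<omega> \<notin> first_unmoved_in 0"
    using dichotomy
  proof eventually_elim
    fix \<omega> assume fin: "emeasure (\<xi> \<omega>) UNIV * indicator (first_unmoved_in 0) \<omega> \<noteq> \<infinity>"
      and d: "emeasure (\<xi> \<omega>) UNIV = 0 \<or> emeasure (\<xi> \<omega>) UNIV = \<infinity>"
    show "\<omega> \<notin> first_unmoved_in 0"
    proof
      assume first_unmoved_in: "\<omega> \<in> first_unmoved_in 0"
      then interpret lf_borel "\<xi> \<omega>" using lf by (auto simp: first_unmoved_in_def)
      have 0: "emeasure (\<xi> \<omega>) UNIV = 0" using fin d first_unmoved_in by auto
      have "U \<omega> {..1} \<le> U \<omega> {..1} + T \<omega> {..1} UNIV" by simp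
      also have "\<dots> = emeasure (\<xi> \<omega>) {..1}"
        using first_unmoved_in lf by (intro unmoved_plus_moved) (auto simp: first_unmoved_in_def)
      also have "\<dots> \<le> emeasure (\<xi> \<omega>) UNIV" by (rule emeasure_mono) auto
      finally show False using first_unmoved_in 0 by (simp add: first_unmoved_in_def)
    qed
  qed
  have "AE \<omega> in M. \<omega> \<notin> first_unmoved_in j" for j
    using AE_flow[OF Z0, of "real_of_int j"] AE_translate
  proof eventually_elim
    case (elim \<omega>)
    then show ?case using first_unmoved_in_translate[of \<omega> "real_of_int j" j j] by simp
  qed
  then show ?thesis by (simp add: AE_all_countable)
qed

lemma AE_kern_1_if_unmoved_null:
  assumes "AE \<omega> in M. \<forall>n::int. U \<omega> {..real_of_int n} = 0"
  shows "AE \<omega> in M. AE s in \<xi> \<omega>. emeasure (kern (\<xi> \<omega>) (\<eta> \<omega>) s) UNIV = 1"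
  using assms AE_space by eventually_elim (simp add: lf_borel.unmoved_eq_0I lf)

lemma AE_received_le: "AE \<omega> in M. \<forall>C\<in>sets borel. G \<omega> C \<le> emeasure (\<eta> \<omega>) C"
  using AE_pair by eventually_elim (simp add: singular_pair.received_le)

text \<open>The event that there is unmatched mass arbitrarily far to the left is invariant.  If it has full
  measure, then \<open>(0,1]\<close> receives all of its \<open>\<eta>\<close>-mass, so the expected mass sent out of \<open>(0,1]\<close> is the full
  intensity of \<open>\<xi>\<close> and nothing remains unmatched.  If it is null, then by lemma
  \<open>AE_not_first_unmoved_in\<close> there is no unmatched mass at all.\<close>

lemma AE_kern_1: "AE \<omega> in M. AE s in \<xi> \<omega>. emeasure (kern (\<xi> \<omega>) (\<eta> \<omega>) s) UNIV = 1"
proof -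
  define B where "B = {\<omega> \<in> space M. \<forall>n::int. 0 < U \<omega> {..real_of_int n}}"
  have B: "B \<in> sets M" unfolding B_def by measurable
  have "AE \<omega> in M. \<forall>t. \<theta> t \<omega> \<in> B \<longleftrightarrow> \<omega> \<in> B"
    using AE_translate
  proof (eventually_elim, intro allI)
    fix \<omega> t
    assume w: "\<omega> \<in> space M \<and> (\<forall>t. \<xi> (\<theta> t \<omega>) = translate t (\<xi> \<omega>) \<and> \<eta> (\<theta> t \<omega>) = translate t (\<eta> \<omega>))"
    then have lfw: "lf_borel (\<xi> \<omega>)" using lf by blast
    have all: "(\<forall>n::int. 0 < U \<omega> {..real_of_int n + t}) \<longleftrightarrow> (\<forall>n::int. 0 < U \<omega> {..real_of_int n})" for t
    proof -
      have *: "\<forall>n::int. 0 < U \<omega> {..real_of_int n + t}" if "\<forall>n::int. 0 < U \<omega> {..real_of_int n + s}" for s t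
      proof
        fix n :: int
        have "real_of_int \<lfloor>real_of_int n + t - s\<rfloor> + s \<le> real_of_int n + t" by linarith
        then have "U \<omega> {..real_of_int \<lfloor>real_of_int n + t - s\<rfloor> + s} \<le> U \<omega> {..real_of_int n + t}"
          by (intro lf_borel.unmoved_mono[OF lfw]) auto
        then show "0 < U \<omega> {..real_of_int n + t}" using that by (meson less_le_trans)
      qed
      show ?thesis using *[of t 0] *[of 0 t] by auto
    qed
    show "\<theta> t \<omega> \<in> B \<longleftrightarrow> \<omega> \<in> B"
      using w flow_in_space all U_translate_atMost[of \<omega> t] by (simp add: B_def)
  qed
  then consider "AE \<omega> in M. \<omega> \<in> B" | "AE \<omega> in M. \<omega> \<notin> B" using ergodic_AE[OF B] by blast
  then show ?thesis
  proof cases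
    case 1
    have G1: "AE \<omega> in M. G \<omega> {0<..1} = emeasure (\<eta> \<omega>) {0<..1}"
      using 1 AE_received_le AE_pair
    proof eventually_elim
      fix \<omega> assume wB: "\<omega> \<in> B" and le: "\<forall>C\<in>sets borel. G \<omega> C \<le> emeasure (\<eta> \<omega>) C"
        and "singular_pair (\<xi> \<omega>) (\<eta> \<omega>)"
      then interpret singular_pair "\<xi> \<omega>" "\<eta> \<omega>" by simp
      have "0 < U \<omega> {..0}" using wB by (auto simp: B_def dest: spec[of _ 0])
      then obtain s u where "s \<le> 0" "0 \<le> u" "u \<le> 1" "tau (\<xi> \<omega>) (\<eta> \<omega>) u s = \<infinity>"
        using \<mu>.exists_unmatched[OF \<nu>.lf_borel_axioms _ singular, of 0] by auto
      then have "emeasure (\<eta> \<omega>) {0<..1} \<le> G \<omega> {0<..1}" by (intro received_Ioc_ge[of s]) auto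
      then show "G \<omega> {0<..1} = emeasure (\<eta> \<omega>) {0<..1}" using le by (intro antisym) auto
    qed
    have "(\<integral>\<^sup>+\<omega>. T \<omega> {0<..1} UNIV \<partial>M) = (\<integral>\<^sup>+\<omega>. emeasure (\<xi> \<omega>) {0<..1} \<partial>M)"
      unfolding intensity_T intensity_eq by (rule nn_integral_cong_AE[OF G1])
    moreover have *: "U \<omega> {0<..1} + T \<omega> {0<..1} UNIV = emeasure (\<xi> \<omega>) {0<..1}" if "\<omega> \<in> space M" for \<omega>
      using lf[OF that] by (intro lf_borel.unmoved_plus_moved) auto
    moreover have "AE \<omega> in M. T \<omega> {0<..1} UNIV \<le> emeasure (\<xi> \<omega>) {0<..1}"
      using AE_space by eventually_elim (simp add: *[symmetric])
    ultimately have TX: "AE \<omega> in M. T \<omega> {0<..1} UNIV = emeasure (\<xi> \<omega>) {0<..1}"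
      using intensity_finite by (intro AE_eq_if_nn_integral_eq) auto
    have U0: "AE \<omega> in M. U \<omega> {0<..1} = 0"
      using TX AE_space
    proof eventually_elim
      case (elim \<omega>)
      interpret lf_borel "\<xi> \<omega>" using lf elim by blast
      have "emeasure (\<xi> \<omega>) {0<..1} + U \<omega> {0<..1} = emeasure (\<xi> \<omega>) {0<..1} + 0"
        using *[of \<omega>] elim by (simp add: add.commute)
      then show ?case unfolding ennreal_add_left_cancel by auto
    qed
    have "AE \<omega> in M. U \<omega> (unit_Ioc j) = 0" for j
      using AE_flow[OF U0, of "real_of_int j"] AE_translate
    proof eventually_elim
      case (elim \<omega>)
      have "{x. x - real_of_int j \<in> {0<..1}} = unit_Ioc j" by auto
      then show ?case using elim U_translate[of \<omega> "real_of_int j" "{0<..1}"] by simp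
    qed
    then have "AE \<omega> in M. \<forall>j. U \<omega> (unit_Ioc j) = 0" by (simp add: AE_all_countable)
    then show ?thesis using AE_space
    proof eventually_elim
      fix \<omega> assume 0: "\<forall>j. U \<omega> (unit_Ioc j) = 0" and w: "\<omega> \<in> space M"
      interpret lf_borel "\<xi> \<omega>" using lf w by blast
      have "AE s in \<xi> \<omega>. \<forall>j. s \<in> unit_Ioc j \<longrightarrow> emeasure (kern (\<xi> \<omega>) (\<eta> \<omega>) s) UNIV = 1"
        using 0 unmoved_eq_0_iff[OF lf(2)[OF w], of "unit_Ioc j" for j] by (simp only: AE_all_countable) simp
      then show "AE s in \<xi> \<omega>. emeasure (kern (\<xi> \<omega>) (\<eta> \<omega>) s) UNIV = 1"
      proof eventually_elim
        case (elim s)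
        then show ?case using unit_Ioc_cover by blast
      qed
    qed
  next
    case 2
    have "AE \<omega> in M. \<forall>n::int. U \<omega> {..real_of_int n} = 0"
      using 2 AE_not_first_unmoved_in AE_space
    proof eventually_elim
      fix \<omega> assume nB: "\<omega> \<notin> B" and nZ: "\<forall>j. \<omega> \<notin> first_unmoved_in j" and w: "\<omega> \<in> space M"
      interpret lf_borel "\<xi> \<omega>" using lf w by blast
      obtain k :: int where k: "U \<omega> {..real_of_int k} = 0"
        using nB w by (auto simp: B_def zero_less_iff_neq_zero)
      show "\<forall>n::int. U \<omega> {..real_of_int n} = 0"
      proof
        fix n :: int
        show "U \<omega> {..real_of_int n} = 0"
        proof (cases "k \<le> n")
          case True
          then show ?thesis
          proof (induction n rule: int_ge_induct)
            case (step i)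
            then show ?case using nZ w by (auto simp: first_unmoved_in_def zero_less_iff_neq_zero)
          qed (rule k)
        next
          case False
          then have "U \<omega> {..real_of_int n} \<le> U \<omega> {..real_of_int k}" by (intro unmoved_mono) auto
          then show ?thesis using k by simp
        qed
      qed
    qed
    then show ?thesis by (rule AE_kern_1_if_unmoved_null)
  qed
qed

lemma AE_received_eq: "AE \<omega> in M. \<forall>C\<in>sets borel. G \<omega> C = emeasure (\<eta> \<omega>) C"
proof -
  have "(\<integral>\<^sup>+\<omega>. T \<omega> {0<..1} UNIV \<partial>M) = (\<integral>\<^sup>+\<omega>. emeasure (\<xi> \<omega>) {0<..1} \<partial>M)"
  proof (rule nn_integral_cong_AE)
    show "AE \<omega> in M. T \<omega> {0<..1} UNIV = emeasure (\<xi> \<omega>) {0<..1}"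
      using AE_kern_1 AE_space
    proof eventually_elim
      case (elim \<omega>)
      interpret lf_borel "\<xi> \<omega>" using lf elim by blast
      have "T \<omega> {0<..1} UNIV = (\<integral>\<^sup>+s. indicator {0<..1} s \<partial>\<xi> \<omega>)"
        unfolding moved_def by (rule nn_integral_cong_AE) (use elim(1) in eventually_elim, simp)
      then show ?case by simp
    qed
  qed
  then have "(\<integral>\<^sup>+\<omega>. G \<omega> {0<..1} \<partial>M) = (\<integral>\<^sup>+\<omega>. emeasure (\<eta> \<omega>) {0<..1} \<partial>M)"
    unfolding intensity_T intensity_eq .
  moreover have "AE \<omega> in M. G \<omega> {0<..1} \<le> emeasure (\<eta> \<omega>) {0<..1}"
    using AE_received_le by eventually_elim simp
  ultimately have eq0: "AE \<omega> in M. G \<omega> {0<..1} = emeasure (\<eta> \<omega>) {0<..1}"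
    using intensity_finite intensity_eq by (intro AE_eq_if_nn_integral_eq) auto
  have "AE \<omega> in M. G \<omega> (unit_Ioc j) = emeasure (\<eta> \<omega>) (unit_Ioc j)" for j
    using AE_flow[OF eq0, of "real_of_int j"] AE_translate
  proof eventually_elim
    case (elim \<omega>)
    have e: "{x. x - real_of_int j \<in> {0<..1}} = unit_Ioc j" "{x. x - real_of_int j \<in> UNIV} = UNIV" by auto
    have "G (\<theta> (real_of_int j) \<omega>) {0<..1} = G \<omega> (unit_Ioc j)"
      using elim moved_translate[OF lf, of \<omega> \<omega> UNIV "{0<..1}" "real_of_int j"] unfolding e by (simp add: moved_UNIV)
    moreover have "emeasure (\<eta> (\<theta> (real_of_int j) \<omega>)) {0<..1} = emeasure (\<eta> \<omega>) (unit_Ioc j)"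
      using elim lf_borel.emeasure_translate[OF lf(2), of \<omega> "{0<..1}" "real_of_int j"] unfolding e by simp
    ultimately show ?case using elim by simp
  qed
  then have "AE \<omega> in M. \<forall>j. G \<omega> (unit_Ioc j) = emeasure (\<eta> \<omega>) (unit_Ioc j)" by (simp add: AE_all_countable)
  then show ?thesis using AE_pair
    by eventually_elim (simp add: singular_pair.received_eq_if_Ioc_eq)
qed

end

section \<open>The allocation balances the two random measures\<close>

lemma locally_finite_iff:
  assumes "sets \<mu> = sets borel"
  shows "locally_finite \<mu> \<longleftrightarrow> (\<forall>n. emeasure \<mu> {- real n..real n} < \<infinity>)"
proof
  assume "\<forall>n. emeasure \<mu> {- real n..real n} < \<infinity>"
  show "locally_finite \<mu>"
    unfolding locally_finite_def
  proof safe
    fix C :: "real set" assume "compact C"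
    then obtain a where a: "\<And>x. x \<in> C \<Longrightarrow> \<bar>x\<bar> \<le> a"
      using compact_imp_bounded[of C] by (auto simp: bounded_iff)
    obtain n where "a \<le> real n" using real_arch_simple by blast
    then have "C \<subseteq> {- real n..real n}" using a by fastforce
    then have "emeasure \<mu> C \<le> emeasure \<mu> {- real n..real n}" using assms by (intro emeasure_mono) auto
    then show "emeasure \<mu> C < \<infinity>" using \<open>\<forall>n. _ < _\<close> order.strict_trans1 by blast
  qed
qed (simp add: locally_finite_def)

lemma lf_borel_null_measure: "lf_borel (null_measure borel)"
  by (rule lf_borelI_Ioc) simp_all

text \<open>By stationarity \<open>\<xi>{x}\<close> has the same expectation for all \<open>x\<close>, and infinitely many points of
  \<open>[0,1]\<close> share a finite expected mass; so this expectation is \<open>0\<close>.\<close>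

lemma (in ergodic_flow) intensity_Ioc:
  assumes \<xi>: "lf_kernel M \<xi>" and inv: "AE \<omega> in M. \<forall>t. \<xi> (\<theta> t \<omega>) = translate t (\<xi> \<omega>)"
    and fin: "intensity M \<xi> < \<infinity>"
  shows "(\<integral>\<^sup>+\<omega>. emeasure (\<xi> \<omega>) {0<..1} \<partial>M) = intensity M \<xi>"
proof -
  have [measurable]: "(\<lambda>\<omega>. emeasure (\<xi> \<omega>) C) \<in> borel_measurable M" if "C \<in> sets borel" for C
    using \<xi> that by (simp add: lf_kernel_def)
  define p where "p = (\<integral>\<^sup>+\<omega>. emeasure (\<xi> \<omega>) {0} \<partial>M)"
  have p: "(\<integral>\<^sup>+\<omega>. emeasure (\<xi> \<omega>) {x} \<partial>M) = p" for x
  proof -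
    have "p = (\<integral>\<^sup>+\<omega>. emeasure (\<xi> (\<theta> x \<omega>)) {0} \<partial>M)"
      unfolding p_def by (rule nn_integral_flow[symmetric]) simp
    also have "\<dots> = (\<integral>\<^sup>+\<omega>. emeasure (\<xi> \<omega>) {x} \<partial>M)"
    proof (rule nn_integral_cong_AE)
      show "AE \<omega> in M. emeasure (\<xi> (\<theta> x \<omega>)) {0} = emeasure (\<xi> \<omega>) {x}"
        using inv AE_space
      proof eventually_elim
        case (elim \<omega>)
        have "{y. y - x \<in> {0}} = {x}" by auto
        then show ?case
          using elim lf_borel.emeasure_translate[OF lf_kernelD(1)[OF \<xi>], of \<omega> "{0}" x] by simp
      qed
    qed
    finally show ?thesis ..
  qed
  define x where "x k = 1 / real (Suc k)" for k
  have "(\<integral>\<^sup>+k. p \<partial>count_space (UNIV :: nat set)) = (\<integral>\<^sup>+k. \<integral>\<^sup>+\<omega>. emeasure (\<xi> \<omega>) {x k} \<partial>M \<partial>count_space UNIV)"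
    by (simp add: p)
  also have "\<dots> = (\<integral>\<^sup>+\<omega>. \<integral>\<^sup>+k. emeasure (\<xi> \<omega>) {x k} \<partial>count_space UNIV \<partial>M)"
    by (rule nn_integral_count_space_nn_integral[symmetric]) auto
  also have "\<dots> \<le> intensity M \<xi>"
    unfolding intensity_def
  proof (rule nn_integral_mono)
    fix \<omega> assume "\<omega> \<in> space M"
    then interpret lf_borel "\<xi> \<omega>" using lf_kernelD(1)[OF \<xi>] by blast
    have "(\<integral>\<^sup>+k. emeasure (\<xi> \<omega>) {x k} \<partial>count_space UNIV) = emeasure (\<xi> \<omega>) (\<Union>k\<in>UNIV. {x k})"
      by (intro emeasure_UN_countable[symmetric]) (auto simp: disjoint_family_on_def x_def)
    also have "\<dots> \<le> emeasure (\<xi> \<omega>) {0..1}"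
      by (intro emeasure_mono) (auto simp: x_def divide_le_eq)
    finally show "(\<integral>\<^sup>+k. emeasure (\<xi> \<omega>) {x k} \<partial>count_space UNIV) \<le> emeasure (\<xi> \<omega>) {0..1}" .
  qed
  finally have "p * \<infinity> < \<infinity>" using fin by (simp add: nn_integral_const)
  then have p0: "p = 0" by (cases "p = 0") (auto simp: ennreal_mult_top)
  have "intensity M \<xi> = (\<integral>\<^sup>+\<omega>. emeasure (\<xi> \<omega>) {0} + emeasure (\<xi> \<omega>) {0<..1} \<partial>M)"
    unfolding intensity_def
  proof (rule nn_integral_cong)
    fix \<omega> assume "\<omega> \<in> space M"
    then interpret lf_borel "\<xi> \<omega>" using lf_kernelD(1)[OF \<xi>] by blast
    have "emeasure (\<xi> \<omega>) {0} + emeasure (\<xi> \<omega>) {0<..1} = emeasure (\<xi> \<omega>) ({0} \<union> {0<..1})"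
      by (rule plus_emeasure) auto
    also have "{0} \<union> {0<..1} = {0..1::real}" by auto
    finally show "emeasure (\<xi> \<omega>) {0..1} = emeasure (\<xi> \<omega>) {0} + emeasure (\<xi> \<omega>) {0<..1}" ..
  qed
  also have "\<dots> = p + (\<integral>\<^sup>+\<omega>. emeasure (\<xi> \<omega>) {0<..1} \<partial>M)"
    unfolding p_def by (rule nn_integral_add) auto
  finally show ?thesis using p0 by simp
qed

lemma translate_eqI:
  assumes \<mu>: "lf_borel \<mu>" and \<mu>': "sets \<mu>' = sets borel"
    and eq: "\<And>C. C \<in> sets borel \<Longrightarrow> emeasure \<mu>' ((\<lambda>x. x - t) ` C) = emeasure \<mu> C"
  shows "\<mu>' = translate t \<mu>"
proof (rule measure_eqI)
  fix A assume "A \<in> sets \<mu>'"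
  then have A: "A \<in> sets borel" using \<mu>' by simp
  have "y \<in> (\<lambda>x. x - t) ` {x. x - t \<in> A}" if "y \<in> A" for y
    by (rule image_eqI[of _ _ "y + t"]) (use that in auto)
  then have "(\<lambda>x. x - t) ` {x. x - t \<in> A} = A" by auto
  then show "emeasure \<mu>' A = emeasure (translate t \<mu>) A"
    using eq[OF sets_translate_vimage[OF A, of t]] lf_borel.emeasure_translate[OF \<mu> A] by simp
qed (simp add: \<mu>')

theorem theorem3p2:
  fixes M :: "'a measure" and \<theta> :: "real \<Rightarrow> 'a \<Rightarrow> 'a" and \<xi> \<eta> :: "'a \<Rightarrow> real measure"
  assumes "ergodic_flow M \<theta>"
    and "invariant_random_measure M \<theta> \<xi>"
    and "invariant_random_measure M \<theta> \<eta>"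
    and "AE \<omega> in M. mutually_singular (\<xi> \<omega>) (\<eta> \<omega>)"
    and "intensity M \<xi> < \<infinity>" and "intensity M \<eta> < \<infinity>"
    and "intensity M \<xi> = intensity M \<eta>"
    and "AE \<omega> in M. emeasure (\<xi> \<omega>) UNIV = 0 \<or> emeasure (\<xi> \<omega>) UNIV = \<infinity>"
  shows "transport_kernel
      (restrict_space M {\<omega>. locally_finite (\<xi> \<omega>) \<and> locally_finite (\<eta> \<omega>)}) (K_tau \<xi> \<eta>)
    \<and> balances M (K_tau \<xi> \<eta>) \<xi> \<eta>"
proof -
  interpret ergodic_flow M \<theta> by fact
  define good where "good = {\<omega>. locally_finite (\<xi> \<omega>) \<and> locally_finite (\<eta> \<omega>)}"
  have rm: "random_measure M \<xi>" "random_measure M \<eta>"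
    using assms(2,3) by (auto simp: invariant_random_measure_def)
  have sets: "sets (\<xi> \<omega>) = sets borel" "sets (\<eta> \<omega>) = sets borel" if "\<omega> \<in> space M" for \<omega>
    using rm that by (auto simp: random_measure_def)
  have [measurable]: "(\<lambda>\<omega>. emeasure (\<xi> \<omega>) C) \<in> borel_measurable M" "(\<lambda>\<omega>. emeasure (\<eta> \<omega>) C) \<in> borel_measurable M"
    if "C \<in> sets borel" for C using rm that by (auto simp: random_measure_def)
  have AE_good: "AE \<omega> in M. \<omega> \<in> good"
    using rm unfolding random_measure_def good_def by auto
  have lf_good: "lf_borel (\<xi> \<omega>)" "lf_borel (\<eta> \<omega>)" if "\<omega> \<in> good" "\<omega> \<in> space M" for \<omega>
    using sets that by (auto simp: lf_borel_def good_def)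
  have good_sets: "good \<inter> space M \<in> sets M"
  proof -
    have "good \<inter> space M = {\<omega> \<in> space M. (\<forall>n. emeasure (\<xi> \<omega>) {- real n..real n} < \<infinity>) \<and>
      (\<forall>n. emeasure (\<eta> \<omega>) {- real n..real n} < \<infinity>)}"
      using locally_finite_iff[OF sets(1)] locally_finite_iff[OF sets(2)] by (auto simp: good_def)
    also have "\<dots> \<in> sets M" by measurable
    finally show ?thesis .
  qed
  have "transport_kernel (restrict_space M good) (K_tau \<xi> \<eta>)"
    by (rule transport_kernel_K_tau)
      (use lf_good in \<open>auto simp: lf_kernel_def space_restrict_space intro!: measurable_restrict_space1\<close>)
  moreover have "balances M (K_tau \<xi> \<eta>) \<xi> \<eta>"
  proof -
    \<comment> \<open>off a null set nothing changes, and the modified measures are locally finite for every \<open>\<omega>\<close>\<close>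
    define \<xi>' where "\<xi>' \<omega> = (if \<omega> \<in> good then \<xi> \<omega> else null_measure borel)" for \<omega>
    define \<eta>' where "\<eta>' \<omega> = (if \<omega> \<in> good then \<eta> \<omega> else null_measure borel)" for \<omega>
    have lf': "lf_kernel M \<xi>'" "lf_kernel M \<eta>'"
    proof -
      have "(\<lambda>\<omega>. emeasure (\<xi>' \<omega>) C) \<in> borel_measurable M" "(\<lambda>\<omega>. emeasure (\<eta>' \<omega>) C) \<in> borel_measurable M"
        if "C \<in> sets borel" for C
      proof -
        have *: "emeasure (\<xi>' \<omega>) C = emeasure (\<xi> \<omega>) C * indicator (good \<inter> space M) \<omega>"
          "emeasure (\<eta>' \<omega>) C = emeasure (\<eta> \<omega>) C * indicator (good \<inter> space M) \<omega>" if "\<omega> \<in> space M" for \<omega>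
          using that by (auto simp: \<xi>'_def \<eta>'_def)
        show "(\<lambda>\<omega>. emeasure (\<xi>' \<omega>) C) \<in> borel_measurable M" "(\<lambda>\<omega>. emeasure (\<eta>' \<omega>) C) \<in> borel_measurable M"
          using that good_sets by (simp_all add: * cong: measurable_cong)
      qed
      then show "lf_kernel M \<xi>'" "lf_kernel M \<eta>'"
        using lf_good lf_borel_null_measure by (auto simp: lf_kernel_def \<xi>'_def \<eta>'_def)
    qed
    have eq: "AE \<omega> in M. \<xi>' \<omega> = \<xi> \<omega> \<and> \<eta>' \<omega> = \<eta> \<omega>"
      using AE_good by eventually_elim (simp add: \<xi>'_def \<eta>'_def)
    have inv: "AE \<omega> in M. \<forall>t. \<xi>' (\<theta> t \<omega>) = translate t (\<xi>' \<omega>) \<and> \<eta>' (\<theta> t \<omega>) = translate t (\<eta>' \<omega>)"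
    proof -
      have "AE \<omega> in M. \<forall>C\<in>sets borel. \<forall>t. emeasure (\<xi> (\<theta> t \<omega>)) ((\<lambda>x. x - t) ` C) = emeasure (\<xi> \<omega>) C"
        "AE \<omega> in M. \<forall>C\<in>sets borel. \<forall>t. emeasure (\<eta> (\<theta> t \<omega>)) ((\<lambda>x. x - t) ` C) = emeasure (\<eta> \<omega>) C"
        using assms(2,3) by (auto simp: invariant_random_measure_def)
      then show ?thesis using AE_good AE_space
      proof (eventually_elim, intro allI)
        fix \<omega> t
        assume i: "\<forall>C\<in>sets borel. \<forall>t. emeasure (\<xi> (\<theta> t \<omega>)) ((\<lambda>x. x - t) ` C) = emeasure (\<xi> \<omega>) C"
          "\<forall>C\<in>sets borel. \<forall>t. emeasure (\<eta> (\<theta> t \<omega>)) ((\<lambda>x. x - t) ` C) = emeasure (\<eta> \<omega>) C"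
          and w: "\<omega> \<in> good" "\<omega> \<in> space M"
        have 1: "\<xi> (\<theta> t \<omega>) = translate t (\<xi> \<omega>)" "\<eta> (\<theta> t \<omega>) = translate t (\<eta> \<omega>)"
          using i w lf_good sets flow_in_space by (auto intro!: translate_eqI)
        have "\<theta> t \<omega> \<in> good"
          using lf_borel.lf_borel_translate[OF lf_good(1)[OF w], of t] lf_borel.lf_borel_translate[OF lf_good(2)[OF w], of t]
          by (simp add: good_def 1 lf_borel_def)
        then show "\<xi>' (\<theta> t \<omega>) = translate t (\<xi>' \<omega>) \<and> \<eta>' (\<theta> t \<omega>) = translate t (\<eta>' \<omega>)"
          using w 1 by (simp add: \<xi>'_def \<eta>'_def)
      qed
    qed
    have inv': "AE \<omega> in M. \<forall>t. \<xi>' (\<theta> t \<omega>) = translate t (\<xi>' \<omega>)" "AE \<omega> in M. \<forall>t. \<eta>' (\<theta> t \<omega>) = translate t (\<eta>' \<omega>)"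
      using inv by (eventually_elim, simp)+
    have int: "intensity M \<xi>' = intensity M \<xi>" "intensity M \<eta>' = intensity M \<eta>"
      unfolding intensity_def by (rule nn_integral_cong_AE, use eq in eventually_elim, simp)+
    have int': "(\<integral>\<^sup>+\<omega>. emeasure (\<xi>' \<omega>) {0<..1} \<partial>M) = intensity M \<xi>" "(\<integral>\<^sup>+\<omega>. emeasure (\<eta>' \<omega>) {0<..1} \<partial>M) = intensity M \<eta>"
      using intensity_Ioc[OF lf'(1) inv'(1)] intensity_Ioc[OF lf'(2) inv'(2)] assms(5,6) int by simp_all
    interpret pair: invariant_pair M \<theta> \<xi>' \<eta>'
    proof
      show "AE \<omega> in M. mutually_singular (\<xi>' \<omega>) (\<eta>' \<omega>)"
        using assms(4) eq by eventually_elim simp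
      show "AE \<omega> in M. emeasure (\<xi>' \<omega>) UNIV = 0 \<or> emeasure (\<xi>' \<omega>) UNIV = \<infinity>"
        using assms(8) eq by eventually_elim simp
    qed (use lf' inv' int' assms(5-7) in simp_all)
    show ?thesis
      unfolding balances_def
    proof
      let ?B = "{p \<in> space (M \<Otimes>\<^sub>M borel). emeasure (kern (\<xi>' (fst p)) (\<eta>' (fst p)) (snd p)) UNIV \<noteq> 1}"
      let ?N = "?B \<union> (space M - good \<inter> space M) \<times> (UNIV :: real set)"
      have "?B \<in> sets (M \<Otimes>\<^sub>M borel)"
        using pair.measurable_kern_\<omega>[of UNIV] by measurable
      moreover have "(space M - good \<inter> space M) \<times> (UNIV :: real set) \<in> sets (M \<Otimes>\<^sub>M borel)"
        using good_sets by (intro pair_measureI) auto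
      ultimately have N: "?N \<in> sets (M \<Otimes>\<^sub>M borel)" by (rule sets.Un)
      have "emeasure (campbell_measure M \<xi>) ?N = (\<integral>\<^sup>+\<omega>. emeasure (\<xi> \<omega>) (Pair \<omega> -` ?N) \<partial>M)"
        by (rule emeasure_campbell_measure[OF rm(1) N])
      also have "\<dots> = (\<integral>\<^sup>+\<omega>. 0 \<partial>M)"
      proof (rule nn_integral_cong_AE)
        show "AE \<omega> in M. emeasure (\<xi> \<omega>) (Pair \<omega> -` ?N) = 0"
          using pair.AE_kern_1 AE_good AE_space eq
        proof eventually_elim
          case (elim \<omega>)
          have "AE s in \<xi> \<omega>. s \<notin> Pair \<omega> -` ?N"
            using elim(1) unfolding elim(4)[THEN conjunct1]
            by eventually_elim (use elim in auto)
          then show ?case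
            using AE_iff_measurable[of "Pair \<omega> -` ?N" "\<xi> \<omega>" "\<lambda>s. s \<notin> Pair \<omega> -` ?N"] sets_Pair1[OF N, of \<omega>]
              sets(1)[OF elim(3)] sets_eq_imp_space_eq[OF sets(1)[OF elim(3)]] by auto
        qed
      qed
      finally have 0: "emeasure (campbell_measure M \<xi>) ?N = 0" by simp
      have sc: "sets (campbell_measure M \<xi>) = sets (M \<Otimes>\<^sub>M (borel :: real measure))"
        unfolding campbell_measure_def
        using sets.sigma_sets_eq[of "M \<Otimes>\<^sub>M (borel :: real measure)"] sets.space_closed[of "M \<Otimes>\<^sub>M (borel :: real measure)"]
        by (simp add: space_pair_measure)
      show "AE (\<omega>, s) in campbell_measure M \<xi>. emeasure (K_tau \<xi> \<eta> \<omega> s) UNIV = 1"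
      proof (rule AE_I[OF _ 0])
        show "{p \<in> space (campbell_measure M \<xi>). \<not> (case p of (\<omega>, s) \<Rightarrow> emeasure (K_tau \<xi> \<eta> \<omega> s) UNIV = 1)} \<subseteq> ?N"
        proof
          fix p assume "p \<in> {p \<in> space (campbell_measure M \<xi>). \<not> (case p of (\<omega>, s) \<Rightarrow> emeasure (K_tau \<xi> \<eta> \<omega> s) UNIV = 1)}"
          moreover obtain \<omega> s where p: "p = (\<omega>, s)" by (cases p)
          ultimately have w: "\<omega> \<in> space M" and K: "emeasure (K_tau \<xi> \<eta> \<omega> s) UNIV \<noteq> 1"
            using sets_eq_imp_space_eq[OF sc] by (auto simp: space_pair_measure)
          show "p \<in> ?N"
            using w K unfolding kern_eq_K_tau[of \<xi> \<omega> \<eta> s, symmetric]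
            by (cases "\<omega> \<in> good") (auto simp: p space_pair_measure \<xi>'_def \<eta>'_def)
        qed
      qed (use N sc in simp)
      show "AE \<omega> in M. \<forall>C\<in>sets borel. (\<integral>\<^sup>+s. emeasure (K_tau \<xi> \<eta> \<omega> s) C \<partial>\<xi> \<omega>) = emeasure (\<eta> \<omega>) C"
        using pair.AE_received_eq eq
        by eventually_elim (simp add: received_def kern_eq_K_tau)
    qed
  qed
  ultimately show ?thesis by (simp add: good_def)
qed

end
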